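(* Let $\mathfrak g$ be a Lie algebra. For any $\mathfrak g$-Hopf algebra $\mathcal F$, the pair $(\delta,\sigma)$ is a modular pair in involution for the bicrossed product Hopf algebra $\mathcal F\blacktriangleright\!\!\vartriangleleft U(\mathfrak g)$, where $\delta(f\otimes u)=\varepsilon(f)\delta_{\mathfrak g}(u)$ with $\delta_{\mathfrak g}:U(\mathfrak g)\to\mathbb C$ the character extending $X\mapsto\mathrm{Tr}(\mathrm{ad}_X)$, and $\sigma=\sigma_{\mathcal F}\otimes1$ with $\sigma_{\mathcal F}=\det[f^i_j]\in\mathcal F$ the determinant of the matrix of first order matrix coefficients of the coaction of $\mathcal F$ on $\mathfrak g$.
   Context: Everything is over $\mathbb C$; Lie algebras are finite dimensional; Sweedler notation is used ($\Delta(u)=u_{(1)}\otimes u_{(2)}$, right coactions $\nabla(u)=u_{\langle0\rangle}\otimes u_{\langle1\rangle}$). **$\mathfrak g$-Hopf algebras.** Let $\mathfrak g$ have basis $X_1,\dots,X_N$ and structure constants $[X_i,X_j]=\sum_k C^k_{ij}X_k$. Let $\mathcal F$ be a commutative Hopf algebra on which $\mathfrak g$ acts (from the left, $X\triangleright f$) by derivations. $\mathcal F$ is a $\mathfrak g$-Hopf algebra if: (1) $\mathcal F$ coacts on $\mathfrak g$ from the right by $\nabla_{\mathfrak g}(X_j)=\sum_iX_i\otimes f^i_j$, with $X_i\triangleright f^k_j-X_j\triangleright f^k_i=\sum_{s,r}C^k_{sr}f^r_if^s_j+\sum_lC^l_{ij}f^k_l$ for all $i,j,k$; (2) $\Delta(X\triangleright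 f)=X_{\langle0\rangle}\triangleright f_{(1)}\otimes X_{\langle1\rangle}f_{(2)}+f_{(1)}\otimes X\triangleright f_{(2)}$ and $\varepsilon(X\triangleright f)=0$ for all $X\in\mathfrak g$, $f\in\mathcal F$. The $f^i_j$ are the first order matrix coefficients. **Bicrossed product.** The action extends to $U(\mathfrak g)$, and the coaction extends to $\nabla:U(\mathfrak g)\to U(\mathfrak g)\otimes\mathcal F$ by $\nabla(1)=1\otimes1$, $\nabla(uv)=u_{(1)\langle0\rangle}v_{\langle0\rangle}\otimes u_{(1)\langle1\rangle}(u_{(2)}\triangleright v_{\langle1\rangle})$. The Hopf algebra $\mathcal F\blacktriangleright\!\!\vartriangleleft U(\mathfrak g)$ is $\mathcal F\otimes U(\mathfrak g)$ with product $(f\otimes u)(g\otimes v)=f(u_{(1)}\triangleright g)\otimes u_{(2)}v$, unit $1\otimes1$, coproduct $\Delta(f\otimes u)=(f_{(1)}\otimes u_{(1)\langle0\rangle})\otimes(f_{(2)}u_{(1)\langle1\rangle}\otimes u_{(2)})$, counit $\varepsilon\otimes\varepsilon$ and antipode $S(f\otimes u)=(1\otimes S(u_{\langle0\rangle}))(S(fu_{\langle1\rangle})\otimes1)$. **Modular pair in involution.** For a Hopf algebra $H$, a character (algebra map) $\delta:H\to\mathbb C$ and a group-like $\sigma\in H$ form a modular pair in involution if $\delta(\sigma)=1$ and $S_\delta^2=\mathrm{Ad}_\sigma$, where $S_\delta(h)=\delta(h_{(1)})S(h_{(2)})$ and $\mathrm{Ad}_\sigma(h)=\sigma h\sigma^{-1}$.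 *)

theory Defs
  imports "HOL-Library.Poly_Mapping" "Jordan_Normal_Form.Determinant"
begin

section \<open>Complex vector spaces\<close>

class complex_vector = ab_group_add +
  fixes scaleC :: "complex \<Rightarrow> 'a \<Rightarrow> 'a" (infixr \<open>*\<^sub>C\<close> 75)
  assumes scaleC_add_right: "a *\<^sub>C (x + y) = a *\<^sub>C x + a *\<^sub>C y"
    and scaleC_add_left: "(a + b) *\<^sub>C x = a *\<^sub>C x + b *\<^sub>C x"
    and scaleC_scaleC: "a *\<^sub>C (b *\<^sub>C x) = (a * b) *\<^sub>C x"
    and scaleC_one: "1 *\<^sub>C x = x"

global_interpretation cvec: vector_space "scaleC :: complex \<Rightarrow> 'a \<Rightarrow> 'a::complex_vector"
  by unfold_locales (simp_all add: scaleC_add_right scaleC_add_left scaleC_scaleC scaleC_one)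

declare scaleC_scaleC [simp] scaleC_one [simp]

abbreviation clinear :: "('a::complex_vector \<Rightarrow> 'b::complex_vector) \<Rightarrow> bool"
  where "clinear \<equiv> Vector_Spaces.linear scaleC scaleC"

definition cbilinear :: "('a::complex_vector \<Rightarrow> 'b::complex_vector \<Rightarrow> 'c::complex_vector) \<Rightarrow> bool"
  where "cbilinear \<phi> \<longleftrightarrow> (\<forall>x. clinear (\<phi> x)) \<and> (\<forall>y. clinear (\<lambda>x. \<phi> x y))"

class complex_algebra_1 = complex_vector + ring_1 +
  assumes mult_scaleC_left: "(a *\<^sub>C x) * y = a *\<^sub>C (x * y)"
    and mult_scaleC_right: "x * (a *\<^sub>C y) = a *\<^sub>C (x * y)"

instantiation complex :: complex_algebra_1
begin
definition scaleC_complex :: "complex \<Rightarrow> complex \<Rightarrow> complex"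
  where [simp]: "c *\<^sub>C z = c * z" for z :: complex
instance by standard (simp_all add: algebra_simps)
end

lemma clinear_iff:
  "clinear f \<longleftrightarrow> (\<forall>x y. f (x + y) = f x + f y) \<and> (\<forall>c x. f (c *\<^sub>C x) = c *\<^sub>C f x)"
  by (simp add: Vector_Spaces.linear_iff cvec.vector_space_axioms)

lemma clinearI:
  assumes "\<And>x y. f (x + y) = f x + f y" "\<And>c x. f (c *\<^sub>C x) = c *\<^sub>C f x"
  shows "clinear f"
  using assms by (simp add: clinear_iff)

lemma clinearD:
  assumes "clinear f"
  shows "f (x + y) = f x + f y" "f (c *\<^sub>C x) = c *\<^sub>C f x" "f 0 = 0" "f (- x) = - f x"
    "f (x - y) = f x - f y"
proof -
  interpret l: Vector_Spaces.linear scaleC scaleC f by (rule assms)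
  show "f (x + y) = f x + f y" "f (c *\<^sub>C x) = c *\<^sub>C f x" "f 0 = 0" "f (- x) = - f x"
    "f (x - y) = f x - f y"
    by (rule l.add l.scale l.zero l.neg l.diff)+
qed

lemma clinear_sum: "clinear f \<Longrightarrow> f (sum g A) = (\<Sum>x\<in>A. f (g x))"
  using module_hom.sum Vector_Spaces.linear.axioms(3) by blast

lemma cbilinearD:
  assumes "cbilinear \<phi>"
  shows "clinear (\<phi> x)" "clinear (\<lambda>x. \<phi> x y)"
  using assms by (auto simp: cbilinear_def)

lemma cbilinear_iff:
  "cbilinear \<phi> \<longleftrightarrow>
    (\<forall>x y z. \<phi> (x + y) z = \<phi> x z + \<phi> y z) \<and> (\<forall>x y z. \<phi> x (y + z) = \<phi> x y + \<phi> x z) \<and>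
    (\<forall>c x y. \<phi> (c *\<^sub>C x) y = c *\<^sub>C \<phi> x y) \<and> (\<forall>c x y. \<phi> x (c *\<^sub>C y) = c *\<^sub>C \<phi> x y)"
  by (auto simp: cbilinear_def clinear_iff)


section \<open>The free vector space on a set\<close>

instantiation poly_mapping :: (type, complex_vector) complex_vector
begin
lift_definition scaleC_poly_mapping :: "complex \<Rightarrow> ('a \<Rightarrow>\<^sub>0 'b) \<Rightarrow> 'a \<Rightarrow>\<^sub>0 'b"
  is "\<lambda>c p k. c *\<^sub>C p k"
  by (auto elim!: finite_subset[rotated])
instance
  by standard (transfer, auto simp: fun_eq_iff scaleC_add_right scaleC_add_left)+
end

definition free_ext :: "('k \<Rightarrow> 'v::complex_vector) \<Rightarrow> ('k \<Rightarrow>\<^sub>0 complex) \<Rightarrow> 'v"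
  where "free_ext h p = (\<Sum>k\<in>Poly_Mapping.keys p. Poly_Mapping.lookup p k *\<^sub>C h k)"

lemma lookup_scaleC [simp]: "Poly_Mapping.lookup (c *\<^sub>C p) k = c *\<^sub>C Poly_Mapping.lookup p k"
  by transfer simp

lemma scaleC_single: "c *\<^sub>C Poly_Mapping.single k a = Poly_Mapping.single k (c *\<^sub>C a)"
  by (rule poly_mapping_eqI) (simp add: lookup_single when_def)

lemma free_ext_superset:
  assumes "finite K" "Poly_Mapping.keys p \<subseteq> K"
  shows "free_ext h p = (\<Sum>k\<in>K. Poly_Mapping.lookup p k *\<^sub>C h k)"
  unfolding free_ext_def
  by (rule sum.mono_neutral_left) (use assms in \<open>auto simp: in_keys_iff\<close>)

lemma free_ext_single [simp]: "free_ext h (Poly_Mapping.single k c) = c *\<^sub>C h k"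
  by (subst free_ext_superset[of "{k}"]) auto

lemma clinear_free_ext: "clinear (free_ext h)"
proof (rule clinearI)
  fix p q :: "'a \<Rightarrow>\<^sub>0 complex" and c :: complex
  let ?K = "Poly_Mapping.keys p \<union> Poly_Mapping.keys q"
  have "Poly_Mapping.keys (p + q) \<subseteq> ?K" by (rule Poly_Mapping.keys_add)
  then show "free_ext h (p + q) = free_ext h p + free_ext h q"
    by (subst (1 2 3) free_ext_superset[of ?K])
      (auto simp: lookup_add scaleC_add_left sum.distrib)
  have "Poly_Mapping.keys (c *\<^sub>C p) \<subseteq> Poly_Mapping.keys p" by (auto simp: in_keys_iff)
  then show "free_ext h (c *\<^sub>C p) = c *\<^sub>C free_ext h p"
    by (subst (1 2) free_ext_superset[of "Poly_Mapping.keys p"])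
      (auto simp: cvec.scale_sum_right)
qed

lemma free_induct [case_names zero single add]:
  fixes p :: "'k \<Rightarrow>\<^sub>0 complex"
  assumes "P 0" "\<And>k c. P (Poly_Mapping.single k c)" "\<And>p q. P p \<Longrightarrow> P q \<Longrightarrow> P (p + q)"
  shows "P p"
proof -
  have p: "p = (\<Sum>k\<in>Poly_Mapping.keys p. Poly_Mapping.single k (Poly_Mapping.lookup p k))"
    by (rule poly_mapping_eqI)
      (simp add: lookup_sum lookup_single when_def in_keys_iff if_distrib cong: if_cong)
  have "P (\<Sum>k\<in>K. Poly_Mapping.single k (Poly_Mapping.lookup p k))" if "finite K" for K
    using that by induction (auto intro: assms)
  then show ?thesis by (subst p) simp
qed


section \<open>The tensor product of two vector spaces\<close>

definition tensor_relations :: "('a::complex_vector \<times> 'b::complex_vector \<Rightarrow>\<^sub>0 complex) set"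
  where "tensor_relations =
    (let e = (\<lambda>a b. Poly_Mapping.single (a, b) 1) in
      {e (a + a') b - e a b - e a' b | a a' b. True} \<union>
      {e a (b + b') - e a b - e a b' | a b b'. True} \<union>
      {e (c *\<^sub>C a) b - c *\<^sub>C e a b | c a b. True} \<union>
      {e a (c *\<^sub>C b) - c *\<^sub>C e a b | c a b. True})"

definition tensor_eq ::
  "('a::complex_vector \<times> 'b::complex_vector \<Rightarrow>\<^sub>0 complex) \<Rightarrow> ('a \<times> 'b \<Rightarrow>\<^sub>0 complex) \<Rightarrow> bool"
  where "tensor_eq p q \<longleftrightarrow> p - q \<in> cvec.span tensor_relations"

lemma cspan_equivp: "equivp (\<lambda>p q. p - q \<in> cvec.span R)"
proof (rule equivpI)
  show "reflp (\<lambda>p q. p - q \<in> cvec.span R)"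
    by (rule reflpI) (simp add: cvec.span_zero)
  show "symp (\<lambda>p q. p - q \<in> cvec.span R)"
    by (rule sympI) (metis cvec.span_neg minus_diff_eq)
  show "transp (\<lambda>p q. p - q \<in> cvec.span R)"
    by (rule transpI) (metis cvec.span_add add_diff_eq diff_add_cancel)
qed

lemma cspan_cong:
  assumes "p - p' \<in> cvec.span R"
  shows "- p - - p' \<in> cvec.span R" "c *\<^sub>C p - c *\<^sub>C p' \<in> cvec.span R"
    "q - q' \<in> cvec.span R \<Longrightarrow> (p + q) - (p' + q') \<in> cvec.span R"
    "q - q' \<in> cvec.span R \<Longrightarrow> (p - q) - (p' - q') \<in> cvec.span R"
proof -
  show "- p - - p' \<in> cvec.span R" using cvec.span_neg[OF assms] by simp
  show "c *\<^sub>C p - c *\<^sub>C p' \<in> cvec.span R"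
    using cvec.span_scale[OF assms, of c] by (simp add: cvec.scale_right_diff_distrib)
  assume q: "q - q' \<in> cvec.span R"
  show "(p + q) - (p' + q') \<in> cvec.span R"
    using cvec.span_add[OF assms q] by (simp add: algebra_simps)
  show "(p - q) - (p' - q') \<in> cvec.span R"
    using cvec.span_diff[OF assms q] by (simp add: algebra_simps)
qed

quotient_type (overloaded) ('a, 'b) tensor (infixr \<open>\<otimes>\<^sub>C\<close> 75) =
  "'a::complex_vector \<times> 'b::complex_vector \<Rightarrow>\<^sub>0 complex" / tensor_eq
  using cspan_equivp[of tensor_relations] by (simp add: tensor_eq_def[abs_def])

instantiation tensor :: (complex_vector, complex_vector) complex_vector
begin

lift_definition zero_tensor :: "'a \<otimes>\<^sub>C 'b" is 0 .

lift_definition plus_tensor :: "'a \<otimes>\<^sub>C 'b \<Rightarrow> 'a \<otimes>\<^sub>C 'b \<Rightarrow> 'a \<otimes>\<^sub>C 'b" is "(+)"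
  unfolding tensor_eq_def by (rule cspan_cong)

lift_definition uminus_tensor :: "'a \<otimes>\<^sub>C 'b \<Rightarrow> 'a \<otimes>\<^sub>C 'b" is uminus
  unfolding tensor_eq_def by (rule cspan_cong)

lift_definition minus_tensor :: "'a \<otimes>\<^sub>C 'b \<Rightarrow> 'a \<otimes>\<^sub>C 'b \<Rightarrow> 'a \<otimes>\<^sub>C 'b" is "(-)"
  unfolding tensor_eq_def by (rule cspan_cong)

lift_definition scaleC_tensor :: "complex \<Rightarrow> 'a \<otimes>\<^sub>C 'b \<Rightarrow> 'a \<otimes>\<^sub>C 'b" is scaleC
  unfolding tensor_eq_def by (rule cspan_cong)

instance
  by standard (transfer; simp add: tensor_eq_def algebra_simps cvec.span_zero
      scaleC_add_right scaleC_add_left)+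

end

lift_definition tensor_elem :: "'a::complex_vector \<Rightarrow> 'b::complex_vector \<Rightarrow> 'a \<otimes>\<^sub>C 'b"
    (infixr \<open>\<otimes>\<^sub>C\<close> 75)
  is "\<lambda>a b. Poly_Mapping.single (a, b) 1" .

text \<open>
  \<open>sweedler t \<phi>\<close> is the image of \<open>t\<close> under the linear map on the tensor product that a bilinear
  \<open>\<phi>\<close> induces. So \<open>sweedler (\<Delta> h) (\<lambda>h1 h2. E)\<close> is what Sweedler notation writes as \<open>E\<close> with
  \<open>\<Delta>(h) = h1 \<otimes> h2\<close>. The value is independent of the chosen representative when \<open>\<phi>\<close> is
  bilinear, see \<open>sweedler_abs\<close>.
\<close>
definition sweedler ::
  "'a::complex_vector \<otimes>\<^sub>C 'b::complex_vector \<Rightarrow> ('a \<Rightarrow> 'b \<Rightarrow> 'c::complex_vector) \<Rightarrow> 'c"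
  where "sweedler t \<phi> = free_ext (\<lambda>(a, b). \<phi> a b) (rep_tensor t)"

lemma free_ext_tensor_relations:
  assumes "cbilinear \<phi>" "p \<in> cvec.span tensor_relations"
  shows "free_ext (\<lambda>(a, b). \<phi> a b) p = 0"
proof (rule module_hom.eq_0_on_span[OF _ _ assms(2)])
  show "module_hom scaleC scaleC (free_ext (\<lambda>(a, b). \<phi> a b))"
    by (rule Vector_Spaces.linear.axioms(3)[OF clinear_free_ext])
  show "free_ext (\<lambda>(a, b). \<phi> a b) x = 0" if "x \<in> tensor_relations" for x
    using that assms(1)
    by (auto simp: tensor_relations_def cbilinear_iff clinearD[OF clinear_free_ext])
qed

lemma sweedler_abs:
  assumes "cbilinear \<phi>"
  shows "sweedler (abs_tensor p) \<phi> = free_ext (\<lambda>(a, b). \<phi> a b) p"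
proof -
  have "tensor_eq (rep_tensor (abs_tensor p)) p"
    by (rule Quotient3_rep_abs[OF Quotient3_tensor]) (simp add: tensor_eq_def cvec.span_zero)
  then have "free_ext (\<lambda>(a, b). \<phi> a b) (rep_tensor (abs_tensor p) - p) = 0"
    by (intro free_ext_tensor_relations assms) (simp add: tensor_eq_def)
  then show ?thesis
    by (simp add: sweedler_def clinearD[OF clinear_free_ext])
qed

lemma sweedler_tensor [simp]: "cbilinear \<phi> \<Longrightarrow> sweedler (a \<otimes>\<^sub>C b) \<phi> = \<phi> a b"
  by (simp add: tensor_elem.abs_eq sweedler_abs)

lemma clinear_sweedler:
  assumes "cbilinear \<phi>"
  shows "clinear (\<lambda>t. sweedler t \<phi>)"
proof (rule clinearI)
  fix s t :: "'a \<otimes>\<^sub>C 'b" and c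
  obtain p q where pq: "s = abs_tensor p" "t = abs_tensor q"
    by (metis Quotient3_abs_rep[OF Quotient3_tensor])
  show "sweedler (s + t) \<phi> = sweedler s \<phi> + sweedler t \<phi>" "sweedler (c *\<^sub>C s) \<phi> = c *\<^sub>C sweedler s \<phi>"
    unfolding pq
    by (simp_all add: plus_tensor.abs_eq scaleC_tensor.abs_eq sweedler_abs assms
        clinearD[OF clinear_free_ext])
qed

lemma sweedler_add:
  "sweedler t (\<lambda>a b. \<phi> a b + \<psi> a b) = sweedler t \<phi> + sweedler t \<psi>"
  by (simp add: sweedler_def free_ext_def case_prod_beta scaleC_add_right sum.distrib)

lemma sweedler_scaleC: "sweedler t (\<lambda>a b. c *\<^sub>C \<phi> a b) = c *\<^sub>C sweedler t \<phi>"
  by (simp add: sweedler_def free_ext_def case_prod_beta cvec.scale_sum_right mult.commute)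

lemma clinear_of_sweedler:
  "clinear F \<Longrightarrow> F (sweedler t \<phi>) = sweedler t (\<lambda>a b. F (\<phi> a b))"
  by (simp add: sweedler_def free_ext_def case_prod_beta clinear_sum clinearD)

lemma cbilinear_tensor: "cbilinear (\<otimes>\<^sub>C)"
  unfolding cbilinear_iff
proof (intro conjI allI)
  fix x y :: 'a and z w :: 'b and c :: complex
  have *: "r \<in> tensor_relations \<Longrightarrow> tensor_eq p q" if "r = p - q"
    for r p q :: "'a \<times> 'b \<Rightarrow>\<^sub>0 complex"
    unfolding tensor_eq_def that by (rule cvec.span_base)
  show "(x + y) \<otimes>\<^sub>C z = x \<otimes>\<^sub>C z + y \<otimes>\<^sub>C z"
    unfolding tensor_elem.abs_eq plus_tensor.abs_eq tensor.abs_eq_iff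
    by (rule *[OF diff_diff_eq]) (unfold tensor_relations_def Let_def, blast)
  show "x \<otimes>\<^sub>C (z + w) = x \<otimes>\<^sub>C z + x \<otimes>\<^sub>C w"
    unfolding tensor_elem.abs_eq plus_tensor.abs_eq tensor.abs_eq_iff
    by (rule *[OF diff_diff_eq]) (unfold tensor_relations_def Let_def, blast)
  show "(c *\<^sub>C x) \<otimes>\<^sub>C z = c *\<^sub>C (x \<otimes>\<^sub>C z)"
    unfolding tensor_elem.abs_eq scaleC_tensor.abs_eq tensor.abs_eq_iff
    by (rule *[OF refl]) (unfold tensor_relations_def Let_def, blast)
  show "x \<otimes>\<^sub>C (c *\<^sub>C z) = c *\<^sub>C (x \<otimes>\<^sub>C z)"
    unfolding tensor_elem.abs_eq scaleC_tensor.abs_eq tensor.abs_eq_iff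
    by (rule *[OF refl]) (unfold tensor_relations_def Let_def, blast)
qed

lemma tensor_simps:
  "(x + y) \<otimes>\<^sub>C z = x \<otimes>\<^sub>C z + y \<otimes>\<^sub>C z" "x \<otimes>\<^sub>C (z + w) = x \<otimes>\<^sub>C z + x \<otimes>\<^sub>C w"
  "(c *\<^sub>C x) \<otimes>\<^sub>C z = c *\<^sub>C (x \<otimes>\<^sub>C z)" "x \<otimes>\<^sub>C (c *\<^sub>C z) = c *\<^sub>C (x \<otimes>\<^sub>C z)"
  using cbilinear_tensor unfolding cbilinear_iff by blast+

lemma tensor_induct [case_names zero tensor add]:
  fixes t :: "'a::complex_vector \<otimes>\<^sub>C 'b::complex_vector"
  assumes "P 0" "\<And>a b. P (a \<otimes>\<^sub>C b)" "\<And>s t. P s \<Longrightarrow> P t \<Longrightarrow> P (s + t)"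
  shows "P t"
proof -
  have "P (abs_tensor p)" for p
  proof (induction p rule: free_induct)
    case zero
    then show ?case using assms(1) by (simp add: zero_tensor_def)
  next
    case (single k c)
    obtain a b where k: "k = (a, b)" by (cases k)
    have "abs_tensor (Poly_Mapping.single k c) = c *\<^sub>C (a \<otimes>\<^sub>C b)"
      by (simp add: k tensor_elem.abs_eq scaleC_tensor.abs_eq scaleC_single)
    also have "\<dots> = (c *\<^sub>C a) \<otimes>\<^sub>C b"
      by (simp add: tensor_simps)
    finally show ?case using assms(2) by simp
  next
    case (add p q)
    then show ?case using assms(3) by (simp add: plus_tensor.abs_eq[symmetric])
  qed
  then show ?thesis by (metis Quotient3_abs_rep[OF Quotient3_tensor])
qed

lemma clinear_tensor_eqI:
  fixes t :: "'a::complex_vector \<otimes>\<^sub>C 'b::complex_vector"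
  assumes "clinear F" "clinear G" "\<And>a b. F (a \<otimes>\<^sub>C b) = G (a \<otimes>\<^sub>C b)"
  shows "F t = G t"
  by (induction t rule: tensor_induct) (simp_all add: clinearD[OF assms(1)] clinearD[OF assms(2)] assms(3))


section \<open>Lie algebras and their universal enveloping algebras\<close>

class complex_lie_algebra = complex_vector +
  fixes lie_bracket :: "'a \<Rightarrow> 'a \<Rightarrow> 'a"
  assumes lie_add_left: "lie_bracket (x + y) z = lie_bracket x z + lie_bracket y z"
    and lie_scaleC_left: "lie_bracket (c *\<^sub>C x) z = c *\<^sub>C lie_bracket x z"
    and lie_add_right: "lie_bracket x (y + z) = lie_bracket x y + lie_bracket x z"
    and lie_scaleC_right: "lie_bracket x (c *\<^sub>C z) = c *\<^sub>C lie_bracket x z"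
    and lie_alternating: "lie_bracket x x = 0"
    and lie_jacobi: "lie_bracket x (lie_bracket y z) + lie_bracket y (lie_bracket z x) +
      lie_bracket z (lie_bracket x y) = 0"

text \<open>
  Words under concatenation, written additively because \<open>'a free_word \<Rightarrow>\<^sub>0 complex\<close> then
  carries the ring structure of the free algebra on the set \<open>'a\<close>.
\<close>
datatype 'a free_word = Word "'a list"

instantiation free_word :: (type) monoid_add
begin
definition zero_free_word :: "'a free_word" where "0 = Word []"
fun plus_free_word :: "'a free_word \<Rightarrow> 'a free_word \<Rightarrow> 'a free_word"
  where "Word xs + Word ys = Word (xs @ ys)"
instance
proof
  fix a b c :: "'a free_word"
  show "a + b + c = a + (b + c)" by (cases a; cases b; cases c) simp
  show "0 + a = a" by (cases a) (simp add: zero_free_word_def)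
  show "a + 0 = a" by (cases a) (simp add: zero_free_word_def)
qed
end

type_synonym 'a free_algebra = "'a free_word \<Rightarrow>\<^sub>0 complex"

definition letter :: "'a \<Rightarrow> 'a free_algebra"
  where "letter x = Poly_Mapping.single (Word [x]) 1"

text \<open>
  The first two families cut the free algebra on the set \<open>'g\<close> down to the tensor algebra of
  the vector space \<open>'g\<close>.
\<close>
definition uenv_relations :: "'g::complex_lie_algebra free_algebra set"
  where "uenv_relations =
    {letter (x + y) - letter x - letter y | x y. True} \<union>
    {letter (c *\<^sub>C x) - c *\<^sub>C letter x | c x. True} \<union>
    {letter x * letter y - letter y * letter x - letter (lie_bracket x y) | x y. True}"

definition uenv_ideal :: "'g::complex_lie_algebra free_algebra set"
  where "uenv_ideal = cvec.span {a * r * b | a r b. r \<in> uenv_relations}"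

definition uenv_eq :: "'g::complex_lie_algebra free_algebra \<Rightarrow> 'g free_algebra \<Rightarrow> bool"
  where "uenv_eq p q \<longleftrightarrow> p - q \<in> uenv_ideal"

quotient_type (overloaded) 'g uenv = "'g::complex_lie_algebra free_algebra" / uenv_eq
  using cspan_equivp by (simp add: uenv_eq_def[abs_def] uenv_ideal_def)

lemma free_algebra_scaleC:
  fixes p q :: "'a free_algebra"
  shows "c *\<^sub>C p * q = c *\<^sub>C (p * q)" "p * (c *\<^sub>C q) = c *\<^sub>C (p * q)"
proof -
  have l: "c *\<^sub>C p = Poly_Mapping.single 0 c * p" for p :: "'a free_algebra"
    by (induction p rule: free_induct)
      (simp_all add: mult_single scaleC_single scaleC_add_right distrib_left)
  have r: "c *\<^sub>C p = p * Poly_Mapping.single 0 c" for p :: "'a free_algebra"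
    by (induction p rule: free_induct)
      (simp_all add: mult_single scaleC_single scaleC_add_right distrib_right mult.commute)
  show "c *\<^sub>C p * q = c *\<^sub>C (p * q)" by (simp add: l mult.assoc)
  show "p * (c *\<^sub>C q) = c *\<^sub>C (p * q)" by (simp add: r mult.assoc)
qed

lemma uenv_ideal_mult:
  assumes "p \<in> uenv_ideal"
  shows "a * p \<in> uenv_ideal" "p * a \<in> uenv_ideal"
proof -
  let ?S = "{a * r * b | a r b. r \<in> uenv_relations}"
  have l: "clinear (\<lambda>p. a * p)" and r: "clinear (\<lambda>p. p * a)"
    by (rule clinearI; simp add: distrib_left distrib_right free_algebra_scaleC)+
  have "(\<lambda>p. a * p) ` cvec.span ?S \<subseteq> cvec.span ((\<lambda>p. a * p) ` ?S)"
    by (simp add: module_hom.span_image[OF Vector_Spaces.linear.axioms(3)[OF l]])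
  also have "\<dots> \<subseteq> cvec.span ?S"
    by (rule cvec.span_mono) (auto, metis mult.assoc)
  finally show "a * p \<in> uenv_ideal" using assms by (auto simp: uenv_ideal_def)
  have "(\<lambda>p. p * a) ` cvec.span ?S \<subseteq> cvec.span ((\<lambda>p. p * a) ` ?S)"
    by (simp add: module_hom.span_image[OF Vector_Spaces.linear.axioms(3)[OF r]])
  also have "\<dots> \<subseteq> cvec.span ?S"
    by (rule cvec.span_mono) (auto, metis mult.assoc)
  finally show "p * a \<in> uenv_ideal" using assms by (auto simp: uenv_ideal_def)
qed

text \<open>
  The action on a vector space that a family \<open>\<rho>\<close> of endomorphisms indexed by \<open>'g\<close> induces, first on
  words and then on the free algebra.
\<close>
fun word_act :: "('g \<Rightarrow> 'v \<Rightarrow> 'v) \<Rightarrow> 'g free_word \<Rightarrow> 'v \<Rightarrow> 'v"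
  where "word_act \<rho> (Word xs) v = foldr \<rho> xs v"

definition free_act :: "('g \<Rightarrow> 'v::complex_vector \<Rightarrow> 'v) \<Rightarrow> 'g free_algebra \<Rightarrow> 'v \<Rightarrow> 'v"
  where "free_act \<rho> p v = free_ext (\<lambda>w. word_act \<rho> w v) p"

definition lie_representation :: "('g::complex_lie_algebra \<Rightarrow> 'v::complex_vector \<Rightarrow> 'v) \<Rightarrow> bool"
  where "lie_representation \<rho> \<longleftrightarrow> cbilinear \<rho> \<and>
    (\<forall>x y v. \<rho> (lie_bracket x y) v = \<rho> x (\<rho> y v) - \<rho> y (\<rho> x v))"

lemma word_act_add: "word_act \<rho> (w + w') v = word_act \<rho> w (word_act \<rho> w' v)"
  by (cases w; cases w') simp

lemma clinear_word_act:
  assumes "\<And>x. clinear (\<rho> x)"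
  shows "clinear (word_act \<rho> w)"
proof (cases w)
  case (Word xs)
  have "clinear (foldr \<rho> xs)"
    by (induction xs) (auto simp: clinear_iff clinearD[OF assms])
  then show ?thesis by (simp add: Word clinear_iff)
qed

lemma clinear_free_act:
  assumes "\<And>x. clinear (\<rho> x)"
  shows "clinear (free_act \<rho> p)"
  unfolding free_act_def free_ext_def
  by (rule clinearI) (simp_all add: clinearD[OF clinear_word_act[OF assms]] scaleC_add_right
    sum.distrib cvec.scale_sum_right mult.commute)

lemma clinear_free_act_left: "clinear (\<lambda>p. free_act \<rho> p v)"
  unfolding free_act_def by (rule clinear_free_ext)

lemma free_act_mult:
  assumes "\<And>x. clinear (\<rho> x)"
  shows "free_act \<rho> (p * q) v = free_act \<rho> p (free_act \<rho> q v)"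
proof (induction p rule: free_induct)
  case zero
  then show ?case by (simp add: clinearD[OF clinear_free_act_left])
next
  case (single k c)
  show ?case
  proof (induction q rule: free_induct)
    case zero
    then show ?case
      by (simp add: clinearD[OF clinear_free_act_left] clinearD[OF clinear_free_act[OF assms]])
  next
    case (single k' c')
    then show ?case
      by (simp add: free_act_def mult_single word_act_add clinearD[OF clinear_word_act[OF assms]])
  next
    case (add p q)
    then show ?case
      by (simp add: distrib_left clinearD[OF clinear_free_act_left]
          clinearD[OF clinear_free_act[OF assms]])
  qed
next
  case (add p q)
  then show ?case by (simp add: distrib_right clinearD[OF clinear_free_act_left])
qed

lemma free_act_letter [simp]: "free_act \<rho> (letter x) v = \<rho> x v"
  by (simp add: free_act_def letter_def)

lemma free_act_one [simp]: "free_act \<rho> 1 v = v"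
  by (simp add: free_act_def single_one[symmetric] zero_free_word_def del: single_one)

lemma free_act_ideal:
  assumes "lie_representation \<rho>" "p \<in> uenv_ideal"
  shows "free_act \<rho> p v = 0"
proof -
  have lin: "clinear (\<rho> x)" for x
    using assms(1) by (simp add: lie_representation_def cbilinear_def)
  note S = free_act_mult[OF lin] clinearD[OF clinear_free_act_left] clinearD[OF clinear_free_act[OF lin]]
  have rel: "free_act \<rho> r v = 0" if "r \<in> uenv_relations" for r v
    using that assms(1) by (auto simp: uenv_relations_def lie_representation_def cbilinear_iff S)
  show ?thesis
    using assms(2) unfolding uenv_ideal_def
    by (rule module_hom.eq_0_on_span[OF Vector_Spaces.linear.axioms(3)[OF clinear_free_act_left], rotated])
      (auto simp: S rel)
qed

lemma one_notin_uenv_ideal: "1 \<notin> (uenv_ideal :: 'g::complex_lie_algebra free_algebra set)"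
proof
  let ?\<rho> = "\<lambda>(x::'g) (v::complex). 0 :: complex"
  assume "1 \<in> (uenv_ideal :: 'g free_algebra set)"
  moreover have "lie_representation ?\<rho>" by (simp add: lie_representation_def cbilinear_iff)
  ultimately have "free_act ?\<rho> 1 1 = 0" by (intro free_act_ideal)
  then show False by simp
qed

instantiation uenv :: (complex_lie_algebra) complex_algebra_1
begin

lift_definition zero_uenv :: "'a uenv" is 0 .
lift_definition one_uenv :: "'a uenv" is 1 .

lift_definition plus_uenv :: "'a uenv \<Rightarrow> 'a uenv \<Rightarrow> 'a uenv" is "(+)"
  unfolding uenv_eq_def uenv_ideal_def by (rule cspan_cong)

lift_definition uminus_uenv :: "'a uenv \<Rightarrow> 'a uenv" is uminus
  unfolding uenv_eq_def uenv_ideal_def by (rule cspan_cong)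

lift_definition minus_uenv :: "'a uenv \<Rightarrow> 'a uenv \<Rightarrow> 'a uenv" is "(-)"
  unfolding uenv_eq_def uenv_ideal_def by (rule cspan_cong)

lift_definition scaleC_uenv :: "complex \<Rightarrow> 'a uenv \<Rightarrow> 'a uenv" is scaleC
  unfolding uenv_eq_def uenv_ideal_def by (rule cspan_cong)

lift_definition times_uenv :: "'a uenv \<Rightarrow> 'a uenv \<Rightarrow> 'a uenv" is "(*)"
proof -
  fix p p' q q' :: "'a free_algebra"
  assume "uenv_eq p p'" "uenv_eq q q'"
  then have "p * (q - q') + (p - p') * q' \<in> uenv_ideal"
    unfolding uenv_eq_def using uenv_ideal_mult[of "q - q'" p] uenv_ideal_mult[of "p - p'" q']
    by (simp add: uenv_ideal_def cvec.span_add)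
  then show "uenv_eq (p * q) (p' * q')"
    by (simp add: uenv_eq_def algebra_simps)
qed

instance
proof
  show "0 \<noteq> (1 :: 'a uenv)"
  proof
    assume "0 = (1 :: 'a uenv)"
    then have "uenv_eq 0 (1 :: 'a free_algebra)" by transfer
    then have "- (0 - 1) \<in> (uenv_ideal :: 'a free_algebra set)"
      unfolding uenv_eq_def uenv_ideal_def by (rule cvec.span_neg)
    then show False by (simp add: one_notin_uenv_ideal)
  qed
qed (transfer; simp add: uenv_eq_def uenv_ideal_def cvec.span_zero algebra_simps
      scaleC_add_right scaleC_add_left free_algebra_scaleC)+

end

lift_definition uenv_of :: "'g::complex_lie_algebra \<Rightarrow> 'g uenv" is letter .

lemma uenv_of_simps:
  "uenv_of (x + y) = uenv_of x + uenv_of y" "uenv_of (c *\<^sub>C x) = c *\<^sub>C uenv_of x"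
  "uenv_of (lie_bracket x y) = uenv_of x * uenv_of y - uenv_of y * uenv_of x"
proof -
  have *: "r \<in> uenv_relations \<Longrightarrow> r \<in> uenv_ideal" for r :: "'a free_algebra"
    unfolding uenv_ideal_def by (rule cvec.span_base) (metis (mono_tags, lifting) mem_Collect_eq mult_1 mult.right_neutral)
  have neg: "p - q \<in> uenv_ideal \<Longrightarrow> q - p \<in> uenv_ideal" for p q :: "'a free_algebra"
    using cvec.span_neg[of "p - q"] by (simp add: uenv_ideal_def)
  have "letter (x + y) - letter x - letter y \<in> uenv_relations"
    "letter (c *\<^sub>C x) - c *\<^sub>C letter x \<in> uenv_relations"
    "letter x * letter y - letter y * letter x - letter (lie_bracket x y) \<in> uenv_relations"
    unfolding uenv_relations_def by blast+
  note r = this[THEN *]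
  show "uenv_of (x + y) = uenv_of x + uenv_of y"
    unfolding uenv_of.abs_eq plus_uenv.abs_eq uenv.abs_eq_iff uenv_eq_def
    using r(1) by (simp add: diff_diff_eq)
  show "uenv_of (c *\<^sub>C x) = c *\<^sub>C uenv_of x"
    unfolding uenv_of.abs_eq scaleC_uenv.abs_eq uenv.abs_eq_iff uenv_eq_def by (rule r(2))
  show "uenv_of (lie_bracket x y) = uenv_of x * uenv_of y - uenv_of y * uenv_of x"
    unfolding uenv_of.abs_eq times_uenv.abs_eq minus_uenv.abs_eq uenv.abs_eq_iff uenv_eq_def
    by (rule neg[OF r(3)])
qed

lemma uenv_induct [case_names one gen add scaleC]:
  fixes u :: "'g::complex_lie_algebra uenv"
  assumes "P 1" "\<And>x u. P u \<Longrightarrow> P (uenv_of x * u)" "\<And>u v. P u \<Longrightarrow> P v \<Longrightarrow> P (u + v)"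
    "\<And>c u. P u \<Longrightarrow> P (c *\<^sub>C u)"
  shows "P u"
proof -
  have word: "P (abs_uenv (Poly_Mapping.single (Word xs) 1))" for xs :: "'g list"
  proof (induction xs)
    case Nil
    then show ?case
      using assms(1) by (simp add: one_uenv_def single_one[symmetric] zero_free_word_def del: single_one)
  next
    case (Cons x xs)
    have "abs_uenv (Poly_Mapping.single (Word (x # xs)) 1) =
        uenv_of x * abs_uenv (Poly_Mapping.single (Word xs) 1)"
      by (simp add: uenv_of.abs_eq times_uenv.abs_eq letter_def mult_single)
    then show ?case using assms(2)[OF Cons.IH] by simp
  qed
  have "P (abs_uenv p)" for p
  proof (induction p rule: free_induct)
    case zero
    then show ?case using assms(4)[OF assms(1), of 0] by (simp add: zero_uenv_def)
  next
    case (single k c)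
    obtain xs where k: "k = Word xs" by (cases k)
    show ?case using assms(4)[OF word[of xs], of c]
      by (simp add: k scaleC_uenv.abs_eq scaleC_single)
  next
    case (add p q)
    then show ?case using assms(3) by (simp add: plus_uenv.abs_eq[symmetric])
  qed
  then show ?thesis by (metis Quotient3_abs_rep[OF Quotient3_uenv])
qed

lemma uenv_module_exists:
  assumes "lie_representation \<rho>"
  shows "\<exists>A. cbilinear A \<and> (\<forall>v. A 1 v = v) \<and> (\<forall>u u' v. A (u * u') v = A u (A u' v)) \<and>
    (\<forall>x v. A (uenv_of x) v = \<rho> x v)"
proof -
  define A where "A u v = free_act \<rho> (rep_uenv u) v" for u v
  have lin: "clinear (\<rho> x)" for x
    using assms by (simp add: lie_representation_def cbilinear_def)
  note S = free_act_mult[OF lin] clinearD[OF clinear_free_act_left] clinearD[OF clinear_free_act[OF lin]]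
  have abs: "A (abs_uenv p) v = free_act \<rho> p v" for p v
  proof -
    have "uenv_eq (rep_uenv (abs_uenv p)) p"
      by (rule Quotient3_rep_abs[OF Quotient3_uenv])
        (simp add: uenv_eq_def uenv_ideal_def cvec.span_zero)
    then have "free_act \<rho> (rep_uenv (abs_uenv p) - p) v = 0"
      by (intro free_act_ideal assms) (simp add: uenv_eq_def)
    then show ?thesis by (simp add: A_def S)
  qed
  have ex: "\<exists>p. u = abs_uenv p" for u
    by (metis Quotient3_abs_rep[OF Quotient3_uenv])
  have "cbilinear A"
    unfolding cbilinear_iff
  proof (intro conjI allI)
    fix u v :: "'a uenv" and x y and c
    obtain p q where pq: "u = abs_uenv p" "v = abs_uenv q" using ex by metis
    show "A (u + v) x = A u x + A v x" "A u (x + y) = A u x + A u y"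
      "A (c *\<^sub>C u) x = c *\<^sub>C A u x" "A u (c *\<^sub>C x) = c *\<^sub>C A u x"
      by (simp_all add: pq plus_uenv.abs_eq scaleC_uenv.abs_eq abs S)
  qed
  moreover have "A (u * u') v = A u (A u' v)" for u u' v
  proof -
    obtain p q where pq: "u = abs_uenv p" "u' = abs_uenv q" using ex by metis
    show ?thesis by (simp add: pq times_uenv.abs_eq abs S)
  qed
  ultimately show ?thesis
    by (intro exI[of _ A]) (simp add: one_uenv.abs_eq uenv_of.abs_eq abs)
qed


section \<open>Hopf algebras\<close>

definition tensor_mult ::
  "('a \<Rightarrow> 'a \<Rightarrow> 'a::complex_vector) \<Rightarrow> ('b \<Rightarrow> 'b \<Rightarrow> 'b::complex_vector) \<Rightarrow> 'a \<otimes>\<^sub>C 'b \<Rightarrow> 'a \<otimes>\<^sub>C 'b \<Rightarrow> 'a \<otimes>\<^sub>C 'b"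
  where "tensor_mult m n s t = sweedler s (\<lambda>a b. sweedler t (\<lambda>a' b'. m a a' \<otimes>\<^sub>C n b b'))"

locale hopf_algebra =
  fixes mul :: "'h \<Rightarrow> 'h \<Rightarrow> 'h::complex_vector" and e :: 'h
    and comult :: "'h \<Rightarrow> 'h \<otimes>\<^sub>C 'h" and counit :: "'h \<Rightarrow> complex" and antipode :: "'h \<Rightarrow> 'h"
  assumes mult_bilinear: "cbilinear mul"
    and mult_assoc: "mul (mul x y) z = mul x (mul y z)"
    and mult_unit_left: "mul e x = x" and mult_unit_right: "mul x e = x"
    and comult_linear: "clinear comult"
    and comult_coassoc:
      "sweedler (comult x) (\<lambda>a b. sweedler (comult a) (\<lambda>a1 a2. a1 \<otimes>\<^sub>C (a2 \<otimes>\<^sub>C b))) =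
       sweedler (comult x) (\<lambda>a b. sweedler (comult b) (\<lambda>b1 b2. a \<otimes>\<^sub>C (b1 \<otimes>\<^sub>C b2)))"
    and counit_linear: "clinear counit"
    and counit_left: "sweedler (comult x) (\<lambda>a b. counit a *\<^sub>C b) = x"
    and counit_right: "sweedler (comult x) (\<lambda>a b. counit b *\<^sub>C a) = x"
    and comult_mult: "comult (mul x y) = tensor_mult mul mul (comult x) (comult y)"
    and comult_unit: "comult e = e \<otimes>\<^sub>C e"
    and counit_mult: "counit (mul x y) = counit x * counit y"
    and counit_unit: "counit e = 1"
    and antipode_linear: "clinear antipode"
    and antipode_left: "sweedler (comult x) (\<lambda>a b. mul (antipode a) b) = counit x *\<^sub>C e"
    and antipode_right: "sweedler (comult x) (\<lambda>a b. mul a (antipode b)) = counit x *\<^sub>C e"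

definition algebra_character ::
  "('h \<Rightarrow> 'h \<Rightarrow> 'h::complex_vector) \<Rightarrow> 'h \<Rightarrow> ('h \<Rightarrow> complex) \<Rightarrow> bool"
  where "algebra_character mul e \<chi> \<longleftrightarrow>
    clinear \<chi> \<and> \<chi> e = 1 \<and> (\<forall>x y. \<chi> (mul x y) = \<chi> x * \<chi> y)"

definition group_like ::
  "('h::complex_vector \<Rightarrow> 'h \<otimes>\<^sub>C 'h) \<Rightarrow> ('h \<Rightarrow> complex) \<Rightarrow> 'h \<Rightarrow> bool"
  where "group_like comult counit \<sigma> \<longleftrightarrow> comult \<sigma> = \<sigma> \<otimes>\<^sub>C \<sigma> \<and> counit \<sigma> = 1"

definition twisted_antipode ::
  "('h::complex_vector \<Rightarrow> 'h \<otimes>\<^sub>C 'h) \<Rightarrow> ('h \<Rightarrow> 'h) \<Rightarrow> ('h \<Rightarrow> complex) \<Rightarrow> 'h \<Rightarrow> 'h"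
  where "twisted_antipode comult antipode \<delta> h = sweedler (comult h) (\<lambda>h1 h2. \<delta> h1 *\<^sub>C antipode h2)"

definition algebra_inverse :: "('h \<Rightarrow> 'h \<Rightarrow> 'h) \<Rightarrow> 'h \<Rightarrow> 'h \<Rightarrow> 'h"
  where "algebra_inverse mul e \<sigma> = (THE \<tau>. mul \<sigma> \<tau> = e \<and> mul \<tau> \<sigma> = e)"

text \<open>The inverse is meaningful because group-like elements of a Hopf algebra are invertible.\<close>
locale modular_pair_in_involution = hopf_algebra mul e comult counit antipode
  for mul :: "'h \<Rightarrow> 'h \<Rightarrow> 'h::complex_vector" and e comult counit antipode +
  fixes \<delta> :: "'h \<Rightarrow> complex" and \<sigma> :: 'h
  assumes character: "algebra_character mul e \<delta>"
    and group_like: "group_like comult counit \<sigma>"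
    and modular: "\<delta> \<sigma> = 1"
    and involution:
      "twisted_antipode comult antipode \<delta> (twisted_antipode comult antipode \<delta> h) =
       mul (mul \<sigma> h) (algebra_inverse mul e \<sigma>)"


section \<open>The Hopf algebra structure of the universal enveloping algebra\<close>

text \<open>
  The unique extension of a linear form on \<open>'g\<close> to a character of the enveloping algebra; it exists
  when the form vanishes on brackets, see \<open>uenv_character_ex1\<close>.
\<close>
definition uenv_character :: "('g::complex_lie_algebra \<Rightarrow> complex) \<Rightarrow> 'g uenv \<Rightarrow> complex"
  where "uenv_character l = (THE \<chi>. algebra_character (*) 1 \<chi> \<and> (\<forall>x. \<chi> (uenv_of x) = l x))"

definition uenv_counit :: "'g::complex_lie_algebra uenv \<Rightarrow> complex"
  where "uenv_counit = uenv_character (\<lambda>x. 0)"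

definition uenv_comult :: "'g::complex_lie_algebra uenv \<Rightarrow> 'g uenv \<otimes>\<^sub>C 'g uenv"
  where "uenv_comult = (THE D. clinear D \<and> D 1 = 1 \<otimes>\<^sub>C 1 \<and>
    (\<forall>u v. D (u * v) = tensor_mult (*) (*) (D u) (D v)) \<and>
    (\<forall>x. D (uenv_of x) = uenv_of x \<otimes>\<^sub>C 1 + 1 \<otimes>\<^sub>C uenv_of x))"

definition uenv_antipode :: "'g::complex_lie_algebra uenv \<Rightarrow> 'g uenv"
  where "uenv_antipode = (THE S. clinear S \<and> S 1 = 1 \<and> (\<forall>u v. S (u * v) = S v * S u) \<and>
    (\<forall>x. S (uenv_of x) = - uenv_of x))"

lemma uenv_character_ex1:
  assumes "clinear l" "\<And>x y. l (lie_bracket x y) = 0"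
  shows "\<exists>!\<chi>. algebra_character (*) 1 \<chi> \<and> (\<forall>x. \<chi> (uenv_of x) = l x)"
proof -
  have "lie_representation (\<lambda>x c. l x * c)"
    using clinearD[OF assms(1)] assms(2)
    by (simp add: lie_representation_def cbilinear_iff algebra_simps)
  then obtain A :: "'a uenv \<Rightarrow> complex \<Rightarrow> complex" where
    A: "cbilinear A" "\<And>v. A 1 v = v" "\<And>u u' v. A (u * u') v = A u (A u' v)"
      "\<And>x v. A (uenv_of x) v = l x * v"
    using uenv_module_exists by blast
  have A_one: "A u c = A u 1 * c" for u c
    using clinearD(2)[OF cbilinearD(1)[OF A(1)], of u c 1] by (simp add: mult.commute)
  show ?thesis
  proof (rule ex1I[of _ "\<lambda>u. A u 1"])
    show "algebra_character (*) 1 (\<lambda>u. A u 1) \<and> (\<forall>x. A (uenv_of x) 1 = l x)"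
      using A(1) A_one[of _ "A _ 1"]
      by (simp add: algebra_character_def A cbilinear_def)
    fix \<chi> assume \<chi>: "algebra_character (*) 1 \<chi> \<and> (\<forall>x. \<chi> (uenv_of x) = l x)"
    show "\<chi> = (\<lambda>u. A u 1)"
    proof
      fix u show "\<chi> u = A u 1"
        using \<chi> A by (induction u rule: uenv_induct)
          (auto simp: algebra_character_def clinear_iff cbilinear_iff)
    qed
  qed
qed

lemma uenv_antipode_ex1:
  "\<exists>!S. clinear S \<and> S 1 = 1 \<and> (\<forall>u v. S (u * v) = S v * S u) \<and>
    (\<forall>x::'g::complex_lie_algebra. S (uenv_of x) = - uenv_of x)"
proof -
  have "lie_representation (\<lambda>x u. - (u * uenv_of (x::'g)))"
    by (auto simp: lie_representation_def cbilinear_iff uenv_of_simps algebra_simps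
        mult_scaleC_left mult_scaleC_right)
  then obtain A :: "'g uenv \<Rightarrow> 'g uenv \<Rightarrow> 'g uenv" where
    A: "cbilinear A" "\<And>v. A 1 v = v" "\<And>u u' v. A (u * u') v = A u (A u' v)"
      "\<And>x v. A (uenv_of x) v = - (v * uenv_of x)"
    using uenv_module_exists by blast
  have A_one: "A u v = v * A u 1" for u v
  proof (induction u arbitrary: v rule: uenv_induct)
    case (gen x u)
    show ?case by (simp add: A gen[of v] mult.assoc)
  next
    case (add u u')
    show ?case
      by (simp only: clinearD[OF cbilinearD(2)[OF A(1)]] add[of v] distrib_left)
  next
    case (scaleC c u)
    show ?case
      by (simp only: clinearD[OF cbilinearD(2)[OF A(1)]] scaleC[of v] mult_scaleC_right)
  qed (simp add: A)
  have A_mult: "A (u * v) 1 = A v 1 * A u 1" for u v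
    unfolding A(3) by (rule A_one)
  show ?thesis
  proof (rule ex1I[of _ "\<lambda>u. A u 1"])
    show "clinear (\<lambda>u. A u 1) \<and> A 1 1 = 1 \<and> (\<forall>u v. A (u * v) 1 = A v 1 * A u 1) \<and>
        (\<forall>x. A (uenv_of x) 1 = - uenv_of x)"
      using A(1) by (simp add: A(2,4) A_mult cbilinear_def)
    fix S assume S: "clinear S \<and> S 1 = 1 \<and> (\<forall>u v. S (u * v) = S v * S u) \<and>
        (\<forall>x::'g. S (uenv_of x) = - uenv_of x)"
    show "S = (\<lambda>u. A u 1)"
    proof
      fix u show "S u = A u 1"
        using S A by (induction u rule: uenv_induct) (auto simp: clinear_iff cbilinear_iff)
    qed
  qed
qed

lemma tensor_mult_elem [simp]:
  fixes a a' :: "'a::complex_algebra_1" and b b' :: "'b::complex_algebra_1"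
  shows "tensor_mult (*) (*) (a \<otimes>\<^sub>C b) (a' \<otimes>\<^sub>C b') = (a * a') \<otimes>\<^sub>C (b * b')"
    and tensor_mult_bilinear: "cbilinear (tensor_mult (*) (*) :: 'a \<otimes>\<^sub>C 'b \<Rightarrow> 'a \<otimes>\<^sub>C 'b \<Rightarrow> 'a \<otimes>\<^sub>C 'b)"
proof -
  have b: "cbilinear (\<lambda>a' b'. (a * a') \<otimes>\<^sub>C (b * b'))" for a :: 'a and b :: 'b
    by (simp add: cbilinear_iff tensor_simps distrib_left mult_scaleC_right)
  have b': "cbilinear (\<lambda>a b. (a * a') \<otimes>\<^sub>C (b * b'))" for a' :: 'a and b' :: 'b
    by (simp add: cbilinear_iff tensor_simps distrib_right mult_scaleC_left)
  have B: "cbilinear (\<lambda>a b. sweedler t (\<lambda>a' b'. (a * a') \<otimes>\<^sub>C (b * b')))" for t :: "'a \<otimes>\<^sub>C 'b"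
    using b' unfolding cbilinear_iff by (simp add: sweedler_add sweedler_scaleC)
  show "tensor_mult (*) (*) (a \<otimes>\<^sub>C b) (a' \<otimes>\<^sub>C b') = (a * a') \<otimes>\<^sub>C (b * b')"
    by (simp add: tensor_mult_def b b')
  show "cbilinear (tensor_mult (*) (*) :: 'a \<otimes>\<^sub>C 'b \<Rightarrow> 'a \<otimes>\<^sub>C 'b \<Rightarrow> 'a \<otimes>\<^sub>C 'b)"
    by (simp add: cbilinear_iff tensor_mult_def clinearD[OF clinear_sweedler[OF B]]
        clinearD[OF clinear_sweedler[OF b]] sweedler_add sweedler_scaleC)
qed

lemma tensor_mult_assoc:
  fixes r s t :: "'a::complex_algebra_1 \<otimes>\<^sub>C 'b::complex_algebra_1"
  shows "tensor_mult (*) (*) (tensor_mult (*) (*) r s) t =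
    tensor_mult (*) (*) r (tensor_mult (*) (*) s t)"
proof -
  note S = clinearD[OF cbilinearD(1)[OF tensor_mult_bilinear]]
    clinearD[OF cbilinearD(2)[OF tensor_mult_bilinear]]
  have 1: "tensor_mult (*) (*) (tensor_mult (*) (*) (a \<otimes>\<^sub>C b) (a' \<otimes>\<^sub>C b')) t =
    tensor_mult (*) (*) (a \<otimes>\<^sub>C b) (tensor_mult (*) (*) (a' \<otimes>\<^sub>C b') t)" for a a' :: 'a and b b' :: 'b
    by (induction t rule: tensor_induct) (simp_all add: S mult.assoc)
  have 2: "tensor_mult (*) (*) (tensor_mult (*) (*) (a \<otimes>\<^sub>C b) s) t =
    tensor_mult (*) (*) (a \<otimes>\<^sub>C b) (tensor_mult (*) (*) s t)" for a :: 'a and b :: 'b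
    by (induction s rule: tensor_induct) (simp_all only: S 1)
  show ?thesis by (induction r rule: tensor_induct) (simp_all only: S 2)
qed

lemma tensor_mult_one:
  fixes t :: "'a::complex_algebra_1 \<otimes>\<^sub>C 'b::complex_algebra_1"
  shows "tensor_mult (*) (*) (1 \<otimes>\<^sub>C 1) t = t" "tensor_mult (*) (*) t (1 \<otimes>\<^sub>C 1) = t"
  by (induction t rule: tensor_induct)
    (simp_all add: clinearD[OF cbilinearD(1)[OF tensor_mult_bilinear]]
      clinearD[OF cbilinearD(2)[OF tensor_mult_bilinear]])

lemma uenv_comult_ex1:
  "\<exists>!D. clinear D \<and> D 1 = 1 \<otimes>\<^sub>C 1 \<and> (\<forall>u v. D (u * v) = tensor_mult (*) (*) (D u) (D v)) \<and>
    (\<forall>x::'g::complex_lie_algebra. D (uenv_of x) = uenv_of x \<otimes>\<^sub>C 1 + 1 \<otimes>\<^sub>C uenv_of x)"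
proof -
  let ?p = "\<lambda>x::'g. uenv_of x \<otimes>\<^sub>C 1 + 1 \<otimes>\<^sub>C uenv_of x"
  note S = clinearD[OF cbilinearD(1)[OF tensor_mult_bilinear]]
    clinearD[OF cbilinearD(2)[OF tensor_mult_bilinear]]
  have t_diff: "(u - v) \<otimes>\<^sub>C w = u \<otimes>\<^sub>C w - v \<otimes>\<^sub>C w" "w \<otimes>\<^sub>C (u - v) = w \<otimes>\<^sub>C u - w \<otimes>\<^sub>C v"
    for u v w :: "'g uenv"
    by (rule clinearD(5)[OF cbilinearD(2)[OF cbilinear_tensor]]
        clinearD(5)[OF cbilinearD(1)[OF cbilinear_tensor]])+
  have br: "?p (lie_bracket x y) =
      tensor_mult (*) (*) (?p x) (?p y) - tensor_mult (*) (*) (?p y) (?p x)" for x y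
    by (simp add: S uenv_of_simps t_diff algebra_simps)
  have "lie_representation (\<lambda>x. tensor_mult (*) (*) (?p x))"
    unfolding lie_representation_def
  proof (intro conjI allI)
    show "cbilinear (\<lambda>x. tensor_mult (*) (*) (?p x))"
      by (simp add: cbilinear_iff S uenv_of_simps tensor_simps scaleC_add_right[symmetric])
    show "tensor_mult (*) (*) (?p (lie_bracket x y)) v =
        tensor_mult (*) (*) (?p x) (tensor_mult (*) (*) (?p y) v) -
        tensor_mult (*) (*) (?p y) (tensor_mult (*) (*) (?p x) v)" for x y v
      unfolding br by (simp only: S tensor_mult_assoc)
  qed
  then obtain A :: "'g uenv \<Rightarrow> 'g uenv \<otimes>\<^sub>C 'g uenv \<Rightarrow> 'g uenv \<otimes>\<^sub>C 'g uenv" where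
    A: "cbilinear A" "\<And>v. A 1 v = v" "\<And>u u' v. A (u * u') v = A u (A u' v)"
      "\<And>x v. A (uenv_of x) v = tensor_mult (*) (*) (?p x) v"
    using uenv_module_exists by blast
  have A_one: "A u t = tensor_mult (*) (*) (A u (1 \<otimes>\<^sub>C 1)) t" for u t
  proof (induction u arbitrary: t rule: uenv_induct)
    case (gen x u)
    show ?case by (simp only: A gen[of t] tensor_mult_assoc)
  next
    case (add u u')
    show ?case by (simp only: clinearD[OF cbilinearD(2)[OF A(1)]] add[of t] S)
  next
    case (scaleC c u)
    show ?case by (simp only: clinearD[OF cbilinearD(2)[OF A(1)]] scaleC[of t] S)
  qed (simp add: A tensor_mult_one)
  have A_mult: "A (u * v) (1 \<otimes>\<^sub>C 1) = tensor_mult (*) (*) (A u (1 \<otimes>\<^sub>C 1)) (A v (1 \<otimes>\<^sub>C 1))" for u v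
    unfolding A(3) by (rule A_one)
  show ?thesis
  proof (rule ex1I[of _ "\<lambda>u. A u (1 \<otimes>\<^sub>C 1)"])
    show "clinear (\<lambda>u. A u (1 \<otimes>\<^sub>C 1)) \<and> A 1 (1 \<otimes>\<^sub>C 1) = 1 \<otimes>\<^sub>C 1 \<and>
        (\<forall>u v. A (u * v) (1 \<otimes>\<^sub>C 1) = tensor_mult (*) (*) (A u (1 \<otimes>\<^sub>C 1)) (A v (1 \<otimes>\<^sub>C 1))) \<and>
        (\<forall>x. A (uenv_of x) (1 \<otimes>\<^sub>C 1) = ?p x)"
      using A(1) by (simp add: A(2,4) A_mult cbilinear_def tensor_mult_one)
    fix D assume D: "clinear D \<and> D 1 = 1 \<otimes>\<^sub>C 1 \<and>
        (\<forall>u v. D (u * v) = tensor_mult (*) (*) (D u) (D v)) \<and> (\<forall>x. D (uenv_of x) = ?p x)"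
    show "D = (\<lambda>u. A u (1 \<otimes>\<^sub>C 1))"
    proof
      fix u show "D u = A u (1 \<otimes>\<^sub>C 1)"
        using D A by (induction u rule: uenv_induct) (auto simp: clinear_iff cbilinear_iff)
    qed
  qed
qed


section \<open>Lie-Hopf algebras\<close>

definition endo_trace :: "'v set \<Rightarrow> ('v::complex_vector \<Rightarrow> 'v) \<Rightarrow> complex"
  where "endo_trace B T = (\<Sum>b\<in>B. cvec.representation B (T b) b)"

text \<open>
  Indices run over \<open>{..<N}\<close>, so \<open>N = 0\<close> covers the zero Lie algebra. In \<open>C i j k\<close> the indices \<open>i\<close>, \<open>j\<close>
  are lower and \<open>k\<close> is upper; in \<open>f i j\<close> the index \<open>i\<close> is upper and \<open>j\<close> is lower.
\<close>
locale g_hopf_algebra = hopf_algebra "(*)" 1 comult counit antipode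
  for comult :: "'f::{complex_algebra_1, comm_ring_1} \<Rightarrow> 'f \<otimes>\<^sub>C 'f" and counit antipode +
  fixes N :: nat and X :: "nat \<Rightarrow> 'g::complex_lie_algebra" and C :: "nat \<Rightarrow> nat \<Rightarrow> nat \<Rightarrow> complex"
    and act :: "'g \<Rightarrow> 'f \<Rightarrow> 'f" and coact :: "'g \<Rightarrow> 'g \<otimes>\<^sub>C 'f" and f :: "nat \<Rightarrow> nat \<Rightarrow> 'f"
  assumes basis_inj: "inj_on X {..<N}"
    and basis_independent: "cvec.independent (X ` {..<N})"
    and basis_span: "cvec.span (X ` {..<N}) = UNIV"
    and structure_constants:
      "\<lbrakk>i < N; j < N\<rbrakk> \<Longrightarrow> lie_bracket (X i) (X j) = (\<Sum>k<N. C i j k *\<^sub>C X k)"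
    and act_representation: "lie_representation act"
    and act_derivation: "act x (a * b) = act x a * b + a * act x b"
    and coact_linear: "clinear coact"
    and coact_coassoc:
      "sweedler (coact x) (\<lambda>x0 x1. sweedler (coact x0) (\<lambda>y0 y1. y0 \<otimes>\<^sub>C (y1 \<otimes>\<^sub>C x1))) =
       sweedler (coact x) (\<lambda>x0 x1. sweedler (comult x1) (\<lambda>a b. x0 \<otimes>\<^sub>C (a \<otimes>\<^sub>C b)))"
    and coact_counit: "sweedler (coact x) (\<lambda>x0 x1. counit x1 *\<^sub>C x0) = x"
    and coact_coefficients: "j < N \<Longrightarrow> coact (X j) = (\<Sum>i<N. X i \<otimes>\<^sub>C f i j)"
    and coefficients_structure:
      "\<lbrakk>i < N; j < N; k < N\<rbrakk> \<Longrightarrow> act (X i) (f k j) - act (X j) (f k i) =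
        (\<Sum>s<N. \<Sum>r<N. C s r k *\<^sub>C (f r i * f s j)) + (\<Sum>l<N. C i j l *\<^sub>C f k l)"
    and comult_act:
      "comult (act x a) = sweedler (comult a) (\<lambda>a1 a2.
        sweedler (coact x) (\<lambda>x0 x1. act x0 a1 \<otimes>\<^sub>C (x1 * a2)) + a1 \<otimes>\<^sub>C act x a2)"
    and counit_act: "counit (act x a) = 0"


section \<open>The bicrossed product\<close>

definition uenv_act ::
  "('g::complex_lie_algebra \<Rightarrow> 'f::complex_vector \<Rightarrow> 'f) \<Rightarrow> 'g uenv \<Rightarrow> 'f \<Rightarrow> 'f"
  where "uenv_act act = (THE A. cbilinear A \<and> (\<forall>a. A 1 a = a) \<and>
    (\<forall>u v a. A (u * v) a = A u (A v a)) \<and> (\<forall>x a. A (uenv_of x) a = act x a))"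

lemma uenv_act_ex1:
  assumes "lie_representation act"
  shows "\<exists>!A. cbilinear A \<and> (\<forall>a. A 1 a = a) \<and>
    (\<forall>u v a. A (u * v) a = A u (A v a)) \<and> (\<forall>x a. A (uenv_of x) a = act x a)"
proof (rule ex_ex1I)
  fix A B
  assume AB: "cbilinear A \<and> (\<forall>a. A 1 a = a) \<and>
      (\<forall>u v a. A (u * v) a = A u (A v a)) \<and> (\<forall>x a. A (uenv_of x) a = act x a)"
    "cbilinear B \<and> (\<forall>a. B 1 a = a) \<and>
      (\<forall>u v a. B (u * v) a = B u (B v a)) \<and> (\<forall>x a. B (uenv_of x) a = act x a)"
  have "A u a = B u a" for u a
    using AB by (induction u arbitrary: a rule: uenv_induct) (auto simp: cbilinear_iff)
  then show "A = B" by blast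
qed (rule uenv_module_exists[OF assms])

text \<open>
  As in \<open>uenv_act\<close>, the description is pinned down by its clauses because \<open>'g\<close> generates the
  enveloping algebra. Existence for a Lie-Hopf algebra uses \<open>act_representation\<close>,
  \<open>act_derivation\<close> and \<open>coefficients_structure\<close>.
\<close>
definition uenv_coact ::
  "('g::complex_lie_algebra \<Rightarrow> 'f::complex_algebra_1 \<Rightarrow> 'f) \<Rightarrow> ('g \<Rightarrow> 'g \<otimes>\<^sub>C 'f) \<Rightarrow>
    'g uenv \<Rightarrow> 'g uenv \<otimes>\<^sub>C 'f"
  where "uenv_coact act coact = (THE D. clinear D \<and>
    (\<forall>x. D (uenv_of x) = sweedler (coact x) (\<lambda>x0 x1. uenv_of x0 \<otimes>\<^sub>C x1)) \<and>
    D 1 = 1 \<otimes>\<^sub>C 1 \<and>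
    (\<forall>u v. D (u * v) =
      sweedler (uenv_comult u) (\<lambda>u1 u2. sweedler (D u1) (\<lambda>u10 u11. sweedler (D v) (\<lambda>v0 v1.
        (u10 * v0) \<otimes>\<^sub>C (u11 * uenv_act act u2 v1))))))"

definition bicrossed_mult ::
  "('g::complex_lie_algebra \<Rightarrow> 'f::complex_algebra_1 \<Rightarrow> 'f) \<Rightarrow>
    'f \<otimes>\<^sub>C 'g uenv \<Rightarrow> 'f \<otimes>\<^sub>C 'g uenv \<Rightarrow> 'f \<otimes>\<^sub>C 'g uenv"
  where "bicrossed_mult act s t =
    sweedler s (\<lambda>a u. sweedler t (\<lambda>b v. sweedler (uenv_comult u) (\<lambda>u1 u2.
      (a * uenv_act act u1 b) \<otimes>\<^sub>C (u2 * v))))"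

definition bicrossed_comult ::
  "('f::complex_algebra_1 \<Rightarrow> 'f \<otimes>\<^sub>C 'f) \<Rightarrow> ('g::complex_lie_algebra \<Rightarrow> 'f \<Rightarrow> 'f) \<Rightarrow>
    ('g \<Rightarrow> 'g \<otimes>\<^sub>C 'f) \<Rightarrow> 'f \<otimes>\<^sub>C 'g uenv \<Rightarrow> ('f \<otimes>\<^sub>C 'g uenv) \<otimes>\<^sub>C ('f \<otimes>\<^sub>C 'g uenv)"
  where "bicrossed_comult comult act coact t =
    sweedler t (\<lambda>a u. sweedler (comult a) (\<lambda>a1 a2. sweedler (uenv_comult u) (\<lambda>u1 u2.
      sweedler (uenv_coact act coact u1) (\<lambda>u10 u11.
        (a1 \<otimes>\<^sub>C u10) \<otimes>\<^sub>C ((a2 * u11) \<otimes>\<^sub>C u2)))))"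

definition bicrossed_functional ::
  "('f::complex_vector \<Rightarrow> complex) \<Rightarrow> ('g::complex_lie_algebra uenv \<Rightarrow> complex) \<Rightarrow>
    'f \<otimes>\<^sub>C 'g uenv \<Rightarrow> complex"
  where "bicrossed_functional \<phi> \<psi> t = sweedler t (\<lambda>a u. \<phi> a * \<psi> u)"

definition bicrossed_antipode ::
  "('f::complex_algebra_1 \<Rightarrow> 'f) \<Rightarrow> ('g::complex_lie_algebra \<Rightarrow> 'f \<Rightarrow> 'f) \<Rightarrow>
    ('g \<Rightarrow> 'g \<otimes>\<^sub>C 'f) \<Rightarrow> 'f \<otimes>\<^sub>C 'g uenv \<Rightarrow> 'f \<otimes>\<^sub>C 'g uenv"
  where "bicrossed_antipode antipode act coact t =
    sweedler t (\<lambda>a u. sweedler (uenv_coact act coact u) (\<lambda>u0 u1.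
      bicrossed_mult act (1 \<otimes>\<^sub>C uenv_antipode u0) (antipode (a * u1) \<otimes>\<^sub>C 1)))"

end

theory Submission
  imports Defs
begin

text \<open>
  Write \<open>F\<close> for the commutative Hopf algebra, \<open>g\<close> for the Lie algebra,
  \<open>H\<close> for the bicrossed product, and \<open>X \<triangleright> a\<close> for the
  action. As an algebra, \<open>H\<close> is generated by \<open>F\<close> and \<open>g\<close>
  with the relations of \<open>F\<close>, those of \<open>U(g)\<close>, and
  \<open>X a = a X + X \<triangleright> a\<close>. The proof uses this presentation in two ways.
  First, a map on \<open>H\<close> is multiplicative as soon as its restrictions to
  \<open>F\<close> and \<open>U(g)\<close> are and respect the commutation relation
  (\<open>bicrossed_lift\<close>). Second, each Hopf algebra axiom holds on a subalgebra, so it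
  need only be checked for elements of \<open>F\<close> and \<open>g\<close>
  (\<open>bicrossed_induct\<close>), where it is an axiom of \<open>F\<close> or of the coaction
  on \<open>g\<close>.

  The coaction extends to \<open>U(g)\<close> because the operators
  \<open>t \<mapsto> \<nabla>(X) t + (id \<otimes> X \<triangleright>) t\<close> on
  \<open>U(g) \<otimes> F\<close> represent \<open>g\<close>; this is what the structure identity
  for the coefficients \<open>f i j\<close> says (\<open>coact_gen_bracket\<close>). The coproduct
  respects the commutation relation because of the formula for
  \<open>\<Delta>(X \<triangleright> a)\<close>, and the antipode because of its consequence
  \<open>S(X \<triangleright> a) = \<Sum> (X\<^sub>0 \<triangleright> S(a)) S(X\<^sub>1)\<close>
  (\<open>antipode_act\<close>).

  The determinant \<open>\<sigma>\<close> of the coefficient matrix is group-like since the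
  coproduct of this matrix is its product with itself. The trace of the adjoint representation
  vanishes on brackets, so \<open>\<delta>\<close> is a character. The twisted antipode is
  antimultiplicative, so its square and conjugation by \<open>\<sigma>\<close> are two algebra
  endomorphisms of \<open>H\<close>, and it suffices to compare them on \<open>F\<close>, where
  both are the identity, and on a basis of \<open>g\<close>. With \<open>t i\<close> for the trace
  of the adjoint map of \<open>X i\<close>, the antipode axioms give

  \<open>S\<^sub>\<delta>\<^sup>2(X j) = X j + \<Sum> t i f i j - t j - \<Sum> (X k \<triangleright> f i j) S(f k i)\<close>,

  while Jacobi's formula for the derivative of a determinant, with \<open>S(f i j)\<close> as the
  inverse matrix, gives

  \<open>\<sigma> (X j) \<sigma>\<^sup>-\<^sup>1 = X j - \<Sum> (X j \<triangleright> f i k) S(f k i)\<close>.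

  The two agree by the structure identity contracted with the inverse matrix, in which the
  structure constants turn into the traces (\<open>structure_contracted\<close>).
\<close>

section \<open>Linear maps on tensor products\<close>

lemma clinear_ident [simp]: "clinear (\<lambda>x. x)"
  by (rule clinearI) simp_all

lemma clinear_comp: "clinear h \<Longrightarrow> clinear g \<Longrightarrow> clinear (\<lambda>x. h (g x))"
  by (rule clinearI) (simp_all add: clinearD)

lemma clinear_plus [simp]: "clinear g \<Longrightarrow> clinear h \<Longrightarrow> clinear (\<lambda>x. g x + h x)"
  by (rule clinearI) (simp_all add: clinearD scaleC_add_right algebra_simps)

lemma clinear_uminus [simp]: "clinear g \<Longrightarrow> clinear (\<lambda>x. - g x)"
  by (rule clinearI) (simp_all add: clinearD)

lemma clinear_minus [simp]: "clinear g \<Longrightarrow> clinear h \<Longrightarrow> clinear (\<lambda>x. g x - h x)"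
  by (rule clinearI) (simp_all add: clinearD cvec.scale_right_diff_distrib algebra_simps)

lemma clinear_zero [simp]: "clinear (\<lambda>x. 0)"
  by (rule clinearI) simp_all

lemma clinear_sums [simp]: "(\<And>i. i \<in> I \<Longrightarrow> clinear (\<lambda>x. g x i)) \<Longrightarrow> clinear (\<lambda>x. \<Sum>i\<in>I. g x i)"
  unfolding clinear_iff by (simp add: sum.distrib cvec.scale_sum_right)

lemma clinear_scale_right [simp]: "clinear g \<Longrightarrow> clinear (\<lambda>x. c *\<^sub>C g x)"
  by (rule clinearI) (simp_all add: clinearD scaleC_add_right mult.commute)

lemma clinear_scale_left [simp]: "clinear g \<Longrightarrow> clinear (\<lambda>x. g x *\<^sub>C v)"
  by (rule clinearI) (simp_all add: clinearD scaleC_add_left)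

text \<open>
  The linearity rules are conditional rewrite rules for \<open>clinear\<close> and
  \<open>cbilinear\<close>, so that rewriting with \<open>sweedler_tensor\<close> can discharge
  its bilinearity condition by itself.
\<close>
lemma clinear_bilinear_left: "cbilinear m \<Longrightarrow> clinear g \<Longrightarrow> clinear (\<lambda>x. m (g x) c)"
  by (rule clinear_comp[OF cbilinearD(2)])

lemma clinear_bilinear_right: "cbilinear m \<Longrightarrow> clinear g \<Longrightarrow> clinear (\<lambda>x. m c (g x))"
  by (rule clinear_comp[OF cbilinearD(1)])

lemmas clinear_bilinear = clinear_bilinear_left clinear_bilinear_right

lemma cbilinear_times [simp]: "cbilinear ((*) :: 'a::complex_algebra_1 \<Rightarrow> 'a \<Rightarrow> 'a)"
  by (simp add: cbilinear_iff algebra_simps mult_scaleC_left mult_scaleC_right)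

lemmas clinear_times [simp] = clinear_bilinear[OF cbilinear_times]

lemmas clinear_tensor [simp] = clinear_bilinear[OF cbilinear_tensor]

lemma cbilinearI [simp]:
  "(\<And>x. clinear (\<lambda>y. \<phi> x y)) \<Longrightarrow> (\<And>y. clinear (\<lambda>x. \<phi> x y)) \<Longrightarrow> cbilinear \<phi>"
  by (simp add: cbilinear_def)

lemma clinear_sweedler_left [simp]:
  "clinear g \<Longrightarrow> cbilinear \<phi> \<Longrightarrow> clinear (\<lambda>x. sweedler (g x) \<phi>)"
  by (rule clinear_comp[OF clinear_sweedler])

text \<open>
  For a fixed tensor, \<open>sweedler\<close> is a fixed finite linear combination of values of
  its function argument.
\<close>
lemma clinear_sweedler_right [simp]:
  "(\<And>a b. clinear (\<lambda>x. \<phi> x a b)) \<Longrightarrow> clinear (\<lambda>x. sweedler t (\<lambda>a b. \<phi> x a b))"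
  by (rule clinearI)
    (subst clinearD[of "\<lambda>x. \<phi> x _ _"], assumption, rule sweedler_add sweedler_scaleC)+

lemma sweedler_tensor_add [simp]:
  "cbilinear \<phi> \<Longrightarrow> sweedler (s + t) \<phi> = sweedler s \<phi> + sweedler t \<phi>"
  "cbilinear \<phi> \<Longrightarrow> sweedler (c *\<^sub>C t) \<phi> = c *\<^sub>C sweedler t \<phi>"
  "cbilinear \<phi> \<Longrightarrow> sweedler 0 \<phi> = 0"
  "cbilinear \<phi> \<Longrightarrow> sweedler (- t) \<phi> = - sweedler t \<phi>"
  "cbilinear \<phi> \<Longrightarrow> sweedler (s - t) \<phi> = sweedler s \<phi> - sweedler t \<phi>"
  by (simp_all add: clinearD[OF clinear_sweedler])

lemma tensor_arith:
  "0 \<otimes>\<^sub>C y = 0" "x \<otimes>\<^sub>C 0 = 0" "(- x) \<otimes>\<^sub>C y = - (x \<otimes>\<^sub>C y)" "x \<otimes>\<^sub>C (- y) = - (x \<otimes>\<^sub>C y)"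
  "(x - x') \<otimes>\<^sub>C y = x \<otimes>\<^sub>C y - x' \<otimes>\<^sub>C y" "x \<otimes>\<^sub>C (y - y') = x \<otimes>\<^sub>C y - x \<otimes>\<^sub>C y'"
  by (simp_all add: clinearD[OF cbilinearD(2)[OF cbilinear_tensor]]
      clinearD[OF cbilinearD(1)[OF cbilinear_tensor]])

lemma tensor_sum:
  "(\<Sum>i\<in>I. g i) \<otimes>\<^sub>C y = (\<Sum>i\<in>I. g i \<otimes>\<^sub>C y)" "x \<otimes>\<^sub>C (\<Sum>i\<in>I. h i) = (\<Sum>i\<in>I. x \<otimes>\<^sub>C h i)"
  by (simp_all add: clinear_sum[OF cbilinearD(2)[OF cbilinear_tensor]]
      clinear_sum[OF cbilinearD(1)[OF cbilinear_tensor]])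

lemma sweedler_sum:
  "cbilinear \<phi> \<Longrightarrow> sweedler (\<Sum>i\<in>I. t i) \<phi> = (\<Sum>i\<in>I. sweedler (t i) \<phi>)"
  by (rule clinear_sum[OF clinear_sweedler])

lemma sweedler_diff:
  "sweedler t (\<lambda>a b. - \<phi> a b) = - sweedler t \<phi>"
  "sweedler t (\<lambda>a b. \<phi> a b - \<psi> a b) = sweedler t \<phi> - sweedler t \<psi>"
  "sweedler t (\<lambda>a b. 0) = 0"
  by (simp_all add: sweedler_def free_ext_def case_prod_beta sum_negf sum_subtractf
      cvec.scale_right_diff_distrib)

text \<open>
  The second equation is between functions because a product \<open>sweedler t \<phi> * b\<close>
  under a binder for \<open>b\<close> is stored eta-contracted, where only the partial application
  is visible.
\<close>
lemma sweedler_times: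
  fixes \<phi> :: "'a::complex_vector \<Rightarrow> 'b::complex_vector \<Rightarrow> 'c::complex_algebra_1"
  shows "c * sweedler t \<phi> = sweedler t (\<lambda>a b. c * \<phi> a b)"
    "(*) (sweedler t \<phi>) = (\<lambda>c. sweedler t (\<lambda>a b. \<phi> a b * c))"
  by (simp_all add: fun_eq_iff clinear_of_sweedler[where F = "\<lambda>x. c * x"]
      clinear_of_sweedler[where F = "\<lambda>x. x * _"])

lemma sweedler_sweedler:
  "cbilinear \<phi> \<Longrightarrow> sweedler (sweedler t \<psi>) \<phi> = sweedler t (\<lambda>a b. sweedler (\<psi> a b) \<phi>)"
  by (rule clinear_of_sweedler[OF clinear_sweedler])

lemma tensor_sweedler:
  "sweedler t \<phi> \<otimes>\<^sub>C y = sweedler t (\<lambda>a b. \<phi> a b \<otimes>\<^sub>C y)"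
  "x \<otimes>\<^sub>C sweedler t \<psi> = sweedler t (\<lambda>a b. x \<otimes>\<^sub>C \<psi> a b)"
  by (simp_all add: clinear_of_sweedler[where F = "\<lambda>x. x \<otimes>\<^sub>C _"]
      clinear_of_sweedler[where F = "\<lambda>y. x \<otimes>\<^sub>C y"])

section \<open>Tensor products of algebras\<close>

text \<open>
  Extend \<open>x\<close> to a basis and take the coordinate of \<open>x\<close>. Such functionals
  show that a tensor of nonzero vectors is nonzero, which makes the tensor product of two algebras
  nontrivial.
\<close>
lemma exists_functional:
  fixes x :: "'a::complex_vector"
  assumes "x \<noteq> 0"
  shows "\<exists>\<phi>. clinear \<phi> \<and> \<phi> x = (1::complex)"
proof -
  let ?B = "cvec.extend_basis {x}"
  have "cvec.independent {x}" using assms by (simp add: cvec.dependent_single)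
  note B = cvec.independent_extend_basis[OF this] cvec.span_extend_basis[OF this]
    cvec.extend_basis_superset[OF this]
  have "clinear (\<lambda>y. cvec.representation ?B y x)"
    by (rule clinearI) (simp_all add: cvec.representation_add cvec.representation_scale B)
  moreover have "cvec.representation ?B x x = 1"
    using B by (subst cvec.representation_basis) auto
  ultimately show ?thesis by blast
qed

lemma tensor_nonzero:
  fixes x :: "'a::complex_vector" and y :: "'b::complex_vector"
  assumes "x \<noteq> 0" "y \<noteq> 0"
  shows "x \<otimes>\<^sub>C y \<noteq> 0"
proof
  assume 0: "x \<otimes>\<^sub>C y = 0"
  obtain \<phi> \<psi> where \<phi>: "clinear \<phi>" "\<phi> x = (1::complex)" and \<psi>: "clinear \<psi>" "\<psi> y = (1::complex)"
    using exists_functional assms by metis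
  note [simp] = \<phi>(2) \<psi>(2) clinear_comp[OF \<phi>(1)] clinear_comp[OF \<psi>(1)]
  have "sweedler (x \<otimes>\<^sub>C y) (\<lambda>a b. \<phi> a * \<psi> b) = 1" by simp
  then show False unfolding 0 by simp
qed

text \<open>
  Both sides are the same double sum over the chosen representatives of \<open>s\<close> and
  \<open>t\<close>.
\<close>
lemma sweedler_swap:
  "sweedler s (\<lambda>a b. sweedler t (\<lambda>c d. \<phi> a b c d)) =
   sweedler t (\<lambda>c d. sweedler s (\<lambda>a b. \<phi> a b c d))"
  unfolding sweedler_def free_ext_def case_prod_beta cvec.scale_sum_right scaleC_scaleC
  by (subst sum.swap) (simp add: mult.commute)

lemma tensor_mult_tensor [simp]:
  assumes [simp]: "cbilinear m" "cbilinear n"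
  shows "tensor_mult m n (a \<otimes>\<^sub>C b) (a' \<otimes>\<^sub>C b') = m a a' \<otimes>\<^sub>C n b b'"
  by (simp add: tensor_mult_def clinear_bilinear[OF assms(1)] clinear_bilinear[OF assms(2)])

lemma cbilinear_tensor_mult [simp]:
  assumes [simp]: "cbilinear m" "cbilinear n"
  shows "cbilinear (tensor_mult m n)"
  unfolding tensor_mult_def
  by (simp add: clinear_bilinear[OF assms(1)] clinear_bilinear[OF assms(2)])

lemma sweedler_tensor_mult:
  assumes [simp]: "cbilinear m" "cbilinear n" "cbilinear \<phi>"
  shows "sweedler (tensor_mult m n s t) \<phi> =
    sweedler s (\<lambda>a b. sweedler t (\<lambda>c d. \<phi> (m a c) (n b d)))"
  by (simp add: tensor_mult_def clinear_of_sweedler[OF clinear_sweedler[OF assms(3)]])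

text \<open>
  The multiplication is a parameter because the bicrossed product lives on the vector space
  \<open>'f \<otimes>\<^sub>C 'g uenv\<close> with a multiplication depending on the action, next
  to the componentwise one.
\<close>
locale unital_algebra =
  fixes mul :: "'h \<Rightarrow> 'h \<Rightarrow> 'h::complex_vector" and e :: 'h
  assumes bilinear: "cbilinear mul"
    and assoc: "mul (mul x y) z = mul x (mul y z)"
    and unit: "mul e x = x" "mul x e = x"
begin

lemmas clinear_mul = clinear_bilinear[OF bilinear]
lemmas mul_arith = clinearD[OF clinear_mul(1)[OF clinear_ident]]
  clinearD[OF clinear_mul(2)[OF clinear_ident]]
lemmas mul_sum = clinear_sum[OF clinear_mul(1)[OF clinear_ident]]
  clinear_sum[OF clinear_mul(2)[OF clinear_ident]]

lemma mul_sweedler: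
  "mul (sweedler t \<phi>) = (\<lambda>y. sweedler t (\<lambda>a b. mul (\<phi> a b) y))"
  "mul x (sweedler t \<phi>) = sweedler t (\<lambda>a b. mul x (\<phi> a b))"
  using clinear_of_sweedler[OF clinear_mul(1)[OF clinear_ident], of t \<phi>]
    clinear_of_sweedler[OF clinear_mul(2)[OF clinear_ident], of x t \<phi>] by (simp_all add: fun_eq_iff)

lemma opposite: "unital_algebra (\<lambda>x y. mul y x) e"
  by standard (simp_all add: clinear_mul assoc unit)

end

lemma unital_algebra_tensor:
  assumes "unital_algebra m e" "unital_algebra n d"
  shows "unital_algebra (tensor_mult m n) (e \<otimes>\<^sub>C d)"
proof -
  interpret m: unital_algebra m e by fact
  interpret n: unital_algebra n d by fact
  note [simp] = m.bilinear n.bilinear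
  have bil: "cbilinear (tensor_mult m n)" by simp
  note S = clinearD[OF cbilinearD(1)[OF bil]] clinearD[OF cbilinearD(2)[OF bil]]
  have 1: "tensor_mult m n (tensor_mult m n (a \<otimes>\<^sub>C b) (a' \<otimes>\<^sub>C b')) t =
    tensor_mult m n (a \<otimes>\<^sub>C b) (tensor_mult m n (a' \<otimes>\<^sub>C b') t)" for a a' b b' t
    by (induction t rule: tensor_induct) (simp_all add: S m.assoc n.assoc)
  have 2: "tensor_mult m n (tensor_mult m n (a \<otimes>\<^sub>C b) s) t =
    tensor_mult m n (a \<otimes>\<^sub>C b) (tensor_mult m n s t)" for a b s t
    by (induction s rule: tensor_induct) (simp_all only: S 1)
  show ?thesis
  proof
    show "cbilinear (tensor_mult m n)" by (rule bil)
    show "tensor_mult m n (tensor_mult m n r s) t = tensor_mult m n r (tensor_mult m n s t)" for r s t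
      by (induction r rule: tensor_induct) (simp_all only: S 2)
    show "tensor_mult m n (e \<otimes>\<^sub>C d) t = t" "tensor_mult m n t (e \<otimes>\<^sub>C d) = t" for t
      by (induction t rule: tensor_induct) (simp_all add: S m.unit n.unit)
  qed
qed

lemma unital_algebra_times: "unital_algebra ((*) :: 'a::complex_algebra_1 \<Rightarrow> 'a \<Rightarrow> 'a) 1"
  by standard (simp_all add: mult.assoc)

text \<open>
  The componentwise product. On \<open>'g uenv \<otimes>\<^sub>C 'f\<close> it makes the coaction
  of the enveloping algebra a computation in a ring; on \<open>'f \<otimes>\<^sub>C 'f\<close> the
  ring is commutative and determinants are available.
\<close>
instantiation tensor :: (complex_algebra_1, complex_algebra_1) complex_algebra_1
begin

definition times_tensor :: "'a \<otimes>\<^sub>C 'b \<Rightarrow> 'a \<otimes>\<^sub>C 'b \<Rightarrow> 'a \<otimes>\<^sub>C 'b"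
  where "times_tensor = tensor_mult (*) (*)"

definition one_tensor :: "'a \<otimes>\<^sub>C 'b"
  where "one_tensor = 1 \<otimes>\<^sub>C 1"

instance
proof -
  interpret unital_algebra "(*) :: 'a \<otimes>\<^sub>C 'b \<Rightarrow> 'a \<otimes>\<^sub>C 'b \<Rightarrow> 'a \<otimes>\<^sub>C 'b" 1
    unfolding times_tensor_def one_tensor_def
    by (intro unital_algebra_tensor unital_algebra_times)
  note 0 = assoc unit clinearD[OF cbilinearD(1)[OF bilinear]] clinearD[OF cbilinearD(2)[OF bilinear]]
  show "OFCLASS('a \<otimes>\<^sub>C 'b, complex_algebra_1_class)"
  proof
    show "0 \<noteq> (1 :: 'a \<otimes>\<^sub>C 'b)"
      unfolding one_tensor_def by (rule not_sym, rule tensor_nonzero) simp_all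
  qed (rule 0)+
qed

end

lemma tensor_times [simp]: "(a \<otimes>\<^sub>C b) * (a' \<otimes>\<^sub>C b') = (a * a') \<otimes>\<^sub>C (b * b')"
  for a a' :: "'a::complex_algebra_1" and b b' :: "'b::complex_algebra_1"
  by (simp add: times_tensor_def)

instance tensor :: ("{complex_algebra_1,comm_ring_1}", "{complex_algebra_1,comm_ring_1}") comm_ring_1
proof
  fix s t :: "'a \<otimes>\<^sub>C 'b"
  have "(a \<otimes>\<^sub>C b) * t = t * (a \<otimes>\<^sub>C b)" for a b
    by (induction t rule: tensor_induct) (simp_all add: distrib_left distrib_right mult.commute)
  then show "s * t = t * s"
    by (induction s rule: tensor_induct) (simp_all add: distrib_left distrib_right)
  show "1 * s = s" "(s + t) * u = s * u + t * u" for u by (simp_all add: distrib_right)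
qed

section \<open>Antipodes and twisted antipodes\<close>

context hopf_algebra
begin

sublocale unital_algebra mul e
  by standard (rule mult_bilinear mult_assoc mult_unit_left mult_unit_right)+

lemmas clinear_structure = clinear_mul clinear_comp[OF comult_linear] clinear_comp[OF counit_linear]
  clinear_comp[OF antipode_linear]

text \<open>
  Coassociativity is an equality in a triple tensor product; here the linear map that a trilinear
  \<open>F\<close> induces on that product is applied to it.
\<close>
lemma coassoc_apply:
  assumes lin: "\<And>b c. clinear (\<lambda>a. F a b c)" "\<And>a c. clinear (\<lambda>b. F a b c)" "\<And>a b. clinear (\<lambda>c. F a b c)"
  shows "sweedler (comult x) (\<lambda>a b. sweedler (comult a) (\<lambda>a1 a2. F a1 a2 b)) =
    sweedler (comult x) (\<lambda>a b. sweedler (comult b) (\<lambda>b1 b2. F a b1 b2))"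
proof -
  define G where "G t = sweedler t (\<lambda>a s. sweedler s (\<lambda>b c. F a b c))" for t
  have G: "clinear G" "\<And>a b c. G (a \<otimes>\<^sub>C (b \<otimes>\<^sub>C c)) = F a b c"
    unfolding G_def by (simp_all add: lin)
  show ?thesis
    using arg_cong[OF comult_coassoc[of x], of G]
    by (simp add: clinear_of_sweedler[OF G(1)] G(2))
qed

text \<open>
  In the convolution algebra of linear endomorphisms \<open>R\<close> is a right inverse of
  \<open>P\<close>, and \<open>Q\<close> convolved with \<open>P\<close> is the multiple
  \<open>c\<close> of the unit; hence \<open>Q = Q P R = c R\<close>. Antimultiplicativity and
  involutivity of antipodes are instances, with a suitable \<open>c\<close>.
\<close>
lemma convolution_inverse_unique:
  assumes lin: "clinear P" "clinear Q" "clinear R"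
    and PR: "\<And>x. sweedler (comult x) (\<lambda>a b. mul (P a) (R b)) = counit x *\<^sub>C e"
    and QP: "\<And>x. sweedler (comult x) (\<lambda>a b. mul (Q a) (P b)) = counit x *\<^sub>C c"
  shows "Q x = mul c (R x)"
proof -
  note [simp] = clinear_comp[OF lin(1)] clinear_comp[OF lin(2)] clinear_comp[OF lin(3)] clinear_structure
  have "Q x = sweedler (comult x) (\<lambda>a b. counit b *\<^sub>C Q a)"
    using arg_cong[OF counit_right[of x], of Q]
    by (simp add: clinear_of_sweedler[OF lin(2)] clinearD[OF lin(2)])
  also have "\<dots> = sweedler (comult x) (\<lambda>a b. mul (Q a) (counit b *\<^sub>C e))"
    by (simp add: mul_arith unit)
  also have "\<dots> = sweedler (comult x) (\<lambda>a b. sweedler (comult b) (\<lambda>b1 b2. mul (Q a) (mul (P b1) (R b2))))"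
    by (simp add: PR[symmetric] mul_sweedler)
  also have "\<dots> = sweedler (comult x) (\<lambda>a b. sweedler (comult a) (\<lambda>a1 a2. mul (Q a1) (mul (P a2) (R b))))"
    by (rule coassoc_apply[symmetric]) simp_all
  also have "\<dots> = sweedler (comult x) (\<lambda>a b. mul (counit a *\<^sub>C c) (R b))"
    by (simp add: QP[symmetric] mul_sweedler assoc)
  also have "\<dots> = mul c (R (sweedler (comult x) (\<lambda>a b. counit a *\<^sub>C b)))"
    by (simp add: clinear_of_sweedler[OF lin(3)] clinearD[OF lin(3)] mul_sweedler mul_arith)
  finally show ?thesis by (simp add: counit_left)
qed

lemma antipode_unit: "antipode e = e"
  using antipode_left[of e] by (simp add: comult_unit counit_unit clinear_structure unit)

text \<open>
  Two applications of uniqueness of convolution inverses, one in each argument: for fixed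
  \<open>a\<close> the map \<open>b \<mapsto> \<Sum> S(a\<^sub>1 b) a\<^sub>2\<close> convolved
  with the identity is \<open>\<epsilon>(a) \<epsilon>(b)\<close>, so it is
  \<open>\<epsilon>(a) S(b)\<close>; then for fixed \<open>y\<close> the map
  \<open>a \<mapsto> S(a y)\<close> convolved with the identity is
  \<open>\<epsilon>(a) S(y)\<close>, so it is \<open>S(y) S(a)\<close>.
\<close>
lemma antipode_antimultiplicative: "antipode (mul x y) = mul (antipode y) (antipode x)"
proof -
  note [simp] = clinear_structure
  define Q where "Q a b = sweedler (comult a) (\<lambda>a1 a2. mul (antipode (mul a1 b)) a2)" for a b
  have Q: "Q a b = counit a *\<^sub>C antipode b" for a b
  proof -
    have "Q a b = mul (counit a *\<^sub>C e) (antipode b)"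
    proof (rule convolution_inverse_unique[where P = "\<lambda>x. x" and Q = "Q a" and R = antipode])
      show "clinear (\<lambda>b. Q a b)" unfolding Q_def by simp
      fix b
      have "sweedler (comult b) (\<lambda>b1 b2. mul (Q a b1) b2) =
          sweedler (comult a) (\<lambda>a1 a2. sweedler (comult b) (\<lambda>b1 b2. mul (antipode (mul a1 b1)) (mul a2 b2)))"
        by (subst sweedler_swap) (simp add: Q_def mul_sweedler assoc)
      also have "\<dots> = sweedler (comult (mul a b)) (\<lambda>p q. mul (antipode p) q)"
        by (simp add: comult_mult sweedler_tensor_mult bilinear)
      finally show "sweedler (comult b) (\<lambda>b1 b2. mul (Q a b1) b2) = counit b *\<^sub>C (counit a *\<^sub>C e)"
        by (simp add: antipode_left counit_mult mult.commute)
    qed (simp_all add: antipode_linear antipode_right)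
    then show ?thesis by (simp add: mul_arith unit)
  qed
  show ?thesis
  proof (rule convolution_inverse_unique[where P = "\<lambda>x. x" and Q = "\<lambda>x. antipode (mul x y)"
          and R = antipode])
    show "sweedler (comult a) (\<lambda>a1 a2. mul (antipode (mul a1 y)) a2) = counit a *\<^sub>C antipode y" for a
      using Q[of a y] by (simp only: Q_def)
  qed (simp_all add: antipode_linear antipode_right)
qed

text \<open>
  By commutativity \<open>S\<close> is multiplicative, so
  \<open>S(S(x\<^sub>1)) S(x\<^sub>2) = S(S(x\<^sub>1) x\<^sub>2)\<close> equals
  \<open>\<epsilon>(x)\<close>: \<open>S \<circ> S\<close> and the identity are both convolution
  inverses of \<open>S\<close>.
\<close>
lemma antipode_involutive:
  assumes comm: "\<And>x y. mul x y = mul y x"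
  shows "antipode (antipode x) = x"
proof -
  note [simp] = clinear_structure
  have "antipode (antipode x) = mul e x"
  proof (rule convolution_inverse_unique[where P = antipode and R = "\<lambda>x. x"])
    fix x
    have "sweedler (comult x) (\<lambda>a b. mul (antipode (antipode a)) (antipode b)) =
        antipode (sweedler (comult x) (\<lambda>a b. mul (antipode a) b))"
      by (simp add: clinear_of_sweedler[OF antipode_linear] antipode_antimultiplicative comm)
    then show "sweedler (comult x) (\<lambda>a b. mul (antipode (antipode a)) (antipode b)) = counit x *\<^sub>C e"
      by (simp add: antipode_left clinearD[OF antipode_linear] antipode_unit)
  qed (simp_all add: antipode_linear antipode_left)
  then show ?thesis by (simp add: unit)
qed

lemma twisted_antipode_antimultiplicative:
  assumes "algebra_character mul e \<delta>"
  shows "clinear (twisted_antipode comult antipode \<delta>)"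
    "twisted_antipode comult antipode \<delta> e = e"
    "twisted_antipode comult antipode \<delta> (mul x y) =
      mul (twisted_antipode comult antipode \<delta> y) (twisted_antipode comult antipode \<delta> x)"
proof -
  have \<delta>: "clinear \<delta>" "\<delta> e = 1" "\<And>x y. \<delta> (mul x y) = \<delta> x * \<delta> y"
    using assms by (simp_all add: algebra_character_def)
  note [simp] = clinear_structure clinear_comp[OF \<delta>(1)]
  show "clinear (twisted_antipode comult antipode \<delta>)"
    unfolding twisted_antipode_def by simp
  show "twisted_antipode comult antipode \<delta> e = e"
    by (simp add: twisted_antipode_def comult_unit \<delta> antipode_unit)
  show "twisted_antipode comult antipode \<delta> (mul x y) =
      mul (twisted_antipode comult antipode \<delta> y) (twisted_antipode comult antipode \<delta> x)"
    by (simp add: twisted_antipode_def comult_mult sweedler_tensor_mult bilinear \<delta>(3)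
        antipode_antimultiplicative mul_sweedler mul_arith sweedler_scaleC[symmetric])
      (subst sweedler_swap, simp add: mult.commute)
qed

end

section \<open>The structure maps of the enveloping algebra\<close>

lemma tensor_one [simp]:
  "(1 \<otimes>\<^sub>C 1) * t = t" "t * (1 \<otimes>\<^sub>C 1) = t"
  for t :: "'a::complex_algebra_1 \<otimes>\<^sub>C 'b::complex_algebra_1"
  by (simp_all flip: one_tensor_def)

lemma clinear_uenv_of [simp]: "clinear g \<Longrightarrow> clinear (\<lambda>x. uenv_of (g x))"
  by (rule clinearI) (simp_all add: clinearD uenv_of_simps)

lemmas uenv_of_arith = clinearD[OF clinear_uenv_of[OF clinear_ident]]
  clinear_sum[OF clinear_uenv_of[OF clinear_ident]]

lemma uenv_comult_simps:
  "clinear (uenv_comult :: 'g::complex_lie_algebra uenv \<Rightarrow> _)"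
  "uenv_comult (1 :: 'g uenv) = 1 \<otimes>\<^sub>C 1"
  "uenv_comult (u * v) = uenv_comult u * uenv_comult (v :: 'g uenv)"
  "uenv_comult (uenv_of (x :: 'g)) = uenv_of x \<otimes>\<^sub>C 1 + 1 \<otimes>\<^sub>C uenv_of x"
  using theI'[OF uenv_comult_ex1] unfolding uenv_comult_def times_tensor_def by blast+

lemmas clinear_uenv_comult [simp] = clinear_comp[OF uenv_comult_simps(1)]

lemma uenv_antipode_simps:
  "clinear (uenv_antipode :: 'g::complex_lie_algebra uenv \<Rightarrow> _)"
  "uenv_antipode (1 :: 'g uenv) = 1"
  "uenv_antipode (u * v) = uenv_antipode v * uenv_antipode (u :: 'g uenv)"
  "uenv_antipode (uenv_of (x :: 'g)) = - uenv_of x"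
  using theI'[OF uenv_antipode_ex1] unfolding uenv_antipode_def by blast+

lemmas clinear_uenv_antipode [simp] = clinear_comp[OF uenv_antipode_simps(1)]

lemma uenv_character_simps:
  fixes l :: "'g::complex_lie_algebra \<Rightarrow> complex"
  assumes "clinear l" "\<And>x y. l (lie_bracket x y) = 0"
  shows "clinear (uenv_character l)" "uenv_character l 1 = 1"
    "uenv_character l (u * v) = uenv_character l u * uenv_character l v"
    "uenv_character l (uenv_of x) = l x"
proof -
  have "algebra_character (*) 1 (uenv_character l) \<and> (\<forall>x. uenv_character l (uenv_of x) = l x)"
    unfolding uenv_character_def by (rule theI'[OF uenv_character_ex1[OF assms]])
  then show "clinear (uenv_character l)" "uenv_character l 1 = 1"
    "uenv_character l (u * v) = uenv_character l u * uenv_character l v"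
    "uenv_character l (uenv_of x) = l x"
    by (simp_all add: algebra_character_def)
qed

text \<open>
  The coproduct of the enveloping algebra obeys the Leibniz rule in a generator on the left; this
  is the recursion step behind the proofs by \<open>uenv_induct\<close>.
\<close>
lemma sweedler_uenv_comult_gen:
  assumes [simp]: "cbilinear \<phi>"
  shows "sweedler (uenv_comult (uenv_of x * u)) \<phi> =
    sweedler (uenv_comult u) (\<lambda>u1 u2. \<phi> (uenv_of x * u1) u2 + \<phi> u1 (uenv_of x * u2))"
proof -
  note [simp] = clinear_bilinear[OF assms]
  have "sweedler ((uenv_of x \<otimes>\<^sub>C 1 + 1 \<otimes>\<^sub>C uenv_of x) * t) \<phi> =
      sweedler t (\<lambda>u1 u2. \<phi> (uenv_of x * u1) u2 + \<phi> u1 (uenv_of x * u2))" for t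
    by (rule clinear_tensor_eqI) (simp_all add: distrib_right)
  then show ?thesis by (simp add: uenv_comult_simps)
qed

section \<open>The action and the coaction on the enveloping algebra\<close>

context g_hopf_algebra
begin

lemma eq_on_basis:
  assumes "clinear F" "clinear G" "\<And>i. i < N \<Longrightarrow> F (X i) = G (X i)"
  shows "F x = G x"
proof -
  have "F x - G x = 0"
    by (rule module_hom.eq_0_on_span[OF Vector_Spaces.linear.axioms(3)[OF clinear_minus[OF assms(1,2)]],
          of "X ` {..<N}"])
      (use assms(3) in \<open>auto simp: basis_span\<close>)
  then show ?thesis by simp
qed

lemma act_bilinear: "cbilinear act"
  using act_representation by (simp add: lie_representation_def)

lemmas clinear_act [simp] = clinear_bilinear[OF act_bilinear]
lemmas act_arith = clinearD[OF clinear_act(1)[OF clinear_ident]]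
  clinearD[OF clinear_act(2)[OF clinear_ident]]

lemma act_bracket: "act (lie_bracket x y) a = act x (act y a) - act y (act x a)"
  using act_representation by (simp add: lie_representation_def)

lemma act_one [simp]: "act x 1 = 0"
  using act_derivation[of x 1 1] by simp

lemmas clinear_coact [simp] = clinear_comp[OF coact_linear]
lemmas clinear_hopf [simp] = clinear_comp[OF comult_linear] clinear_comp[OF counit_linear]
  clinear_comp[OF antipode_linear]

abbreviation "uact \<equiv> uenv_act act"

lemma uact:
  "cbilinear uact" "uact 1 a = a" "uact (u * v) a = uact u (uact v a)" "uact (uenv_of x) a = act x a"
  using theI'[OF uenv_act_ex1[OF act_representation]] unfolding uenv_act_def by blast+

lemmas clinear_uact [simp] = clinear_bilinear[OF uact(1)]
lemmas uact_simps [simp] = uact(2,3,4)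

text \<open>
  The coaction of \<open>'f\<close> on the Lie algebra with values moved into the enveloping
  algebra, where they can be multiplied.
\<close>
definition coact_gen :: "'g \<Rightarrow> 'g uenv \<otimes>\<^sub>C 'f"
  where "coact_gen x = sweedler (coact x) (\<lambda>x0 x1. uenv_of x0 \<otimes>\<^sub>C x1)"

text \<open>
  The derivation \<open>id \<otimes> act x\<close> of the algebra
  \<open>'g uenv \<otimes>\<^sub>C 'f\<close>.
\<close>
definition act_second :: "'g \<Rightarrow> 'g uenv \<otimes>\<^sub>C 'f \<Rightarrow> 'g uenv \<otimes>\<^sub>C 'f"
  where "act_second x t = sweedler t (\<lambda>u a. u \<otimes>\<^sub>C act x a)"

lemma clinear_coact_gen [simp]: "clinear g \<Longrightarrow> clinear (\<lambda>x. coact_gen (g x))"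
  unfolding coact_gen_def by simp

lemma clinear_act_second [simp]:
  "clinear g \<Longrightarrow> clinear (\<lambda>x. act_second (g x) t)" "clinear h \<Longrightarrow> clinear (\<lambda>x. act_second y (h x))"
  unfolding act_second_def by simp_all

lemmas coact_gen_arith = clinearD[OF clinear_coact_gen[OF clinear_ident]]
  clinear_sum[OF clinear_coact_gen[OF clinear_ident]]
lemmas act_second_arith = clinearD[OF clinear_act_second(1)[OF clinear_ident]]
  clinearD[OF clinear_act_second(2)[OF clinear_ident]]

lemma act_second_tensor [simp]: "act_second x (u \<otimes>\<^sub>C a) = u \<otimes>\<^sub>C act x a"
  by (simp add: act_second_def)

lemma act_second_derivation: "act_second x (s * t) = act_second x s * t + s * act_second x t"
proof -
  have "act_second x ((u \<otimes>\<^sub>C a) * t) = act_second x (u \<otimes>\<^sub>C a) * t + (u \<otimes>\<^sub>C a) * act_second x t" for u a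
    by (induction t rule: tensor_induct)
      (simp_all add: act_second_arith act_derivation tensor_simps distrib_left)
  then show ?thesis
    by (induction s rule: tensor_induct) (simp_all add: act_second_arith distrib_right)
qed

lemma act_second_bracket:
  "act_second (lie_bracket x y) t = act_second x (act_second y t) - act_second y (act_second x t)"
  by (induction t rule: tensor_induct) (simp_all add: act_second_arith act_bracket tensor_arith)

lemma coact_gen_basis: "j < N \<Longrightarrow> coact_gen (X j) = (\<Sum>i<N. uenv_of (X i) \<otimes>\<^sub>C f i j)"
  by (simp add: coact_gen_def coact_coefficients sweedler_sum)

text \<open>
  This is the compatibility of the first order coefficients in coordinate-free form. It says that
  the operators \<open>t \<mapsto> coact_gen x * t + act_second x t\<close> represent the Lie
  algebra. Both sides are bilinear in \<open>x\<close> and \<open>y\<close>, so it is checked on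
  basis vectors, where the coefficient of \<open>X k\<close> is
  \<open>coefficients_structure\<close>; the double sum over \<open>C s r k\<close> there is minus
  the commutator of \<open>coact_gen (X i)\<close> and \<open>coact_gen (X j)\<close>.
\<close>
lemma coact_gen_bracket:
  "coact_gen (lie_bracket x y) = coact_gen x * coact_gen y - coact_gen y * coact_gen x
    + act_second x (coact_gen y) - act_second y (coact_gen x)"
proof -
  let ?X = "\<lambda>i. uenv_of (X i)"
  have bracket_lin: "clinear (\<lambda>x. lie_bracket x y)" "clinear (\<lambda>y. lie_bracket x y)" for x y :: 'g
    by (rule clinearI; simp add: lie_add_left lie_add_right lie_scaleC_left lie_scaleC_right)+
  note [simp] = clinear_comp[OF bracket_lin(1)] clinear_comp[OF bracket_lin(2)]
  have basis: "coact_gen (lie_bracket (X i) (X j)) =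
      coact_gen (X i) * coact_gen (X j) - coact_gen (X j) * coact_gen (X i)
      + act_second (X i) (coact_gen (X j)) - act_second (X j) (coact_gen (X i))"
    if ij: "i < N" "j < N" for i j
  proof -
    have prod: "coact_gen (X p) * coact_gen (X q) =
        (\<Sum>r<N. \<Sum>s<N. (?X r * ?X s) \<otimes>\<^sub>C (f r p * f s q))" if "p < N" "q < N" for p q
      using that by (simp add: coact_gen_basis sum_product)
    have der: "act_second (X p) (coact_gen (X q)) = (\<Sum>k<N. ?X k \<otimes>\<^sub>C act (X p) (f k q))"
      if "q < N" for p q
      using that
      by (simp add: coact_gen_basis clinear_sum[OF clinear_act_second(2)[OF clinear_ident]])
    have "act_second (X i) (coact_gen (X j)) - act_second (X j) (coact_gen (X i)) =
        (\<Sum>k<N. ?X k \<otimes>\<^sub>C (act (X i) (f k j) - act (X j) (f k i)))"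
      by (simp add: der ij sum_subtractf[symmetric] tensor_arith)
    also have "\<dots> = (\<Sum>k<N. \<Sum>s<N. \<Sum>r<N. C s r k *\<^sub>C (?X k \<otimes>\<^sub>C (f r i * f s j))) +
        (\<Sum>k<N. \<Sum>l<N. C i j l *\<^sub>C (?X k \<otimes>\<^sub>C f k l))"
      by (simp add: coefficients_structure ij tensor_simps tensor_sum sum.distrib)
    also have "(\<Sum>k<N. \<Sum>s<N. \<Sum>r<N. C s r k *\<^sub>C (?X k \<otimes>\<^sub>C (f r i * f s j))) =
        (\<Sum>s<N. \<Sum>k<N. \<Sum>r<N. C s r k *\<^sub>C (?X k \<otimes>\<^sub>C (f r i * f s j)))"
      by (rule sum.swap)
    also have "\<dots> = (\<Sum>s<N. \<Sum>r<N. \<Sum>k<N. C s r k *\<^sub>C (?X k \<otimes>\<^sub>C (f r i * f s j)))"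
      by (rule sum.cong[OF refl sum.swap])
    also have "\<dots> = (\<Sum>s<N. \<Sum>r<N. uenv_of (lie_bracket (X s) (X r)) \<otimes>\<^sub>C (f r i * f s j))"
      by (simp add: structure_constants uenv_of_arith tensor_sum tensor_simps)
    also have "\<dots> = coact_gen (X j) * coact_gen (X i) - coact_gen (X i) * coact_gen (X j)"
      unfolding prod[OF ij] prod[OF ij(2) ij(1)] uenv_of_simps(3)
      by (subst (3) sum.swap) (simp add: tensor_arith sum_subtractf mult.commute)
    also have "(\<Sum>k<N. \<Sum>l<N. C i j l *\<^sub>C (?X k \<otimes>\<^sub>C f k l)) = coact_gen (lie_bracket (X i) (X j))"
      by (subst sum.swap) (simp add: structure_constants ij coact_gen_arith coact_gen_basis
          cvec.scale_sum_right)
    finally show ?thesis by (simp add: algebra_simps)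
  qed
  have "coact_gen (lie_bracket x (X j)) = coact_gen x * coact_gen (X j) - coact_gen (X j) * coact_gen x
      + act_second x (coact_gen (X j)) - act_second (X j) (coact_gen x)" if "j < N" for j
    by (rule eq_on_basis) (simp_all add: basis that)
  then show ?thesis
    by (rule eq_on_basis[rotated 2]) simp_all
qed

abbreviation "ucoact \<equiv> uenv_coact act coact"

text \<open>
  The Lie algebra acts on \<open>'g uenv \<otimes>\<^sub>C 'f\<close> by the operators
  \<open>t \<mapsto> coact_gen x * t + act_second x t\<close>. The extended coaction of
  \<open>u\<close> is the result of letting \<open>u\<close> act on
  \<open>1 \<otimes>\<^sub>C 1\<close>. The product rule that describes the coaction follows from
  the formula \<open>A_J\<close> for the action of \<open>u\<close> on any tensor, by induction on
  \<open>u\<close>; taking \<open>u\<close> to be a generator in the product rule gives back the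
  recursion, so the description has only this solution.
\<close>
lemma ucoact:
  "clinear ucoact" "ucoact 1 = 1 \<otimes>\<^sub>C 1"
  "ucoact (uenv_of x * u) = coact_gen x * ucoact u + act_second x (ucoact u)"
proof -
  have "lie_representation (\<lambda>x t. coact_gen x * t + act_second x t)"
    unfolding lie_representation_def
    by (simp add: act_second_derivation act_second_bracket coact_gen_bracket act_second_arith algebra_simps)
  from uenv_module_exists[OF this] obtain A where
    A: "cbilinear A" "\<And>v. A 1 v = v" "\<And>u u' v. A (u * u') v = A u (A u' v)"
      "\<And>x v. A (uenv_of x) v = coact_gen x * v + act_second x v" by blast
  note [simp] = clinear_bilinear[OF A(1)]
  note A_arith = clinearD[OF cbilinearD(1)[OF A(1)]] clinearD[OF cbilinearD(2)[OF A(1)]]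
  define D where "D u = A u (1 \<otimes>\<^sub>C 1)" for u
  have D: "clinear D" "D 1 = 1 \<otimes>\<^sub>C 1" "D (uenv_of x * u) = coact_gen x * D u + act_second x (D u)" for x u
    unfolding D_def by (simp_all add: A)
  note [simp] = clinear_comp[OF D(1)]
  define J where "J u t = sweedler t (\<lambda>v0 v1. v0 \<otimes>\<^sub>C uact u v1)" for u and t :: "'g uenv \<otimes>\<^sub>C 'f"
  have [simp]: "clinear (\<lambda>x. J (g x) t)" if "clinear g" for t and g :: "'z::complex_vector \<Rightarrow> 'g uenv"
    unfolding J_def using that by simp
  have [simp]: "clinear (\<lambda>x. J u (g x))" if "clinear g" for u and g :: "'z::complex_vector \<Rightarrow> _"
    unfolding J_def using that by simp
  have J_tensor [simp]: "J u (v \<otimes>\<^sub>C a) = v \<otimes>\<^sub>C uact u a" for u v a by (simp add: J_def)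
  have J_one [simp]: "J 1 t = t" for t
    by (rule clinear_tensor_eqI) simp_all
  have J_gen [simp]: "J (uenv_of x) t = act_second x t" for x t
    by (rule clinear_tensor_eqI) simp_all
  have J_mult: "J (u * v) t = J u (J v t)" for u v t
    by (rule clinear_tensor_eqI) simp_all
  have times_J: "s * J u t = sweedler s (\<lambda>u10 u11. sweedler t (\<lambda>v0 v1.
        (u10 * v0) \<otimes>\<^sub>C (u11 * uact u v1)))" for s t u
  proof (rule clinear_tensor_eqI[of "\<lambda>s. s * J u t"])
    fix p q
    show "(p \<otimes>\<^sub>C q) * J u t = sweedler (p \<otimes>\<^sub>C q) (\<lambda>u10 u11. sweedler t (\<lambda>v0 v1.
        (u10 * v0) \<otimes>\<^sub>C (u11 * uact u v1)))"
      by (rule clinear_tensor_eqI[of "\<lambda>t. (p \<otimes>\<^sub>C q) * J u t"]) simp_all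
  qed simp_all
  \<comment> \<open>the second factor of the product rule is \<open>D v\<close>, so the action of
    \<open>u\<close> is needed on arbitrary tensors\<close>
  have A_J: "A u t = sweedler (uenv_comult u) (\<lambda>u1 u2. D u1 * J u2 t)" for u t
  proof (induction u rule: uenv_induct)
    case (gen x u)
    have "sweedler (uenv_comult (uenv_of x * u)) (\<lambda>u1 u2. D u1 * J u2 t) =
        sweedler (uenv_comult u) (\<lambda>u1 u2. coact_gen x * (D u1 * J u2 t) + act_second x (D u1 * J u2 t))"
      by (simp add: sweedler_uenv_comult_gen D(3) J_mult act_second_derivation algebra_simps)
    then show ?case
      by (simp add: A gen sweedler_add sweedler_times
          clinear_of_sweedler[OF clinear_act_second(2)[OF clinear_ident]])
  qed (simp_all add: uenv_comult_simps A A_arith D(2) clinearD[OF uenv_comult_simps(1)])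
  let ?P = "\<lambda>D. clinear D \<and>
    (\<forall>x. D (uenv_of x) = sweedler (coact x) (\<lambda>x0 x1. uenv_of x0 \<otimes>\<^sub>C x1)) \<and>
    D 1 = 1 \<otimes>\<^sub>C 1 \<and>
    (\<forall>u v. D (u * v) =
      sweedler (uenv_comult u) (\<lambda>u1 u2. sweedler (D u1) (\<lambda>u10 u11. sweedler (D v) (\<lambda>v0 v1.
        (u10 * v0) \<otimes>\<^sub>C (u11 * uenv_act act u2 v1)))))"
  have "ucoact = D"
    unfolding uenv_coact_def
  proof (rule the_equality)
    have "D (u * v) = sweedler (uenv_comult u) (\<lambda>u1 u2. D u1 * J u2 (D v))" for u v
      unfolding D_def[of "u * v"] A(3) D_def[of v, symmetric] by (rule A_J)
    then show "?P D"
      using D(3)[of _ 1] by (simp add: D(1,2) times_J coact_gen_def tensor_arith)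
  next
    fix E assume E: "?P E"
    then have E1: "clinear E" "E 1 = 1 \<otimes>\<^sub>C 1" "\<And>x. E (uenv_of x) = coact_gen x"
      "\<And>u v. E (u * v) = sweedler (uenv_comult u) (\<lambda>u1 u2. E u1 * J u2 (E v))"
      unfolding times_J coact_gen_def by blast+
    note [simp] = clinear_comp[OF E1(1)]
    have E2: "E (uenv_of x * v) = coact_gen x * E v + act_second x (E v)" for x v
      unfolding E1(4) by (simp add: uenv_comult_simps E1(2,3))
    show "E = D"
    proof
      fix u show "E u = D u"
        by (induction u rule: uenv_induct)
          (simp_all add: E1(2) D(2,3) E2 clinearD[OF E1(1)] clinearD[OF D(1)])
    qed
  qed
  then show "clinear ucoact" "ucoact 1 = 1 \<otimes>\<^sub>C 1"
    "ucoact (uenv_of x * u) = coact_gen x * ucoact u + act_second x (ucoact u)"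
    using D by simp_all
qed

lemmas clinear_ucoact [simp] = clinear_comp[OF ucoact(1)]

end

section \<open>The bicrossed product algebra and its universal property\<close>

context g_hopf_algebra
begin

text \<open>
  Left multiplication by \<open>a \<otimes>\<^sub>C 1\<close> multiplies the first tensor factor,
  and left multiplication by \<open>1 \<otimes>\<^sub>C uenv_of x\<close> acts by the Leibniz rule
  on both factors. The coproduct of the enveloping algebra in the definition of the product enters
  only through the reduction to these two cases.
\<close>
abbreviation bmul :: "'f \<otimes>\<^sub>C 'g uenv \<Rightarrow> 'f \<otimes>\<^sub>C 'g uenv \<Rightarrow> 'f \<otimes>\<^sub>C 'g uenv" (infixl \<open>\<odot>\<close> 70)
  where "bmul \<equiv> bicrossed_mult act"

lemma bmul_bilinear: "cbilinear bmul"
  unfolding bicrossed_mult_def by simp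

lemmas clinear_bmul [simp] = clinear_bilinear[OF bmul_bilinear]
lemmas bmul_arith = clinearD[OF clinear_bmul(1)[OF clinear_ident]]
  clinearD[OF clinear_bmul(2)[OF clinear_ident]]

lemma bmul_tensor: "(a \<otimes>\<^sub>C u) \<odot> (b \<otimes>\<^sub>C v) =
    sweedler (uenv_comult u) (\<lambda>u1 u2. (a * uact u1 b) \<otimes>\<^sub>C (u2 * v))"
  unfolding bicrossed_mult_def by simp

lemma bmul_base: "(a \<otimes>\<^sub>C 1) \<odot> (b \<otimes>\<^sub>C v) = (a * b) \<otimes>\<^sub>C v"
  by (simp add: bmul_tensor uenv_comult_simps)

lemma bmul_gen: "(1 \<otimes>\<^sub>C uenv_of x) \<odot> (b \<otimes>\<^sub>C v) = act x b \<otimes>\<^sub>C v + b \<otimes>\<^sub>C (uenv_of x * v)"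
  by (simp add: bmul_tensor uenv_comult_simps)

lemma bmul_one: "(1 \<otimes>\<^sub>C 1) \<odot> t = t"
  by (rule clinear_tensor_eqI) (simp_all add: bmul_base)

lemma bmul_split: "(a \<otimes>\<^sub>C u) \<odot> t = (a \<otimes>\<^sub>C 1) \<odot> ((1 \<otimes>\<^sub>C u) \<odot> t)"
proof (rule clinear_tensor_eqI[of "\<lambda>t. (a \<otimes>\<^sub>C u) \<odot> t"])
  fix b v
  have "(a \<otimes>\<^sub>C 1) \<odot> sweedler s (\<lambda>u1 u2. uact u1 b \<otimes>\<^sub>C (u2 * v)) =
      sweedler s (\<lambda>u1 u2. (a * uact u1 b) \<otimes>\<^sub>C (u2 * v))" for s
    by (rule clinear_tensor_eqI) (simp_all add: bmul_base)
  then show "(a \<otimes>\<^sub>C u) \<odot> (b \<otimes>\<^sub>C v) = (a \<otimes>\<^sub>C 1) \<odot> ((1 \<otimes>\<^sub>C u) \<odot> (b \<otimes>\<^sub>C v))"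
    by (simp add: bmul_tensor)
qed simp_all

lemma bmul_gen_mult: "(1 \<otimes>\<^sub>C (uenv_of x * u)) \<odot> t = (1 \<otimes>\<^sub>C uenv_of x) \<odot> ((1 \<otimes>\<^sub>C u) \<odot> t)"
proof (rule clinear_tensor_eqI[of "\<lambda>t. (1 \<otimes>\<^sub>C (uenv_of x * u)) \<odot> t"])
  fix b v
  have "(1 \<otimes>\<^sub>C uenv_of x) \<odot> sweedler s (\<lambda>u1 u2. uact u1 b \<otimes>\<^sub>C (u2 * v)) =
      sweedler s (\<lambda>u1 u2. uact (uenv_of x * u1) b \<otimes>\<^sub>C (u2 * v) + uact u1 b \<otimes>\<^sub>C (uenv_of x * u2 * v))" for s
    by (rule clinear_tensor_eqI) (simp_all add: bmul_gen mult.assoc)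
  then show "(1 \<otimes>\<^sub>C (uenv_of x * u)) \<odot> (b \<otimes>\<^sub>C v) = (1 \<otimes>\<^sub>C uenv_of x) \<odot> ((1 \<otimes>\<^sub>C u) \<odot> (b \<otimes>\<^sub>C v))"
    by (simp add: bmul_tensor sweedler_uenv_comult_gen)
qed simp_all

definition generators :: "('f \<otimes>\<^sub>C 'g uenv) set"
  where "generators = range (\<lambda>a. a \<otimes>\<^sub>C 1) \<union> range (\<lambda>x. 1 \<otimes>\<^sub>C uenv_of x)"

lemma generator_cases [consumes 1, case_names base gen]:
  assumes "g \<in> generators"
  obtains a where "g = a \<otimes>\<^sub>C 1" | x where "g = 1 \<otimes>\<^sub>C uenv_of x"
  using assms unfolding generators_def by blast

text \<open>
  Every element arises from the unit by left multiplications with generators and by addition.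
  Scalars need no case of their own, as they are multiplications by
  \<open>c *\<^sub>C 1 \<otimes>\<^sub>C 1\<close>.
\<close>
lemma bicrossed_induct [case_names one generator add]:
  assumes one: "P (1 \<otimes>\<^sub>C 1)"
    and gen: "\<And>g t. g \<in> generators \<Longrightarrow> P t \<Longrightarrow> P (g \<odot> t)"
    and add: "\<And>s t. P s \<Longrightarrow> P t \<Longrightarrow> P (s + t)"
  shows "P t"
proof -
  have base: "P ((a * b) \<otimes>\<^sub>C u)" if "P (b \<otimes>\<^sub>C u)" for a b u
    using gen[OF _ that, of "a \<otimes>\<^sub>C 1"] by (simp add: generators_def bmul_base)
  have "P (1 \<otimes>\<^sub>C u)" for u
  proof (induction u rule: uenv_induct)
    case (gen x u)
    then show ?case
      using assms(2)[OF _ gen, of "1 \<otimes>\<^sub>C uenv_of x"] by (simp add: generators_def bmul_gen tensor_arith)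
  next
    case (scaleC c u)
    then show ?case
      using base[of 1 u "c *\<^sub>C 1"] by (simp add: tensor_simps)
  qed (simp_all add: one add tensor_simps)
  then have tensor: "P (a \<otimes>\<^sub>C u)" for a u using base[of 1 u a] by simp
  show ?thesis
    by (induction t rule: tensor_induct) (use tensor[of 0 1] in \<open>simp_all add: tensor add tensor_arith\<close>)
qed

text \<open>
  For a generator \<open>1 \<otimes>\<^sub>C uenv_of x\<close> this is the commutation rule of
  left multiplications \<open>X b = b X + act x b\<close>, which holds because the action is by
  derivations.
\<close>
lemma bmul_generator_assoc:
  assumes "g \<in> generators"
  shows "(g \<odot> s) \<odot> t = g \<odot> (s \<odot> t)"
  using assms
proof (cases rule: generator_cases)
  case (base a)
  have *: "(a \<otimes>\<^sub>C 1) \<odot> ((b \<otimes>\<^sub>C 1) \<odot> t) = ((a * b) \<otimes>\<^sub>C 1) \<odot> t" for b t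
    by (rule clinear_tensor_eqI) (simp_all add: bmul_base mult.assoc)
  show ?thesis unfolding base
  proof (rule clinear_tensor_eqI[of "\<lambda>s. ((a \<otimes>\<^sub>C 1) \<odot> s) \<odot> t"])
    fix b v
    show "((a \<otimes>\<^sub>C 1) \<odot> (b \<otimes>\<^sub>C v)) \<odot> t = (a \<otimes>\<^sub>C 1) \<odot> ((b \<otimes>\<^sub>C v) \<odot> t)"
      unfolding bmul_base bmul_split[of "a * b" v] bmul_split[of b v] * ..
  qed simp_all
next
  case (gen x)
  have *: "(1 \<otimes>\<^sub>C uenv_of x) \<odot> ((b \<otimes>\<^sub>C 1) \<odot> t) =
      (act x b \<otimes>\<^sub>C 1) \<odot> t + (b \<otimes>\<^sub>C 1) \<odot> ((1 \<otimes>\<^sub>C uenv_of x) \<odot> t)" for b t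
    by (rule clinear_tensor_eqI)
      (simp_all add: bmul_base bmul_gen act_derivation bmul_arith tensor_simps)
  show ?thesis unfolding gen
  proof (rule clinear_tensor_eqI[of "\<lambda>s. ((1 \<otimes>\<^sub>C uenv_of x) \<odot> s) \<odot> t"])
    fix b v
    show "((1 \<otimes>\<^sub>C uenv_of x) \<odot> (b \<otimes>\<^sub>C v)) \<odot> t = (1 \<otimes>\<^sub>C uenv_of x) \<odot> ((b \<otimes>\<^sub>C v) \<odot> t)"
      unfolding bmul_gen bmul_arith(1) bmul_split[of "act x b" v] bmul_split[of b v] *
        bmul_split[of b "uenv_of x * v"] bmul_gen_mult ..
  qed simp_all
qed

sublocale bicrossed: unital_algebra bmul "1 \<otimes>\<^sub>C 1"
proof
  show "cbilinear bmul" by (rule bmul_bilinear)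
  show "(1 \<otimes>\<^sub>C 1) \<odot> t = t" for t by (rule bmul_one)
  show "t \<odot> (1 \<otimes>\<^sub>C 1) = t" for t
    by (induction t rule: bicrossed_induct) (simp_all add: bmul_one bmul_generator_assoc bmul_arith)
  show "(r \<odot> s) \<odot> t = r \<odot> (s \<odot> t)" for r s t
    by (induction r rule: bicrossed_induct) (simp_all add: bmul_one bmul_generator_assoc bmul_arith)
qed

lemma bmul_uenv: "(1 \<otimes>\<^sub>C u) \<odot> (1 \<otimes>\<^sub>C v) = 1 \<otimes>\<^sub>C (u * v)"
proof (induction u rule: uenv_induct)
  case (gen x u)
  show ?case by (simp add: bmul_gen_mult gen bmul_gen tensor_arith mult.assoc)
qed (simp_all add: bmul_one tensor_simps bmul_arith distrib_right mult_scaleC_left)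

lemma bmul_commute: "(1 \<otimes>\<^sub>C uenv_of x) \<odot> (b \<otimes>\<^sub>C 1) = act x b \<otimes>\<^sub>C 1 + b \<otimes>\<^sub>C uenv_of x"
  by (simp add: bmul_gen)

text \<open>
  The universal property of the bicrossed product: algebra maps \<open>\<phi>\<close> on
  \<open>'f\<close> and \<open>\<Psi>\<close> on the enveloping algebra combine to an algebra map
  if they respect the commutation relation between \<open>'f\<close> and the Lie algebra. For
  \<open>\<Psi>\<close> it is enough to know the recursion on generators. Applied to the ground
  field, to the tensor square and to the opposite algebra, it gives multiplicativity of characters
  and of the coproduct and antimultiplicativity of the antipode.
\<close>
lemma bicrossed_lift:
  assumes B: "unital_algebra mB eB"
    and \<phi>: "clinear \<phi>" "\<phi> 1 = eB" "\<And>a b. \<phi> (a * b) = mB (\<phi> a) (\<phi> b)"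
    and \<Psi>: "clinear \<Psi>" "\<Psi> 1 = eB" "\<And>x u. \<Psi> (uenv_of x * u) = mB (\<Psi> (uenv_of x)) (\<Psi> u)"
    and cross: "\<And>x a. mB (\<Psi> (uenv_of x)) (\<phi> a) = mB (\<phi> a) (\<Psi> (uenv_of x)) + \<phi> (act x a)"
    and \<Phi>: "clinear \<Phi>" "\<And>a u. \<Phi> (a \<otimes>\<^sub>C u) = mB (\<phi> a) (\<Psi> u)"
  shows "\<Phi> (s \<odot> t) = mB (\<Phi> s) (\<Phi> t)"
proof -
  interpret B: unital_algebra mB eB by (rule B)
  note [simp] = clinear_comp[OF \<Phi>(1)] B.clinear_mul
  have \<Phi>_base: "\<Phi> (a \<otimes>\<^sub>C 1) = \<phi> a" and \<Phi>_gen: "\<Phi> (1 \<otimes>\<^sub>C uenv_of x) = \<Psi> (uenv_of x)" for a x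
    by (simp_all add: \<Phi> \<phi> \<Psi> B.unit)
  have gen: "\<Phi> (g \<odot> t) = mB (\<Phi> g) (\<Phi> t)" if "g \<in> generators" for g t
    using that
  proof (cases rule: generator_cases)
    case (base a)
    show ?thesis unfolding base
      by (rule clinear_tensor_eqI[of "\<lambda>t. \<Phi> ((a \<otimes>\<^sub>C 1) \<odot> t)"])
        (simp_all add: bmul_base \<Phi>(2) \<phi>(3) \<Psi>(2) B.unit B.assoc)
  next
    case (gen x)
    show ?thesis unfolding gen
    proof (rule clinear_tensor_eqI[of "\<lambda>t. \<Phi> ((1 \<otimes>\<^sub>C uenv_of x) \<odot> t)"])
      fix b v
      have "mB (\<Psi> (uenv_of x)) (mB (\<phi> b) (\<Psi> v)) = mB (mB (\<phi> b) (\<Psi> (uenv_of x)) + \<phi> (act x b)) (\<Psi> v)"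
        by (simp add: B.assoc flip: cross)
      then show "\<Phi> ((1 \<otimes>\<^sub>C uenv_of x) \<odot> (b \<otimes>\<^sub>C v)) = mB (\<Phi> (1 \<otimes>\<^sub>C uenv_of x)) (\<Phi> (b \<otimes>\<^sub>C v))"
        unfolding \<Phi>_gen bmul_gen clinearD(1)[OF \<Phi>(1)] \<Phi>(2) \<Psi>(3) by (simp add: \<phi>(2) B.unit B.mul_arith B.assoc add.commute)
    qed simp_all
  qed
  have "\<Phi> (1 \<otimes>\<^sub>C 1) = eB" by (simp add: \<Phi> \<phi> \<Psi> B.unit)
  then show ?thesis
    by (induction s rule: bicrossed_induct)
      (simp_all add: bmul_one B.unit bmul_generator_assoc gen B.assoc bmul_arith B.mul_arith
        clinearD[OF \<Phi>(1)])
qed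

lemma bicrossed_character:
  assumes l: "clinear l" "\<And>x y. l (lie_bracket x y) = 0"
  shows "algebra_character bmul (1 \<otimes>\<^sub>C 1) (bicrossed_functional counit (uenv_character l))"
    "bicrossed_functional counit (uenv_character l) (a \<otimes>\<^sub>C u) = counit a * uenv_character l u"
proof -
  note \<chi> = uenv_character_simps[OF l]
  note [simp] = clinear_comp[OF \<chi>(1)]
  let ?\<delta> = "bicrossed_functional counit (uenv_character l)"
  have lin: "clinear ?\<delta>" and tensor: "\<And>a u. ?\<delta> (a \<otimes>\<^sub>C u) = counit a * uenv_character l u"
    unfolding bicrossed_functional_def by simp_all
  have "?\<delta> (s \<odot> t) = ?\<delta> s * ?\<delta> t" for s t
    by (rule bicrossed_lift[of "(*)" 1 counit "uenv_character l"])
      (simp_all add: unital_algebra_times lin tensor counit_linear counit_unit counit_mult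
        \<chi> counit_act mult.commute)
  then show "algebra_character bmul (1 \<otimes>\<^sub>C 1) ?\<delta>"
    by (simp add: algebra_character_def lin tensor counit_unit \<chi>)
  show "?\<delta> (a \<otimes>\<^sub>C u) = counit a * uenv_character l u" by (rule tensor)
qed

end

section \<open>Hopf axioms hold on subalgebras\<close>

context unital_algebra
begin

text \<open>
  Both iterated coproducts are algebra maps into the triple tensor product, so the elements on
  which they agree are closed under products. The other axioms in this section behave alike.
\<close>
lemma coassoc_mul:
  assumes D: "clinear D" "\<And>x y. D (mul x y) = tensor_mult mul mul (D x) (D y)"
    and xy: "\<And>z. z \<in> {x, y} \<Longrightarrow>
      sweedler (D z) (\<lambda>a b. sweedler (D a) (\<lambda>a1 a2. a1 \<otimes>\<^sub>C (a2 \<otimes>\<^sub>C b))) =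
      sweedler (D z) (\<lambda>a b. sweedler (D b) (\<lambda>b1 b2. a \<otimes>\<^sub>C (b1 \<otimes>\<^sub>C b2)))"
  shows "sweedler (D (mul x y)) (\<lambda>a b. sweedler (D a) (\<lambda>a1 a2. a1 \<otimes>\<^sub>C (a2 \<otimes>\<^sub>C b))) =
    sweedler (D (mul x y)) (\<lambda>a b. sweedler (D b) (\<lambda>b1 b2. a \<otimes>\<^sub>C (b1 \<otimes>\<^sub>C b2)))"
proof -
  let ?m2 = "tensor_mult mul mul" and ?m3 = "tensor_mult mul (tensor_mult mul mul)"
  interpret m3: unital_algebra ?m3 "e \<otimes>\<^sub>C (e \<otimes>\<^sub>C e)"
    by (intro unital_algebra_tensor unital_algebra_axioms)
  note [simp] = clinear_comp[OF D(1)] bilinear clinear_mul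
  let ?L = "\<lambda>t. sweedler t (\<lambda>a b. sweedler (D a) (\<lambda>a1 a2. a1 \<otimes>\<^sub>C (a2 \<otimes>\<^sub>C b)))"
  let ?R = "\<lambda>t. sweedler t (\<lambda>a b. sweedler (D b) (\<lambda>b1 b2. a \<otimes>\<^sub>C (b1 \<otimes>\<^sub>C b2)))"
  have L: "?L (?m2 s t) = ?m3 (?L s) (?L t)" for s t
    by (simp add: sweedler_tensor_mult D(2) m3.mul_sweedler) (subst sweedler_swap, rule refl)
  have R: "?R (?m2 s t) = ?m3 (?R s) (?R t)" for s t
    by (simp add: sweedler_tensor_mult D(2) m3.mul_sweedler) (subst sweedler_swap, rule refl)
  show ?thesis by (simp only: D(2) L R xy insertI1 insertI2)
qed

lemma counit_mul:
  assumes D: "\<And>x y. D (mul x y) = tensor_mult mul mul (D x) (D y)"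
    and \<epsilon>: "clinear \<epsilon>" "\<And>x y. \<epsilon> (mul x y) = \<epsilon> x * \<epsilon> y"
  shows "sweedler (D (mul x y)) (\<lambda>a b. \<epsilon> a *\<^sub>C b) =
      mul (sweedler (D x) (\<lambda>a b. \<epsilon> a *\<^sub>C b)) (sweedler (D y) (\<lambda>a b. \<epsilon> a *\<^sub>C b))"
    "sweedler (D (mul x y)) (\<lambda>a b. \<epsilon> b *\<^sub>C a) =
      mul (sweedler (D x) (\<lambda>a b. \<epsilon> b *\<^sub>C a)) (sweedler (D y) (\<lambda>a b. \<epsilon> b *\<^sub>C a))"
  using bilinear by (simp_all add: D \<epsilon>(2) clinear_comp[OF \<epsilon>(1)] clinear_mul sweedler_tensor_mult
      mul_sweedler mul_arith sweedler_scaleC[symmetric])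

text \<open>
  In \<open>S((xy)\<^sub>1) (xy)\<^sub>2 = S(y\<^sub>1) S(x\<^sub>1) x\<^sub>2 y\<^sub>2\<close>
  the inner product collapses to the scalar \<open>\<epsilon>(x)\<close>, and then the outer one
  does.
\<close>
lemma antipode_mul:
  assumes D: "\<And>x y. D (mul x y) = tensor_mult mul mul (D x) (D y)"
    and \<epsilon>: "\<And>x y. \<epsilon> (mul x y) = \<epsilon> x * \<epsilon> y"
    and S: "clinear S" "\<And>x y. S (mul x y) = mul (S y) (S x)"
  shows "sweedler (D x) (\<lambda>a b. mul (S a) b) = \<epsilon> x *\<^sub>C e \<Longrightarrow>
      sweedler (D y) (\<lambda>a b. mul (S a) b) = \<epsilon> y *\<^sub>C e \<Longrightarrow>
      sweedler (D (mul x y)) (\<lambda>a b. mul (S a) b) = \<epsilon> (mul x y) *\<^sub>C e"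
    and "sweedler (D x) (\<lambda>a b. mul a (S b)) = \<epsilon> x *\<^sub>C e \<Longrightarrow>
      sweedler (D y) (\<lambda>a b. mul a (S b)) = \<epsilon> y *\<^sub>C e \<Longrightarrow>
      sweedler (D (mul x y)) (\<lambda>a b. mul a (S b)) = \<epsilon> (mul x y) *\<^sub>C e"
proof -
  note [simp] = bilinear clinear_comp[OF S(1)] clinear_mul
  assume x: "sweedler (D x) (\<lambda>a b. mul (S a) b) = \<epsilon> x *\<^sub>C e"
    and y: "sweedler (D y) (\<lambda>a b. mul (S a) b) = \<epsilon> y *\<^sub>C e"
  have "sweedler (D (mul x y)) (\<lambda>a b. mul (S a) b) =
      sweedler (D y) (\<lambda>c d. mul (S c) (mul (sweedler (D x) (\<lambda>a b. mul (S a) b)) d))"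
    by (simp add: D S(2) sweedler_tensor_mult mul_sweedler assoc) (rule sweedler_swap)
  also have "\<dots> = \<epsilon> x *\<^sub>C sweedler (D y) (\<lambda>c d. mul (S c) d)"
    unfolding x by (simp add: mul_arith unit sweedler_scaleC)
  finally show "sweedler (D (mul x y)) (\<lambda>a b. mul (S a) b) = \<epsilon> (mul x y) *\<^sub>C e"
    by (simp add: y \<epsilon>)
next
  note [simp] = bilinear clinear_comp[OF S(1)] clinear_mul
  assume x: "sweedler (D x) (\<lambda>a b. mul a (S b)) = \<epsilon> x *\<^sub>C e"
    and y: "sweedler (D y) (\<lambda>a b. mul a (S b)) = \<epsilon> y *\<^sub>C e"
  have "sweedler (D (mul x y)) (\<lambda>a b. mul a (S b)) =
      sweedler (D x) (\<lambda>a b. mul a (mul (sweedler (D y) (\<lambda>c d. mul c (S d))) (S b)))"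
    by (simp add: D S(2) sweedler_tensor_mult mul_sweedler assoc)
  also have "\<dots> = \<epsilon> y *\<^sub>C sweedler (D x) (\<lambda>a b. mul a (S b))"
    unfolding y by (simp add: mul_arith unit sweedler_scaleC)
  finally show "sweedler (D (mul x y)) (\<lambda>a b. mul a (S b)) = \<epsilon> (mul x y) *\<^sub>C e"
    by (simp add: x \<epsilon> mult.commute)
qed

end

section \<open>The coproduct of the bicrossed product\<close>

context g_hopf_algebra
begin

lemma coact_coassoc_apply:
  assumes lin: "\<And>b c. clinear (\<lambda>a. F a b c)" "\<And>a c. clinear (\<lambda>b. F a b c)" "\<And>a b. clinear (\<lambda>c. F a b c)"
  shows "sweedler (coact x) (\<lambda>x0 x1. sweedler (coact x0) (\<lambda>y0 y1. F y0 y1 x1)) =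
    sweedler (coact x) (\<lambda>x0 x1. sweedler (comult x1) (\<lambda>a b. F x0 a b))"
proof -
  define G where "G t = sweedler t (\<lambda>a s. sweedler s (\<lambda>b c. F a b c))" for t
  have G: "clinear G" "\<And>a b c. G (a \<otimes>\<^sub>C (b \<otimes>\<^sub>C c)) = F a b c"
    unfolding G_def by (simp_all add: lin)
  show ?thesis
    using arg_cong[OF coact_coassoc[of x], of G]
    by (simp add: clinear_of_sweedler[OF G(1)] G(2))
qed

lemma antipode_times: "antipode (a * b) = antipode a * antipode b"
  by (simp add: antipode_antimultiplicative mult.commute)

text \<open>
  Apply \<open>m \<circ> (S \<otimes> id)\<close> to the formula for
  \<open>comult (act x a)\<close>; the result vanishes since the counit kills
  \<open>act x a\<close>. Differentiating
  \<open>\<Sum> S(a\<^sub>1) a\<^sub>2 = \<epsilon>(a)\<close> along \<open>x\<close> also gives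
  zero. The terms \<open>S(a\<^sub>1) act x a\<^sub>2\<close> cancel, so the difference of the two
  sides of the claim has convolution product zero with the identity.
\<close>
lemma antipode_act_coact:
  "sweedler (coact x) (\<lambda>x0 x1. antipode (act x0 a) * x1) = act x (antipode a)"
proof -
  define Q where "Q a = sweedler (coact x) (\<lambda>x0 x1. antipode (act x0 a) * x1) - act x (antipode a)" for a
  have "Q a = 0 * antipode a"
  proof (rule convolution_inverse_unique[where P = "\<lambda>x. x" and R = antipode])
    show "clinear Q" unfolding Q_def by simp
    fix a
    let ?S = "sweedler (comult a)"
    have "?S (\<lambda>a1 a2. sweedler (coact x) (\<lambda>x0 x1. antipode (act x0 a1) * (x1 * a2))) +
        ?S (\<lambda>a1 a2. antipode a1 * act x a2) = sweedler (comult (act x a)) (\<lambda>p q. antipode p * q)"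
      by (simp add: comult_act sweedler_sweedler sweedler_add)
    also have "\<dots> = act x (?S (\<lambda>a1 a2. antipode a1 * a2))"
      by (simp add: antipode_left counit_act act_arith)
    also have "\<dots> = ?S (\<lambda>a1 a2. act x (antipode a1) * a2) + ?S (\<lambda>a1 a2. antipode a1 * act x a2)"
      by (simp add: clinear_of_sweedler[OF clinear_act(2)[OF clinear_ident]] act_derivation sweedler_add)
    finally have "?S (\<lambda>a1 a2. sweedler (coact x) (\<lambda>x0 x1. antipode (act x0 a1) * (x1 * a2))) =
        ?S (\<lambda>a1 a2. act x (antipode a1) * a2)"
      by simp
    then show "?S (\<lambda>a1 a2. Q a1 * a2) = counit a *\<^sub>C 0"
      unfolding Q_def left_diff_distrib sweedler_diff(2) by (simp add: sweedler_times mult.assoc)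
  qed (simp_all add: antipode_linear antipode_right)
  then show ?thesis by (simp add: Q_def)
qed

text \<open>
  Solve the preceding identity for \<open>S(act x a)\<close>, by convolving on the right with the
  antipode along the coaction. This formula is exactly the commutation relation that the antipode
  of the bicrossed product must respect.
\<close>
lemma antipode_act:
  "antipode (act x a) = sweedler (coact x) (\<lambda>x0 x1. act x0 (antipode a) * antipode x1)"
proof -
  have "sweedler (coact x) (\<lambda>x0 x1. act x0 (antipode a) * antipode x1) =
      sweedler (coact x) (\<lambda>x0 x1. sweedler (coact x0) (\<lambda>y0 y1. antipode (act y0 a) * (y1 * antipode x1)))"
    by (simp add: antipode_act_coact[symmetric] sweedler_times mult.assoc)
  also have "\<dots> = sweedler (coact x) (\<lambda>x0 x1. sweedler (comult x1) (\<lambda>p q. antipode (act x0 a) * (p * antipode q)))"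
    by (rule coact_coassoc_apply) simp_all
  also have "\<dots> = sweedler (coact x) (\<lambda>x0 x1. antipode (act (counit x1 *\<^sub>C x0) a))"
    by (simp add: antipode_right act_arith clinearD[OF antipode_linear] mult_scaleC_right
        flip: sweedler_times(1))
  also have "\<dots> = antipode (act (sweedler (coact x) (\<lambda>x0 x1. counit x1 *\<^sub>C x0)) a)"
    by (simp add: clinear_of_sweedler[where F = "\<lambda>z. antipode (act z a)"])
  finally show ?thesis by (simp add: coact_counit)
qed

lemma sweedler_coact_gen:
  "cbilinear \<phi> \<Longrightarrow> sweedler (coact_gen x) \<phi> = sweedler (coact x) (\<lambda>x0 x1. \<phi> (uenv_of x0) x1)"
  by (simp add: coact_gen_def sweedler_sweedler)

lemma ucoact_gen: "ucoact (uenv_of x) = coact_gen x"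
  using ucoact(3)[of x 1] by (simp add: ucoact(2) tensor_arith)

abbreviation "bcomult \<equiv> bicrossed_comult comult act coact"
abbreviation "bmul2 \<equiv> tensor_mult bmul bmul"

sublocale bicrossed2: unital_algebra bmul2 "(1 \<otimes>\<^sub>C 1) \<otimes>\<^sub>C (1 \<otimes>\<^sub>C 1)"
  by (intro unital_algebra_tensor bicrossed.unital_algebra_axioms)

declare bmul_bilinear [simp]

lemma bcomult_linear: "clinear bcomult"
  unfolding bicrossed_comult_def by simp

lemma bcomult_base: "bcomult (a \<otimes>\<^sub>C 1) = sweedler (comult a) (\<lambda>a1 a2. (a1 \<otimes>\<^sub>C 1) \<otimes>\<^sub>C (a2 \<otimes>\<^sub>C 1))"
  by (simp add: bicrossed_comult_def uenv_comult_simps ucoact(2))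

lemma bcomult_gen: "bcomult (1 \<otimes>\<^sub>C uenv_of x) =
    sweedler (coact x) (\<lambda>x0 x1. (1 \<otimes>\<^sub>C uenv_of x0) \<otimes>\<^sub>C (x1 \<otimes>\<^sub>C 1)) + (1 \<otimes>\<^sub>C 1) \<otimes>\<^sub>C (1 \<otimes>\<^sub>C uenv_of x)"
  by (simp add: bicrossed_comult_def uenv_comult_simps ucoact(2) ucoact_gen comult_unit sweedler_coact_gen)

text \<open>
  On \<open>a \<otimes>\<^sub>C u\<close> the coproduct is the product of the coproduct of
  \<open>a\<close>, embedded by \<open>\<Phi>\<close>, and an element \<open>\<Psi> u\<close> of
  the tensor square. The recursion \<open>J_step\<close> for \<open>\<Psi>\<close> restates the
  recursion of the extended coaction, and the commutation relation between \<open>\<Psi>\<close>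
  and \<open>\<Phi>\<close> is \<open>comult_act\<close>.
\<close>
lemma bcomult_mult: "bcomult (s \<odot> t) = bmul2 (bcomult s) (bcomult t)"
proof -
  define \<Phi> where "\<Phi> t = sweedler t (\<lambda>a1 a2. (a1 \<otimes>\<^sub>C (1::'g uenv)) \<otimes>\<^sub>C (a2 \<otimes>\<^sub>C (1::'g uenv)))"
    for t :: "'f \<otimes>\<^sub>C 'f"
  have [simp]: "clinear (\<lambda>x. \<Phi> (h x))" if "clinear h" for h :: "'z::complex_vector \<Rightarrow> _"
    unfolding \<Phi>_def using that by simp
  have \<Phi>_tensor [simp]: "\<Phi> (a \<otimes>\<^sub>C b) = (a \<otimes>\<^sub>C 1) \<otimes>\<^sub>C (b \<otimes>\<^sub>C 1)" for a b by (simp add: \<Phi>_def)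
  define J where "J v t = sweedler t (\<lambda>p q. ((1::'f) \<otimes>\<^sub>C p) \<otimes>\<^sub>C (q \<otimes>\<^sub>C v))"
    for v :: "'g uenv" and t :: "'g uenv \<otimes>\<^sub>C 'f"
  have [simp]: "clinear (\<lambda>x. J v (h x))" if "clinear h" for v and h :: "'z::complex_vector \<Rightarrow> _"
    unfolding J_def using that by simp
  have [simp]: "clinear (\<lambda>x. J (h x) t)" if "clinear h" for t and h :: "'z::complex_vector \<Rightarrow> _"
    unfolding J_def using that by simp
  have J_tensor [simp]: "J v (p \<otimes>\<^sub>C q) = (1 \<otimes>\<^sub>C p) \<otimes>\<^sub>C (q \<otimes>\<^sub>C v)" for p q v by (simp add: J_def)
  define \<Psi> where "\<Psi> u = sweedler (uenv_comult u) (\<lambda>u1 u2. J u2 (ucoact u1))" for u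
  let ?G = "\<lambda>x. sweedler (coact x) (\<lambda>x0 x1. (1 \<otimes>\<^sub>C uenv_of x0) \<otimes>\<^sub>C (x1 \<otimes>\<^sub>C 1)) +
      (1 \<otimes>\<^sub>C 1) \<otimes>\<^sub>C (1 \<otimes>\<^sub>C uenv_of x) :: ('f \<otimes>\<^sub>C 'g uenv) \<otimes>\<^sub>C ('f \<otimes>\<^sub>C 'g uenv)"
  note simps = bicrossed2.mul_sweedler bicrossed2.mul_arith bmul_base bmul_gen bmul_one
  have \<Psi>_gen: "\<Psi> (uenv_of x) = ?G x" for x
    by (simp add: \<Psi>_def uenv_comult_simps ucoact(2) ucoact_gen J_def sweedler_coact_gen)
  \<comment> \<open>the recursion of the coaction and the Leibniz rule for \<open>v\<close>, taken together,
    are left multiplication by the coproduct of the generator\<close>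
  have J_step: "J v (coact_gen x * t) + J v (act_second x t) + J (uenv_of x * v) t = bmul2 (?G x) (J v t)"
    for x v t
  proof (rule clinear_tensor_eqI[of _ _ t])
    fix p q
    have "J v (coact_gen x * (p \<otimes>\<^sub>C q)) =
        sweedler (coact x) (\<lambda>x0 x1. (1 \<otimes>\<^sub>C (uenv_of x0 * p)) \<otimes>\<^sub>C ((x1 * q) \<otimes>\<^sub>C v))"
      by (simp add: J_def coact_gen_def sweedler_times sweedler_sweedler)
    then show "J v (coact_gen x * (p \<otimes>\<^sub>C q)) + J v (act_second x (p \<otimes>\<^sub>C q)) + J (uenv_of x * v) (p \<otimes>\<^sub>C q) =
        bmul2 (?G x) (J v (p \<otimes>\<^sub>C q))"
      by (simp add: simps tensor_simps tensor_arith)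
  qed (simp_all add: bicrossed2.clinear_mul)
  show ?thesis
  proof (rule bicrossed_lift[OF bicrossed2.unital_algebra_axioms, of "\<lambda>a. \<Phi> (comult a)" \<Psi>])
    show "clinear (\<lambda>a. \<Phi> (comult a))" "clinear \<Psi>" "clinear bcomult"
      unfolding \<Psi>_def by (simp_all add: bcomult_linear)
    show "\<Phi> (comult 1) = (1 \<otimes>\<^sub>C 1) \<otimes>\<^sub>C (1 \<otimes>\<^sub>C 1)" "\<Psi> 1 = (1 \<otimes>\<^sub>C 1) \<otimes>\<^sub>C (1 \<otimes>\<^sub>C 1)"
      by (simp_all add: comult_unit \<Psi>_def uenv_comult_simps ucoact(2))
    show "\<Phi> (comult (a * b)) = bmul2 (\<Phi> (comult a)) (\<Phi> (comult b))" for a b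
      unfolding comult_mult \<Phi>_def
      by (simp add: sweedler_tensor_mult bicrossed2.mul_sweedler bmul_base)
    show "\<Psi> (uenv_of x * u) = bmul2 (\<Psi> (uenv_of x)) (\<Psi> u)" for x u
      unfolding \<Psi>_gen unfolding \<Psi>_def
      by (simp add: sweedler_uenv_comult_gen ucoact(3) clinearD[where f = "J _"] bicrossed2.mul_sweedler
          flip: J_step) 
    show "bmul2 (\<Psi> (uenv_of x)) (\<Phi> (comult a)) =
        bmul2 (\<Phi> (comult a)) (\<Psi> (uenv_of x)) + \<Phi> (comult (act x a))" for x a
      unfolding \<Psi>_gen comult_act
    proof (rule clinear_tensor_eqI[of _ _ "comult a"])
      fix p q
      show "bmul2 (?G x) (\<Phi> (p \<otimes>\<^sub>C q)) = bmul2 (\<Phi> (p \<otimes>\<^sub>C q)) (?G x) +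
          \<Phi> (sweedler (p \<otimes>\<^sub>C q) (\<lambda>a1 a2. sweedler (coact x) (\<lambda>x0 x1. act x0 a1 \<otimes>\<^sub>C (x1 * a2)) + a1 \<otimes>\<^sub>C act x a2))"
        by (simp add: simps tensor_simps tensor_arith sweedler_add clinearD[where f = \<Phi>] mult.commute
            \<Phi>_def sweedler_sweedler)
    qed (simp_all add: bicrossed2.clinear_mul)
    show "bcomult (a \<otimes>\<^sub>C u) = bmul2 (\<Phi> (comult a)) (\<Psi> u)" for a u
      unfolding \<Phi>_def \<Psi>_def J_def
      by (simp add: bicrossed_comult_def bicrossed2.mul_sweedler bmul_base)
  qed
qed

end

section \<open>The bicrossed product as a Hopf algebra\<close>

context g_hopf_algebra
begin

abbreviation "bantipode \<equiv> bicrossed_antipode antipode act coact"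
abbreviation bcounit :: "'f \<otimes>\<^sub>C 'g uenv \<Rightarrow> complex"
  where "bcounit \<equiv> bicrossed_functional counit uenv_counit"

lemma bantipode_linear: "clinear bantipode"
  unfolding bicrossed_antipode_def by simp

lemma bantipode_base: "bantipode (a \<otimes>\<^sub>C 1) = antipode a \<otimes>\<^sub>C 1"
  by (simp add: bicrossed_antipode_def ucoact(2) uenv_antipode_simps bmul_one)

lemma bantipode_gen: "bantipode (1 \<otimes>\<^sub>C uenv_of x) =
    - sweedler (coact x) (\<lambda>x0 x1. (1 \<otimes>\<^sub>C uenv_of x0) \<odot> (antipode x1 \<otimes>\<^sub>C 1))"
  by (simp add: bicrossed_antipode_def ucoact_gen sweedler_coact_gen uenv_antipode_simps tensor_arith
      bmul_arith sweedler_diff)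

text \<open>
  The image of the relation \<open>X a = a X + act x a\<close> under the antipode. Once Lie
  algebra elements are moved to the right of elements of \<open>'f\<close>, what remains is
  \<open>antipode_act\<close>.
\<close>
lemma bantipode_cross:
  "(antipode a \<otimes>\<^sub>C 1) \<odot> bantipode (1 \<otimes>\<^sub>C uenv_of x) =
    bantipode (1 \<otimes>\<^sub>C uenv_of x) \<odot> (antipode a \<otimes>\<^sub>C 1) + antipode (act x a) \<otimes>\<^sub>C 1"
proof -
  have 1: "(antipode a \<otimes>\<^sub>C 1) \<odot> ((1 \<otimes>\<^sub>C uenv_of x0) \<odot> (antipode x1 \<otimes>\<^sub>C 1)) =
      ((1 \<otimes>\<^sub>C uenv_of x0) \<odot> (antipode x1 \<otimes>\<^sub>C 1)) \<odot> (antipode a \<otimes>\<^sub>C 1) -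
      (act x0 (antipode a) * antipode x1) \<otimes>\<^sub>C 1" for x0 x1
    unfolding bicrossed.assoc bmul_base
    by (simp add: bmul_base bmul_commute bmul_arith act_derivation tensor_simps
        tensor_arith algebra_simps)
  show ?thesis
    unfolding bantipode_gen antipode_act
    by (simp add: bmul_arith bicrossed.mul_sweedler 1 sweedler_diff tensor_sweedler)
qed

text \<open>
  The antipode is the algebra map into the opposite algebra that the universal property provides.
\<close>
lemma bantipode_antimult: "bantipode (s \<odot> t) = bantipode t \<odot> bantipode s"
proof -
  define J where "J t = sweedler t (\<lambda>u0 u1. (1 \<otimes>\<^sub>C uenv_antipode u0) \<odot> (antipode u1 \<otimes>\<^sub>C 1))"
    for t :: "'g uenv \<otimes>\<^sub>C 'f"
  have [simp]: "clinear (\<lambda>x. J (h x))" if "clinear h" for h :: "'z::complex_vector \<Rightarrow> _"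
    unfolding J_def using that by simp
  have J_tensor [simp]: "J (u \<otimes>\<^sub>C a) = (1 \<otimes>\<^sub>C uenv_antipode u) \<odot> (antipode a \<otimes>\<^sub>C 1)" for u a
    by (simp add: J_def)
  have tensor: "bantipode (a \<otimes>\<^sub>C u) = J (ucoact u) \<odot> (antipode a \<otimes>\<^sub>C 1)" for a u
    by (simp add: bicrossed_antipode_def J_def bicrossed.mul_sweedler bicrossed.assoc bmul_base
        antipode_antimultiplicative)
  have gen: "J (ucoact (uenv_of x)) = bantipode (1 \<otimes>\<^sub>C uenv_of x)" for x
    by (simp add: tensor antipode_unit bicrossed.unit)
  have J_step: "J (coact_gen x * t) + J (act_second x t) = J t \<odot> bantipode (1 \<otimes>\<^sub>C uenv_of x)" for x t
  proof (rule clinear_tensor_eqI[of _ _ t])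
    fix p q
    have "J (coact_gen x * (p \<otimes>\<^sub>C q)) = (1 \<otimes>\<^sub>C uenv_antipode p) \<odot>
        (bantipode (1 \<otimes>\<^sub>C uenv_of x) \<odot> (antipode q \<otimes>\<^sub>C 1))"
      by (simp add: J_def coact_gen_def sweedler_times sweedler_sweedler uenv_antipode_simps tensor_arith
          bantipode_gen bmul_arith bicrossed.mul_sweedler sweedler_diff bicrossed.assoc bmul_base
          antipode_times flip: bmul_uenv)
    then show "J (coact_gen x * (p \<otimes>\<^sub>C q)) + J (act_second x (p \<otimes>\<^sub>C q)) =
        J (p \<otimes>\<^sub>C q) \<odot> bantipode (1 \<otimes>\<^sub>C uenv_of x)"
      by (simp add: bicrossed.assoc bantipode_cross bmul_arith)
  qed simp_all
  show ?thesis
  proof (rule bicrossed_lift[OF bicrossed.opposite, of "\<lambda>a. antipode a \<otimes>\<^sub>C 1" "\<lambda>u. J (ucoact u)"])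
    show "J (ucoact 1) = 1 \<otimes>\<^sub>C 1"
      by (simp add: ucoact(2) uenv_antipode_simps antipode_unit bmul_one)
    show "J (ucoact (uenv_of x * u)) = J (ucoact u) \<odot> J (ucoact (uenv_of x))" for x u
      unfolding gen by (simp add: ucoact(3) clinearD[where f = J] J_step)
    show "(antipode a \<otimes>\<^sub>C 1) \<odot> J (ucoact (uenv_of x)) =
        J (ucoact (uenv_of x)) \<odot> (antipode a \<otimes>\<^sub>C 1) + antipode (act x a) \<otimes>\<^sub>C 1" for x a
      unfolding gen by (rule bantipode_cross)
  qed (simp_all add: bantipode_linear tensor antipode_unit bmul_base antipode_antimultiplicative)
qed

lemma bcounit_character: "algebra_character bmul (1 \<otimes>\<^sub>C 1) bcounit"
    and bcounit_base: "bcounit (a \<otimes>\<^sub>C 1) = counit a"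
    and bcounit_gen: "bcounit (1 \<otimes>\<^sub>C uenv_of x) = 0"
  using bicrossed_character[of "\<lambda>x. 0"] uenv_character_simps[of "\<lambda>x::'g. 0"]
  by (simp_all add: uenv_counit_def)

lemma bcounit: "clinear bcounit" "bcounit (1 \<otimes>\<^sub>C 1) = 1" "bcounit (s \<odot> t) = bcounit s * bcounit t"
  using bcounit_character by (simp_all add: algebra_character_def)

lemma bcomult_one: "bcomult (1 \<otimes>\<^sub>C 1) = (1 \<otimes>\<^sub>C 1) \<otimes>\<^sub>C (1 \<otimes>\<^sub>C 1)"
  by (simp add: bcomult_base comult_unit)

lemmas clinear_bicrossed [simp] = clinear_comp[OF bcomult_linear] clinear_comp[OF bantipode_linear]
  clinear_comp[OF bcounit(1)]

text \<open>
  On \<open>a \<otimes>\<^sub>C 1\<close> this is coassociativity of \<open>'f\<close>. On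
  \<open>1 \<otimes>\<^sub>C uenv_of x\<close> it is coassociativity of the coaction, up to terms
  that are literally the same on both sides.
\<close>
lemma bcomult_coassoc:
  "sweedler (bcomult t) (\<lambda>a b. sweedler (bcomult a) (\<lambda>a1 a2. a1 \<otimes>\<^sub>C (a2 \<otimes>\<^sub>C b))) =
   sweedler (bcomult t) (\<lambda>a b. sweedler (bcomult b) (\<lambda>b1 b2. a \<otimes>\<^sub>C (b1 \<otimes>\<^sub>C b2)))"
proof (induction t rule: bicrossed_induct)
  case one
  show ?case by (simp add: bcomult_one)
next
  case (generator g t)
  have "sweedler (bcomult g) (\<lambda>a b. sweedler (bcomult a) (\<lambda>a1 a2. a1 \<otimes>\<^sub>C (a2 \<otimes>\<^sub>C b))) =
      sweedler (bcomult g) (\<lambda>a b. sweedler (bcomult b) (\<lambda>b1 b2. a \<otimes>\<^sub>C (b1 \<otimes>\<^sub>C b2)))"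
    using generator(1)
  proof (cases rule: generator_cases)
    case (base a)
    show ?thesis unfolding base
      by (simp add: bcomult_base sweedler_sweedler) (rule coassoc_apply; simp)
  next
    case (gen x)
    have "sweedler (coact x) (\<lambda>x0 x1. sweedler (coact x0) (\<lambda>y0 y1.
          (1 \<otimes>\<^sub>C uenv_of y0) \<otimes>\<^sub>C ((y1 \<otimes>\<^sub>C 1) \<otimes>\<^sub>C (x1 \<otimes>\<^sub>C 1)))) =
        sweedler (coact x) (\<lambda>x0 x1. sweedler (comult x1) (\<lambda>a b.
          ((1::'f) \<otimes>\<^sub>C uenv_of x0) \<otimes>\<^sub>C ((a \<otimes>\<^sub>C (1::'g uenv)) \<otimes>\<^sub>C (b \<otimes>\<^sub>C (1::'g uenv)))))"
      by (rule coact_coassoc_apply) simp_all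
    then show ?thesis unfolding gen
      by (simp add: bcomult_gen bcomult_base bcomult_one comult_unit sweedler_sweedler sweedler_add tensor_simps)
  qed
  then show ?case
    by (intro bicrossed.coassoc_mul) (use generator(2) in \<open>auto simp: bcomult_linear bcomult_mult\<close>)
next
  case (add s t)
  then show ?case by (simp add: clinearD[OF bcomult_linear])
qed

lemma bcounit_left: "sweedler (bcomult t) (\<lambda>a b. bcounit a *\<^sub>C b) = t"
  and bcounit_right: "sweedler (bcomult t) (\<lambda>a b. bcounit b *\<^sub>C a) = t"
proof (induction t rule: bicrossed_induct)
  case (generator g t)
  case 1
  have "sweedler (bcomult g) (\<lambda>a b. bcounit a *\<^sub>C b) = g" using generator(1)
  proof (cases rule: generator_cases)
    case (base a)
    have "sweedler (comult a) (\<lambda>a1 a2. counit a1 *\<^sub>C (a2 \<otimes>\<^sub>C 1)) = a \<otimes>\<^sub>C (1 :: 'g uenv)"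
      using arg_cong[OF counit_left[of a], of "\<lambda>a. a \<otimes>\<^sub>C 1"] by (simp add: tensor_sweedler tensor_simps)
    then show ?thesis by (simp add: base bcomult_base sweedler_sweedler bcounit_base)
  next
    case (gen x)
    show ?thesis by (simp add: gen bcomult_gen sweedler_sweedler bcounit_gen bcounit(2) sweedler_diff)
  qed
  with generator show ?case by (simp add: bicrossed.counit_mul[OF bcomult_mult bcounit(1,3)])
  case 2
  have "sweedler (bcomult g) (\<lambda>a b. bcounit b *\<^sub>C a) = g" using generator(1)
  proof (cases rule: generator_cases)
    case (base a)
    have "sweedler (comult a) (\<lambda>a1 a2. counit a2 *\<^sub>C (a1 \<otimes>\<^sub>C 1)) = a \<otimes>\<^sub>C (1 :: 'g uenv)"
      using arg_cong[OF counit_right[of a], of "\<lambda>a. a \<otimes>\<^sub>C 1"] by (simp add: tensor_sweedler tensor_simps)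
    then show ?thesis by (simp add: base bcomult_base sweedler_sweedler bcounit_base)
  next
    case (gen x)
    have "sweedler (coact x) (\<lambda>x0 x1. counit x1 *\<^sub>C (1 \<otimes>\<^sub>C uenv_of x0)) = (1::'f) \<otimes>\<^sub>C uenv_of x"
      using arg_cong[OF coact_counit[of x], of "\<lambda>x. 1 \<otimes>\<^sub>C uenv_of x"]
      by (simp add: clinear_of_sweedler[where F = "\<lambda>x. _ \<otimes>\<^sub>C uenv_of x"] tensor_simps uenv_of_simps)
    then show ?thesis by (simp add: gen bcomult_gen sweedler_sweedler bcounit_gen bcounit_base bcounit(2))
  qed
  with generator show ?case by (simp add: bicrossed.counit_mul[OF bcomult_mult bcounit(1,3)])
qed (simp_all add: bcomult_one bcounit clinearD[OF bcomult_linear])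

text \<open>
  For the generator of \<open>x\<close> the coproduct gives
  \<open>S(X\<^sub>0) X\<^sub>1 + X\<close>. The first term is
  \<open>- X\<^sub>0\<^sub>0 S(X\<^sub>0\<^sub>1) X\<^sub>1\<close>, which coassociativity and the
  antipode axiom of \<open>'f\<close> turn into \<open>- X\<close>.
\<close>
lemma bantipode_left: "sweedler (bcomult t) (\<lambda>a b. bantipode a \<odot> b) = bcounit t *\<^sub>C (1 \<otimes>\<^sub>C 1)"
  and bantipode_right: "sweedler (bcomult t) (\<lambda>a b. a \<odot> bantipode b) = bcounit t *\<^sub>C (1 \<otimes>\<^sub>C 1)"
proof (induction t rule: bicrossed_induct)
  case (generator g t)
  case 1
  have "sweedler (bcomult g) (\<lambda>a b. bantipode a \<odot> b) = bcounit g *\<^sub>C (1 \<otimes>\<^sub>C 1)" using generator(1)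
  proof (cases rule: generator_cases)
    case (base a)
    have "sweedler (comult a) (\<lambda>a1 a2. (antipode a1 * a2) \<otimes>\<^sub>C 1) = counit a *\<^sub>C (1 \<otimes>\<^sub>C (1 :: 'g uenv))"
      using arg_cong[OF antipode_left[of a], of "\<lambda>a. a \<otimes>\<^sub>C 1"] by (simp add: tensor_sweedler tensor_simps)
    then show ?thesis by (simp add: base bcomult_base sweedler_sweedler bcounit_base bantipode_base bmul_base)
  next
    case (gen x)
    have "sweedler (coact x) (\<lambda>x0 x1. sweedler (coact x0) (\<lambda>y0 y1.
          (1 \<otimes>\<^sub>C uenv_of y0) \<odot> ((antipode y1 * x1) \<otimes>\<^sub>C 1))) =
        sweedler (coact x) (\<lambda>x0 x1. sweedler (comult x1) (\<lambda>a b.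
          (1 \<otimes>\<^sub>C uenv_of x0) \<odot> ((antipode a * b) \<otimes>\<^sub>C 1)))"
      by (rule coact_coassoc_apply) simp_all
    also have "\<dots> = sweedler (coact x) (\<lambda>x0 x1.
          (1 \<otimes>\<^sub>C uenv_of x0) \<odot> ((sweedler (comult x1) (\<lambda>a b. antipode a * b)) \<otimes>\<^sub>C 1))"
      by (simp add: tensor_sweedler bicrossed.mul_sweedler)
    also have "\<dots> = sweedler (coact x) (\<lambda>x0 x1. 1 \<otimes>\<^sub>C uenv_of (counit x1 *\<^sub>C x0))"
      by (simp add: antipode_left tensor_simps bmul_arith bicrossed.unit uenv_of_simps)
    also have "\<dots> = 1 \<otimes>\<^sub>C uenv_of x"
      using arg_cong[OF coact_counit[of x], of "\<lambda>x. 1 \<otimes>\<^sub>C uenv_of x"]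
      by (simp add: clinear_of_sweedler[where F = "\<lambda>x. _ \<otimes>\<^sub>C uenv_of x"])
    finally show ?thesis
      by (simp add: gen bcomult_gen sweedler_sweedler bcounit_gen bantipode_gen bantipode_base antipode_unit
          bmul_arith bicrossed.mul_sweedler bicrossed.assoc bmul_base bmul_one sweedler_diff)
  qed
  from bicrossed.antipode_mul(1)[OF bcomult_mult bcounit(3) bantipode_linear bantipode_antimult this]
  show ?case using generator by blast
  case 2
  have "sweedler (bcomult g) (\<lambda>a b. a \<odot> bantipode b) = bcounit g *\<^sub>C (1 \<otimes>\<^sub>C 1)" using generator(1)
  proof (cases rule: generator_cases)
    case (base a)
    have "sweedler (comult a) (\<lambda>a1 a2. (a1 * antipode a2) \<otimes>\<^sub>C 1) = counit a *\<^sub>C (1 \<otimes>\<^sub>C (1 :: 'g uenv))"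
      using arg_cong[OF antipode_right[of a], of "\<lambda>a. a \<otimes>\<^sub>C 1"] by (simp add: tensor_sweedler tensor_simps)
    then show ?thesis by (simp add: base bcomult_base sweedler_sweedler bcounit_base bantipode_base bmul_base)
  next
    case (gen x)
    then show ?thesis
      by (simp add: bcomult_gen sweedler_sweedler bcounit_gen bantipode_gen bantipode_base bmul_one)
  qed
  from bicrossed.antipode_mul(2)[OF bcomult_mult bcounit(3) bantipode_linear bantipode_antimult this]
  show ?case using generator by blast
qed (simp_all add: bcomult_one bcounit clinearD[OF bcomult_linear] bantipode_base antipode_unit bmul_one
    scaleC_add_left clinearD[OF bcounit(1)])

sublocale bicrossed_hopf: hopf_algebra bmul "1 \<otimes>\<^sub>C 1" bcomult bcounit bantipode
  by (rule hopf_algebra.intro; rule bmul_bilinear bicrossed.assoc bicrossed.unit bcomult_linear bcomult_coassoc bcounit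
      bcounit_left bcounit_right bcomult_mult bcomult_one bantipode_linear bantipode_left bantipode_right)

end

section \<open>The derivative of a determinant\<close>

text \<open>
  Differentiating the Leibniz formula replaces one row at a time by its derivative. The cofactors
  along the replaced row do not see the replacement, so Laplace expansion along it gives the
  claim.
\<close>
lemma derivation_det:
  fixes D :: "'a::comm_ring_1 \<Rightarrow> 'a"
  assumes add: "\<And>x y. D (x + y) = D x + D y"
    and mult: "\<And>x y. D (x * y) = D x * y + x * D y"
    and A: "A \<in> carrier_mat n n"
  shows "D (det A) = (\<Sum>k<n. \<Sum>j<n. D (A $$ (k, j)) * cofactor A k j)"
proof -
  have zero: "D 0 = 0" using add[of 0 0] by simp
  have one: "D 1 = 0" using mult[of 1 1] by simp
  have minus: "D (- x) = - D x" for x using add[of x "- x"] zero by (simp add: add_eq_0_iff)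
  have sum: "D (\<Sum>i\<in>I. g i) = (\<Sum>i\<in>I. D (g i))" for g and I :: "'i set"
    by (induction I rule: infinite_finite_induct) (simp_all add: zero add)
  have sign: "D (signof p * x) = signof p * D x" for p :: "nat \<Rightarrow> nat" and x
    by (simp add: mult one minus sign_def)
  have prod: "D (\<Prod>i\<in>I. g i) = (\<Sum>k\<in>I. D (g k) * (\<Prod>i\<in>I - {k}. g i))"
    if "finite I" for g and I :: "nat set"
    using that
  proof (induction I)
    case (insert a I)
    have "(\<Prod>i\<in>insert a I - {k}. g i) = g a * (\<Prod>i\<in>I - {k}. g i)" if "k \<in> I" for k
      using that insert by (subst insert_Diff_if) auto
    moreover have "insert a I - {a} = I" using insert by auto
    ultimately show ?case
      using insert by (simp add: mult sum_distrib_left algebra_simps)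
  qed (simp add: one)
  define B where "B k = mat n n (\<lambda>(i, j). if i = k then D (A $$ (k, j)) else A $$ (i, j))" for k
  have B: "B k \<in> carrier_mat n n" for k by (simp add: B_def)
  have cof: "cofactor (B k) k j = cofactor A k j" if "k < n" "j < n" for k j
  proof -
    have "mat_delete (B k) k j = mat_delete A k j"
      using A that by (intro eq_matI) (auto simp: mat_delete_def B_def)
    then show ?thesis by (simp add: cofactor_def)
  qed
  have "D (det A) = (\<Sum>p | p permutes {0..<n}. \<Sum>k<n.
      signof p * (D (A $$ (k, p k)) * (\<Prod>i\<in>{0..<n} - {k}. A $$ (i, p i))))"
    by (simp add: det_def'[OF A] sum sign prod sum_distrib_left atLeast0LessThan)
  also have "\<dots> = (\<Sum>k<n. \<Sum>p | p permutes {0..<n}.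
      signof p * (D (A $$ (k, p k)) * (\<Prod>i\<in>{0..<n} - {k}. A $$ (i, p i))))"
    by (rule sum.swap)
  also have "\<dots> = (\<Sum>k<n. det (B k))"
  proof (intro sum.cong refl)
    fix k assume k: "k \<in> {..<n}"
    have "(\<Prod>i = 0..<n. B k $$ (i, p i)) = D (A $$ (k, p k)) * (\<Prod>i\<in>{0..<n} - {k}. A $$ (i, p i))"
      if "p permutes {0..<n}" for p
    proof -
      have p: "p i < n" if "i < n" for i
        using permutes_in_image[OF \<open>p permutes _\<close>, of i] that by simp
      have "(\<Prod>i = 0..<n. B k $$ (i, p i)) = B k $$ (k, p k) * (\<Prod>i\<in>{0..<n} - {k}. B k $$ (i, p i))"
        using k by (intro prod.remove) auto
      also have "(\<Prod>i\<in>{0..<n} - {k}. B k $$ (i, p i)) = (\<Prod>i\<in>{0..<n} - {k}. A $$ (i, p i))"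
        by (intro prod.cong refl) (use p in \<open>auto simp: B_def\<close>)
      finally show ?thesis using k p by (simp add: B_def)
    qed
    then show "(\<Sum>p | p permutes {0..<n}. signof p * (D (A $$ (k, p k)) *
        (\<Prod>i\<in>{0..<n} - {k}. A $$ (i, p i)))) = det (B k)"
      by (simp add: det_def'[OF B])
  qed
  also have "\<dots> = (\<Sum>k<n. \<Sum>j<n. D (A $$ (k, j)) * cofactor A k j)"
  proof (intro sum.cong refl)
    fix k assume k: "k \<in> {..<n}"
    then have "det (B k) = (\<Sum>j<n. B k $$ (k, j) * cofactor (B k) k j)"
      by (intro laplace_expansion_row[OF B]) simp
    then show "det (B k) = (\<Sum>j<n. D (A $$ (k, j)) * cofactor A k j)"
      using k by (simp add: cof) (simp add: B_def)
  qed
  finally show ?thesis .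
qed

section \<open>The coefficient matrix and its determinant\<close>

lemma sweedler_tensor_id: "sweedler t (\<lambda>a b. a \<otimes>\<^sub>C b) = t"
  by (rule clinear_tensor_eqI) simp_all

context g_hopf_algebra
begin

definition coord :: "nat \<Rightarrow> 'g \<Rightarrow> complex"
  where "coord k x = cvec.representation (X ` {..<N}) x (X k)"

lemma clinear_coord [simp]: "clinear g \<Longrightarrow> clinear (\<lambda>x. coord k (g x))"
  unfolding coord_def
  by (rule clinear_comp, rule clinearI)
    (simp_all add: cvec.representation_add cvec.representation_scale basis_independent basis_span)

lemma coord_basis: "i < N \<Longrightarrow> k < N \<Longrightarrow> coord k (X i) = (if i = k then 1 else 0)"
  using basis_inj by (simp add: coord_def cvec.representation_basis[OF basis_independent] inj_on_eq_iff)

lemma coord_sum: "k < N \<Longrightarrow> coord k (\<Sum>i<N. c i *\<^sub>C X i) = c k"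
  by (simp add: clinear_sum[OF clinear_coord[OF clinear_ident]]
      clinearD[OF clinear_coord[OF clinear_ident]] coord_basis if_distrib cong: if_cong)

lemma coord_expand: "(\<Sum>i<N. coord i x *\<^sub>C X i) = x"
  by (rule eq_on_basis) (simp_all add: coord_basis if_distrib[of "\<lambda>c. c *\<^sub>C _"] cong: if_cong)

text \<open>
  Coassociativity of the coaction on \<open>X j\<close>, read off at the coefficient of
  \<open>X k\<close>.
\<close>
lemma comult_coefficients:
  assumes "k < N" "j < N"
  shows "comult (f k j) = (\<Sum>i<N. f k i \<otimes>\<^sub>C f i j)"
proof -
  have "sweedler (coact (X j)) (\<lambda>x0 x1. sweedler (coact x0) (\<lambda>y0 y1. coord k y0 *\<^sub>C (y1 \<otimes>\<^sub>C x1))) =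
      sweedler (coact (X j)) (\<lambda>x0 x1. sweedler (comult x1) (\<lambda>a b. coord k x0 *\<^sub>C (a \<otimes>\<^sub>C b)))"
    by (rule coact_coassoc_apply) simp_all
  then show ?thesis
    using assms by (simp add: coact_coefficients sweedler_sum coord_basis sweedler_scaleC sweedler_tensor_id
        if_distrib[of "\<lambda>c. c *\<^sub>C _"] cong: if_cong)
qed

lemma counit_coefficients:
  assumes "k < N" "j < N"
  shows "counit (f k j) = (if k = j then 1 else 0)"
proof -
  have "coord k (sweedler (coact (X j)) (\<lambda>x0 x1. counit x1 *\<^sub>C x0)) = coord k (X j)"
    by (simp only: coact_counit)
  then show ?thesis
    using assms by (simp add: coact_coefficients sweedler_sum coord_sum coord_basis eq_commute)
qed

lemma antipode_coefficients:
  assumes "k < N" "j < N"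
  shows "(\<Sum>i<N. antipode (f k i) * f i j) = (if k = j then 1 else 0)"
    "(\<Sum>i<N. f k i * antipode (f i j)) = (if k = j then 1 else 0)"
  using antipode_left[of "f k j"] antipode_right[of "f k j"] assms
  by (simp_all add: comult_coefficients counit_coefficients sweedler_sum if_distrib[of "\<lambda>c. c *\<^sub>C _"] cong: if_cong)

abbreviation coefficient_matrix :: "'f mat"
  where "coefficient_matrix \<equiv> mat N N (\<lambda>(i, j). f i j)"

abbreviation \<sigma> :: 'f
  where "\<sigma> \<equiv> det coefficient_matrix"

text \<open>
  The coproduct of the coefficient matrix \<open>F\<close> is the product of the matrices
  \<open>F \<otimes> 1\<close> and \<open>1 \<otimes> F\<close> over the commutative ring
  \<open>'f \<otimes>\<^sub>C 'f\<close>, and ring homomorphisms and products commute with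
  determinants.
\<close>
lemma comult_sigma: "comult \<sigma> = \<sigma> \<otimes>\<^sub>C \<sigma>"
proof -
  interpret \<Delta>: comm_ring_hom comult
    by standard (simp_all only: comult_mult times_tensor_def comult_unit one_tensor_def
        clinearD[OF comult_linear])
  interpret l: comm_ring_hom "\<lambda>a::'f. a \<otimes>\<^sub>C (1::'f)"
    by standard (simp_all only: one_tensor_def tensor_simps tensor_arith tensor_times mult_1)
  interpret r: comm_ring_hom "\<lambda>a::'f. (1::'f) \<otimes>\<^sub>C a"
    by standard (simp_all only: one_tensor_def tensor_simps tensor_arith tensor_times mult_1)
  let ?L = "map_mat (\<lambda>a. a \<otimes>\<^sub>C (1::'f)) coefficient_matrix"
    and ?R = "map_mat (\<lambda>a. (1::'f) \<otimes>\<^sub>C a) coefficient_matrix"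
  have LR: "map_mat comult coefficient_matrix = ?L * ?R"
    by (rule eq_matI) (simp_all add: comult_coefficients scalar_prod_def atLeast0LessThan)
  have "comult \<sigma> = det (map_mat comult coefficient_matrix)" by (rule \<Delta>.hom_det[symmetric])
  also have "\<dots> = det ?L * det ?R" unfolding LR by (rule det_mult[of _ N]) simp_all
  also have "\<dots> = \<sigma> \<otimes>\<^sub>C \<sigma>" unfolding l.hom_det r.hom_det by simp
  finally show ?thesis .
qed

lemma counit_sigma: "counit \<sigma> = 1"
proof -
  interpret \<epsilon>: comm_ring_hom counit
    by standard (simp_all add: counit_mult counit_unit clinearD[OF counit_linear])
  have "map_mat counit coefficient_matrix = 1\<^sub>m N"
    by (rule eq_matI) (simp_all add: counit_coefficients)
  then show ?thesis using \<epsilon>.hom_det[of coefficient_matrix] by simp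
qed

lemma sigma_antipode: "\<sigma> * antipode \<sigma> = 1"
  using antipode_right[of \<sigma>] by (simp add: comult_sigma counit_sigma)

text \<open>
  The matrix with entries \<open>antipode (f i j)\<close> is inverse to the coefficient matrix, so
  the adjugate is \<open>\<sigma>\<close> times this matrix.
\<close>
lemma cofactor_coefficients:
  assumes "k < N" "j < N"
  shows "cofactor coefficient_matrix k j = \<sigma> * antipode (f j k)"
proof -
  let ?F = coefficient_matrix and ?G = "mat N N (\<lambda>(i, j). antipode (f i j))"
  have FG: "?F * ?G = 1\<^sub>m N"
    by (rule eq_matI) (simp_all add: scalar_prod_def atLeast0LessThan antipode_coefficients)
  have F: "?F \<in> carrier_mat N N" and G: "?G \<in> carrier_mat N N" by simp_all
  have "adj_mat ?F = adj_mat ?F * (?F * ?G)"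
    unfolding FG using adj_mat(1)[OF F] by simp
  also have "\<dots> = (\<sigma> \<cdot>\<^sub>m 1\<^sub>m N) * ?G"
    using assoc_mult_mat[OF adj_mat(1)[OF F] F G] adj_mat(3)[OF F] by simp
  also have "\<dots> = \<sigma> \<cdot>\<^sub>m ?G"
    using mult_smult_assoc_mat[OF one_carrier_mat G] left_mult_one_mat[OF G] by simp
  finally have "adj_mat ?F $$ (j, k) = (\<sigma> \<cdot>\<^sub>m ?G) $$ (j, k)" by simp
  then show ?thesis using assms by (simp add: adj_mat_def)
qed

text \<open>
  Jacobi's formula: the logarithmic derivative of a determinant is the trace of the derivative
  times the inverse matrix.
\<close>
lemma act_sigma: "act x \<sigma> = \<sigma> * (\<Sum>k<N. \<Sum>i<N. act x (f i k) * antipode (f k i))"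
proof -
  have "act x \<sigma> = (\<Sum>i<N. \<Sum>k<N. act x (coefficient_matrix $$ (i, k)) * cofactor coefficient_matrix i k)"
    by (rule derivation_det) (simp_all add: act_arith act_derivation)
  also have "\<dots> = (\<Sum>i<N. \<Sum>k<N. \<sigma> * (act x (f i k) * antipode (f k i)))"
    by (simp add: cofactor_coefficients mult.left_commute)
  also have "\<dots> = (\<Sum>k<N. \<Sum>i<N. \<sigma> * (act x (f i k) * antipode (f k i)))"
    by (rule sum.swap)
  finally show ?thesis by (simp add: sum_distrib_left)
qed

section \<open>The trace of the adjoint representation\<close>

abbreviation trace_ad :: "'g \<Rightarrow> complex"
  where "trace_ad \<equiv> (\<lambda>x. endo_trace (X ` {..<N}) (lie_bracket x))"

lemma clinear_bracket [simp]:
  fixes g :: "'z::complex_vector \<Rightarrow> 'g"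
  assumes "clinear g"
  shows "clinear (\<lambda>x. lie_bracket (g x) y)" "clinear (\<lambda>x. lie_bracket y (g x))"
  by (rule clinear_comp[OF _ assms], rule clinearI;
      simp add: lie_add_left lie_add_right lie_scaleC_left lie_scaleC_right)+

lemmas bracket_arith = clinearD[OF clinear_bracket(1)[OF clinear_ident]]
  clinearD[OF clinear_bracket(2)[OF clinear_ident]]

lemma trace_ad: "trace_ad x = (\<Sum>i<N. coord i (lie_bracket x (X i)))"
  unfolding endo_trace_def coord_def by (rule sum.reindex_cong[OF basis_inj]) simp_all

lemma trace_ad_basis: "s < N \<Longrightarrow> trace_ad (X s) = (\<Sum>i<N. C s i i)"
  by (simp add: trace_ad structure_constants coord_sum)

lemma clinear_trace_ad: "clinear trace_ad"
  unfolding trace_ad by simp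

lemma bracket_antisym: "lie_bracket y x = - lie_bracket x (y :: 'g)"
  using lie_alternating[of "x + y"]
  unfolding eq_neg_iff_add_eq_0 lie_add_left lie_add_right lie_alternating[of x] lie_alternating[of y]
  by (simp add: add.commute)

text \<open>
  By the Jacobi identity the adjoint map of a bracket is a commutator, and commutators have trace
  zero.
\<close>
lemma trace_ad_bracket: "trace_ad (lie_bracket x y) = 0"
proof -
  have expand: "coord i (lie_bracket x (lie_bracket y (X i))) =
      (\<Sum>j<N. coord j (lie_bracket y (X i)) * coord i (lie_bracket x (X j)))" for i x y
    by (subst coord_expand[of "lie_bracket y (X i)", symmetric])
      (simp add: clinear_sum[where f = "\<lambda>z. coord i (lie_bracket x z)"]
        clinearD[where f = "\<lambda>z. coord i (lie_bracket x z)"])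
  have "lie_bracket (lie_bracket x y) z = lie_bracket x (lie_bracket y z) - lie_bracket y (lie_bracket x z)" for z
  proof -
    have "lie_bracket x (lie_bracket y z) + lie_bracket y (lie_bracket z x) = - lie_bracket z (lie_bracket x y)"
      using lie_jacobi[of x y z] by (simp only: eq_neg_iff_add_eq_0)
    then show ?thesis
      by (simp add: bracket_antisym[of "lie_bracket x y" z] bracket_antisym[of x z] bracket_arith)
  qed
  then have "trace_ad (lie_bracket x y) = (\<Sum>i<N. coord i (lie_bracket x (lie_bracket y (X i)))) -
      (\<Sum>i<N. coord i (lie_bracket y (lie_bracket x (X i))))"
    by (simp add: trace_ad clinearD[OF clinear_coord[OF clinear_ident]] sum_subtractf)
  also have "(\<Sum>i<N. coord i (lie_bracket y (lie_bracket x (X i)))) =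
      (\<Sum>i<N. coord i (lie_bracket x (lie_bracket y (X i))))"
    unfolding expand by (subst sum.swap) (simp add: mult.commute)
  finally show ?thesis by simp
qed

text \<open>
  Contracting the compatibility of the coefficients with the inverse matrix turns the quadratic
  term into \<open>\<Sum>\<^sub>s (\<Sum>\<^sub>i C s i i) f s j\<close> and the linear term into
  \<open>\<Sum>\<^sub>k C k j k\<close>. Both are traces of adjoint maps, the second one with the
  opposite sign.
\<close>
lemma structure_contracted:
  assumes j: "j < N"
  shows "(\<Sum>i<N. \<Sum>k<N. (act (X k) (f i j) - act (X j) (f i k)) * antipode (f k i)) =
    (\<Sum>s<N. trace_ad (X s) *\<^sub>C f s j) - trace_ad (X j) *\<^sub>C 1"
proof -
  have "(\<Sum>i<N. \<Sum>k<N. (act (X k) (f i j) - act (X j) (f i k)) * antipode (f k i)) =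
      (\<Sum>i<N. \<Sum>k<N. \<Sum>s<N. \<Sum>r<N. C s r i *\<^sub>C (f s j * (f r k * antipode (f k i)))) +
      (\<Sum>i<N. \<Sum>k<N. \<Sum>l<N. C k j l *\<^sub>C (antipode (f k i) * f i l))"
    by (simp add: coefficients_structure j distrib_left sum_distrib_left sum.distrib
        mult_scaleC_right mult.assoc mult.commute mult.left_commute)
  also have "(\<Sum>i<N. \<Sum>k<N. \<Sum>s<N. \<Sum>r<N. C s r i *\<^sub>C (f s j * (f r k * antipode (f k i)))) =
      (\<Sum>i<N. \<Sum>s<N. \<Sum>k<N. \<Sum>r<N. C s r i *\<^sub>C (f s j * (f r k * antipode (f k i))))"
    by (intro sum.cong refl sum.swap)
  also have "\<dots> = (\<Sum>i<N. \<Sum>s<N. \<Sum>r<N. \<Sum>k<N. C s r i *\<^sub>C (f s j * (f r k * antipode (f k i))))"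
    by (intro sum.cong refl sum.swap)
  also have "\<dots> = (\<Sum>i<N. \<Sum>s<N. \<Sum>r<N. C s r i *\<^sub>C (f s j * (if r = i then 1 else 0)))"
    by (simp add: antipode_coefficients flip: sum_distrib_left cvec.scale_sum_right)
  also have "\<dots> = (\<Sum>i<N. \<Sum>s<N. C s i i *\<^sub>C f s j)"
    by (simp add: if_distrib[of "\<lambda>c. _ *\<^sub>C (_ * c)"] cong: if_cong)
  also have "\<dots> = (\<Sum>s<N. trace_ad (X s) *\<^sub>C f s j)"
    by (subst sum.swap) (simp add: trace_ad_basis cvec.scale_sum_left)
  also have "(\<Sum>i<N. \<Sum>k<N. \<Sum>l<N. C k j l *\<^sub>C (antipode (f k i) * f i l)) =
      (\<Sum>k<N. \<Sum>i<N. \<Sum>l<N. C k j l *\<^sub>C (antipode (f k i) * f i l))"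
    by (rule sum.swap)
  also have "\<dots> = (\<Sum>k<N. \<Sum>l<N. \<Sum>i<N. C k j l *\<^sub>C (antipode (f k i) * f i l))"
    by (intro sum.cong refl sum.swap)
  also have "\<dots> = (\<Sum>k<N. \<Sum>l<N. C k j l *\<^sub>C (if k = l then 1 else 0))"
    by (simp add: antipode_coefficients flip: cvec.scale_sum_right)
  also have "\<dots> = (\<Sum>k<N. C k j k *\<^sub>C 1)"
    by (simp add: if_distrib[of "\<lambda>c. _ *\<^sub>C c"] cong: if_cong)
  also have "\<dots> = - (trace_ad (X j) *\<^sub>C 1)"
  proof -
    have "C k j k = - C j k k" if k: "k < N" for k
    proof -
      have "coord k (lie_bracket (X k) (X j)) = - coord k (lie_bracket (X j) (X k))"
        by (simp add: bracket_antisym[of "X k"] clinearD[OF clinear_coord[OF clinear_ident]])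
      then show ?thesis using j k by (simp add: structure_constants coord_sum)
    qed
    then show ?thesis by (simp add: trace_ad_basis j cvec.scale_sum_left sum_negf)
  qed
  finally show ?thesis by simp
qed

text \<open>
  The left side is what conjugation by \<open>\<sigma>\<close> adds to \<open>X j\<close>, and the
  right side is what the square of the twisted antipode adds. By the product rule and Jacobi's
  formula they are \<open>- \<Sum> act (X j) (f i k) S(f k i)\<close> and the trace terms minus
  \<open>\<Sum> act (X k) (f i j) S(f k i)\<close>, so the claim is the contracted compatibility.
\<close>
lemma sigma_act_antipode:
  assumes j: "j < N"
  shows "\<sigma> * act (X j) (antipode \<sigma>) = (\<Sum>i<N. trace_ad (X i) *\<^sub>C f i j) - trace_ad (X j) *\<^sub>C 1 +
    (\<Sum>i<N. \<Sum>k<N. f i j * act (X k) (antipode (f k i)))"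
proof -
  have "act (X j) \<sigma> * antipode \<sigma> + \<sigma> * act (X j) (antipode \<sigma>) = 0"
    using sigma_antipode act_derivation[of "X j" \<sigma> "antipode \<sigma>"] by simp
  then have 1: "\<sigma> * act (X j) (antipode \<sigma>) = - (act (X j) \<sigma> * antipode \<sigma>)"
    by (simp add: eq_neg_iff_add_eq_0 add.commute)
  have "act (X j) \<sigma> * antipode \<sigma> = (\<sigma> * antipode \<sigma>) * (\<Sum>k<N. \<Sum>i<N. act (X j) (f i k) * antipode (f k i))"
    unfolding act_sigma by (simp only: ac_simps)
  then have 2: "act (X j) \<sigma> * antipode \<sigma> = (\<Sum>i<N. \<Sum>k<N. act (X j) (f i k) * antipode (f k i))"
    unfolding sigma_antipode by (subst sum.swap) simp
  have "(\<Sum>i<N. f i j * act (X k) (antipode (f k i))) = - (\<Sum>i<N. act (X k) (f i j) * antipode (f k i))"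
    if "k < N" for k
  proof -
    have "act (X k) (\<Sum>i<N. antipode (f k i) * f i j) = 0"
      using that j by (simp add: antipode_coefficients act_arith)
    then have "(\<Sum>i<N. act (X k) (antipode (f k i)) * f i j) + (\<Sum>i<N. antipode (f k i) * act (X k) (f i j)) = 0"
      by (simp add: clinear_sum[OF clinear_act(2)[OF clinear_ident]] act_derivation sum.distrib)
    then show ?thesis by (simp add: eq_neg_iff_add_eq_0 mult.commute)
  qed
  then have 3: "(\<Sum>i<N. \<Sum>k<N. f i j * act (X k) (antipode (f k i))) =
      - (\<Sum>i<N. \<Sum>k<N. act (X k) (f i j) * antipode (f k i))"
    by (subst (1 2) sum.swap) (simp add: sum_negf)
  show ?thesis
    unfolding 1 2 3 structure_contracted[OF j, symmetric]
    by (simp add: left_diff_distrib sum_subtractf)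
qed

end

section \<open>The modular pair in involution\<close>

lemma (in unital_algebra) algebra_inverse_eq:
  assumes "mul s t = e" "mul t s = e"
  shows "algebra_inverse mul e s = t"
  unfolding algebra_inverse_def
proof (rule the_equality)
  fix r assume r: "mul s r = e \<and> mul r s = e"
  have "r = mul r (mul s t)" by (simp add: assms unit)
  also have "\<dots> = t" using r by (simp add: unit flip: assoc)
  finally show "r = t" .
qed (simp add: assms)

context g_hopf_algebra
begin

abbreviation \<delta> :: "'f \<otimes>\<^sub>C 'g uenv \<Rightarrow> complex"
  where "\<delta> \<equiv> bicrossed_functional counit (uenv_character trace_ad)"

lemmas delta_character = bicrossed_character(1)[OF clinear_trace_ad trace_ad_bracket]

lemma delta: "clinear \<delta>" "\<delta> (1 \<otimes>\<^sub>C 1) = 1"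
  using delta_character by (simp_all add: algebra_character_def)

lemma delta_base: "\<delta> (a \<otimes>\<^sub>C 1) = counit a" and delta_gen: "\<delta> (1 \<otimes>\<^sub>C uenv_of x) = trace_ad x"
  using bicrossed_character(2)[OF clinear_trace_ad trace_ad_bracket]
    uenv_character_simps[OF clinear_trace_ad trace_ad_bracket]
  by (simp_all add: counit_unit)

abbreviation "twisted \<equiv> twisted_antipode bcomult bantipode \<delta>"

lemmas twisted_props = bicrossed_hopf.twisted_antipode_antimultiplicative[OF delta_character]

lemma twisted_base: "twisted (a \<otimes>\<^sub>C 1) = antipode a \<otimes>\<^sub>C 1"
proof -
  note [simp] = clinear_comp[OF delta(1)]
  have "twisted (a \<otimes>\<^sub>C 1) = sweedler (comult a) (\<lambda>a1 a2. counit a1 *\<^sub>C (antipode a2 \<otimes>\<^sub>C 1))"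
    by (simp add: twisted_antipode_def bcomult_base sweedler_sweedler delta_base bantipode_base)
  also have "\<dots> = antipode (sweedler (comult a) (\<lambda>a1 a2. counit a1 *\<^sub>C a2)) \<otimes>\<^sub>C 1"
    by (simp add: clinear_of_sweedler[OF antipode_linear] clinearD[OF antipode_linear]
        tensor_sweedler tensor_simps)
  finally show ?thesis by (simp add: counit_left)
qed

lemma twisted_gen:
  assumes "j < N"
  shows "twisted (1 \<otimes>\<^sub>C uenv_of (X j)) = (\<Sum>i<N. trace_ad (X i) *\<^sub>C antipode (f i j)) \<otimes>\<^sub>C 1 -
    (\<Sum>i<N. (1 \<otimes>\<^sub>C uenv_of (X i)) \<odot> (antipode (f i j) \<otimes>\<^sub>C 1))"
proof -
  note [simp] = clinear_comp[OF delta(1)]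
  show ?thesis
    using assms
    by (simp add: twisted_antipode_def bcomult_gen delta_gen delta(2) bantipode_gen bantipode_base
        coact_coefficients sweedler_sum tensor_sum tensor_simps)
qed

text \<open>
  Both sides are \<open>X j\<close> plus a correction in \<open>'f\<close>. On the left,
  antimultiplicativity gives \<open>f i j * twisted (X i)\<close> for each term
  \<open>X i S(f i j)\<close> of the inner twisted antipode, and moving the resulting
  \<open>X k\<close> to the right of \<open>S(f k i)\<close> produces the derivatives.
\<close>
lemma twisted_twice_gen:
  assumes j: "j < N"
  shows "twisted (twisted (1 \<otimes>\<^sub>C uenv_of (X j))) =
    (\<sigma> \<otimes>\<^sub>C 1) \<odot> (1 \<otimes>\<^sub>C uenv_of (X j)) \<odot> (antipode \<sigma> \<otimes>\<^sub>C 1)"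
proof -
  let ?X = "\<lambda>i. uenv_of (X i)" and ?t = "\<lambda>i. trace_ad (X i)" and ?S = antipode
  note TD = clinearD[OF twisted_props(1)] clinear_sum[OF twisted_props(1)]
  have S2: "?S (?S a) = a" for a by (rule antipode_involutive) (rule mult.commute)
  have inner: "(f i j \<otimes>\<^sub>C 1) \<odot> twisted (1 \<otimes>\<^sub>C ?X i) =
      (\<Sum>k<N. ?t k *\<^sub>C (f i j * ?S (f k i))) \<otimes>\<^sub>C 1 - (\<Sum>k<N. f i j * act (X k) (?S (f k i))) \<otimes>\<^sub>C 1 -
      (\<Sum>k<N. (f i j * ?S (f k i)) \<otimes>\<^sub>C ?X k)" if "i < N" for i
    using that
    by (simp add: twisted_gen bmul_arith bicrossed.mul_sum bmul_commute bmul_base tensor_sum tensor_simps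
        sum.distrib)
  have swap: "(\<Sum>i<N. \<Sum>k<N. ?t k *\<^sub>C (f i j * ?S (f k i))) = ?t j *\<^sub>C 1"
  proof -
    have "(\<Sum>i<N. ?t k *\<^sub>C (f i j * ?S (f k i))) = ?t k *\<^sub>C (if k = j then 1 else 0)" if "k < N" for k
      using antipode_coefficients(1)[OF that j] by (simp add: mult.commute flip: cvec.scale_sum_right)
    then show ?thesis
      by (subst sum.swap) (simp add: j if_distrib[of "\<lambda>c. _ *\<^sub>C c"] cong: if_cong)
  qed
  have swap': "(\<Sum>i<N. \<Sum>k<N. (f i j * ?S (f k i)) \<otimes>\<^sub>C ?X k) = 1 \<otimes>\<^sub>C ?X j"
  proof -
    have "(\<Sum>i<N. (f i j * ?S (f k i)) \<otimes>\<^sub>C ?X k) = (if k = j then 1 else 0) \<otimes>\<^sub>C ?X k" if "k < N" for k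
      using antipode_coefficients(1)[OF that j] by (simp add: mult.commute flip: tensor_sum(1))
    then show ?thesis
      by (subst sum.swap) (simp add: j tensor_arith if_distrib[of "\<lambda>c. c \<otimes>\<^sub>C _"] cong: if_cong)
  qed
  have "twisted (twisted (1 \<otimes>\<^sub>C ?X j)) = (\<Sum>i<N. ?t i *\<^sub>C f i j) \<otimes>\<^sub>C 1 - (\<Sum>i<N. (f i j \<otimes>\<^sub>C 1) \<odot> twisted (1 \<otimes>\<^sub>C ?X i))"
    unfolding twisted_gen[OF j]
    by (simp add: TD twisted_props(3) twisted_base S2 clinear_sum[OF antipode_linear] clinearD[OF antipode_linear])
  also have "(\<Sum>i<N. (f i j \<otimes>\<^sub>C 1) \<odot> twisted (1 \<otimes>\<^sub>C ?X i)) =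
      (\<Sum>i<N. \<Sum>k<N. ?t k *\<^sub>C (f i j * ?S (f k i))) \<otimes>\<^sub>C 1 -
      (\<Sum>i<N. \<Sum>k<N. f i j * act (X k) (?S (f k i))) \<otimes>\<^sub>C 1 -
      (\<Sum>i<N. \<Sum>k<N. (f i j * ?S (f k i)) \<otimes>\<^sub>C ?X k)"
    by (simp add: inner sum_subtractf flip: tensor_sum(1))
  also have "(\<Sum>i<N. ?t i *\<^sub>C f i j) \<otimes>\<^sub>C 1 - \<dots> = (\<sigma> * act (X j) (?S \<sigma>)) \<otimes>\<^sub>C 1 + 1 \<otimes>\<^sub>C ?X j"
    unfolding swap swap' sigma_act_antipode[OF j] by (simp add: tensor_simps tensor_arith)
  also have "\<dots> = (\<sigma> \<otimes>\<^sub>C 1) \<odot> (1 \<otimes>\<^sub>C ?X j) \<odot> (?S \<sigma> \<otimes>\<^sub>C 1)"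
    unfolding bicrossed.assoc by (simp add: bmul_commute bmul_arith bmul_base sigma_antipode)
  finally show ?thesis .
qed

text \<open>
  Both sides are algebra endomorphisms, the left one as the square of an antimultiplicative map,
  so they are compared on generators. On \<open>'f\<close> both are the identity, because the
  antipode of a commutative Hopf algebra is an involution and \<open>\<sigma>\<close> is central
  in \<open>'f\<close>.
\<close>
lemma twisted_involution: "twisted (twisted t) = (\<sigma> \<otimes>\<^sub>C 1) \<odot> t \<odot> (antipode \<sigma> \<otimes>\<^sub>C 1)"
proof (induction t rule: bicrossed_induct)
  case one
  show ?case by (simp add: twisted_props(2) bicrossed.unit bmul_base sigma_antipode)
next
  case (generator g t)
  have inv: "(antipode \<sigma> \<otimes>\<^sub>C 1) \<odot> (\<sigma> \<otimes>\<^sub>C (1::'g uenv)) = 1 \<otimes>\<^sub>C 1"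
    by (simp add: bmul_base sigma_antipode mult.commute[of "antipode _"])
  have g: "twisted (twisted g) = (\<sigma> \<otimes>\<^sub>C 1) \<odot> g \<odot> (antipode \<sigma> \<otimes>\<^sub>C 1)" using generator(1)
  proof (cases rule: generator_cases)
    case (base a)
    have "\<sigma> * a * antipode \<sigma> = a * (\<sigma> * antipode \<sigma>)" by (simp only: ac_simps)
    moreover have "antipode (antipode a) = a" by (rule antipode_involutive) (rule mult.commute)
    ultimately show ?thesis by (simp add: base twisted_base bmul_base sigma_antipode)
  next
    case (gen x)
    note [simp] = clinear_comp[OF twisted_props(1)]
    show ?thesis unfolding gen
      by (rule eq_on_basis[of "\<lambda>x. twisted (twisted (1 \<otimes>\<^sub>C uenv_of x))"]) (simp_all add: twisted_twice_gen)
  qed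
  have "twisted (twisted (g \<odot> t)) = (\<sigma> \<otimes>\<^sub>C 1) \<odot> (g \<odot> (((antipode \<sigma> \<otimes>\<^sub>C 1) \<odot> (\<sigma> \<otimes>\<^sub>C 1)) \<odot> (t \<odot> (antipode \<sigma> \<otimes>\<^sub>C 1))))"
    unfolding twisted_props(3) g generator(2) bicrossed.assoc ..
  then show ?case unfolding inv by (simp only: bicrossed.unit bicrossed.assoc)
next
  case (add s t)
  then show ?case by (simp add: clinearD[OF twisted_props(1)] bmul_arith)
qed

lemma bicrossed_modular_pair: "modular_pair_in_involution bmul (1 \<otimes>\<^sub>C 1) bcomult bcounit bantipode \<delta> (\<sigma> \<otimes>\<^sub>C 1)"
proof
  show "algebra_character bmul (1 \<otimes>\<^sub>C 1) \<delta>" by (rule delta_character)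
  show "group_like bcomult bcounit (\<sigma> \<otimes>\<^sub>C 1)"
    by (simp add: group_like_def bcomult_base comult_sigma bcounit_base counit_sigma)
  show "\<delta> (\<sigma> \<otimes>\<^sub>C 1) = 1" by (simp add: delta_base counit_sigma)
  have "algebra_inverse bmul (1 \<otimes>\<^sub>C 1) (\<sigma> \<otimes>\<^sub>C 1) = antipode \<sigma> \<otimes>\<^sub>C 1"
    by (rule bicrossed.algebra_inverse_eq)
      (simp_all add: bmul_base sigma_antipode mult.commute[of "antipode _"])
  then show "twisted (twisted t) = bmul (bmul (\<sigma> \<otimes>\<^sub>C 1) t) (algebra_inverse bmul (1 \<otimes>\<^sub>C 1) (\<sigma> \<otimes>\<^sub>C 1))" for t
    by (simp add: twisted_involution)
qed

end

theorem theorem4p1p2: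
  fixes comult :: "'f::{complex_algebra_1, comm_ring_1} \<Rightarrow> 'f \<otimes>\<^sub>C 'f"
    and counit :: "'f \<Rightarrow> complex" and antipode :: "'f \<Rightarrow> 'f"
    and N :: nat and X :: "nat \<Rightarrow> 'g::complex_lie_algebra"
    and C :: "nat \<Rightarrow> nat \<Rightarrow> nat \<Rightarrow> complex"
    and act :: "'g \<Rightarrow> 'f \<Rightarrow> 'f" and coact :: "'g \<Rightarrow> 'g \<otimes>\<^sub>C 'f" and f :: "nat \<Rightarrow> nat \<Rightarrow> 'f"
  assumes "g_hopf_algebra comult counit antipode N X C act coact f"
  shows "modular_pair_in_involution
    (bicrossed_mult act) (1 \<otimes>\<^sub>C 1) (bicrossed_comult comult act coact)
    (bicrossed_functional counit uenv_counit) (bicrossed_antipode antipode act coact)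
    (bicrossed_functional counit
      (uenv_character (\<lambda>x. endo_trace (X ` {..<N}) (lie_bracket x))))
    (det (mat N N (\<lambda>(i, j). f i j)) \<otimes>\<^sub>C (1 :: 'g uenv))"
  by (rule g_hopf_algebra.bicrossed_modular_pair[OF assms])

end
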